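(* Let $\Omega\subset\mathbb{R}^2$ be a bounded polygonal Lipschitz domain, $T>0$, and let $\gamma_0\in(1/2,1]$ be the elliptic regularity index of the biharmonic operator on $\Omega$ with clamped boundary conditions. Let $u$ be the weak solution of the biharmonic wave problem $u_{tt}+\Delta^2u=f$ in $\Omega\times(0,T]$, $u=\partial u/\partial n=0$ on $\partial\Omega\times(0,T]$, $u(0)=u^0$, $u_t(0)=v^0$. Assume $$u^0\in D(A^2),\quad v^0\in D(A^{3/2}),\quad f(0)\in D(A),\quad f_t(0)\in D(A^{1/2}),\quad f_{tt}(0)\in L^2(\Omega),$$ $$f,\ f_t,\ f_{tt},\ f_{ttt}\in L^2(0,T;L^2(\Omega)).$$ Then the norms $$\|u\|_{L^\infty(0,T;H^{2+\gamma_0}(\Omega))},\ \|u_t\|_{L^\infty(0,T;H^{2+\gamma_0}(\Omega))},\ \|u_{tt}\|_{L^\infty(0,T;L^2(\Omega))},\ \|u_{tt}\|_{L^\infty(0,T;H^{2+\gamma_0}(\Omega))},$$ $$\|u_{ttt}\|_{L^\infty(0,T;L^2(\Omega))},\ \|u_{tttt}\|_{L^\infty(0,T;L^2(\Omega))}$$ are bounded (finite).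
   Context: Weak solution: $u\in C^0([0,T];H^2_0(\Omega))\cap C^1([0,T];L^2(\Omega))$ is the unique function with $(u_{tt},v)+a(u,v)=(f,v)$ for all $v\in H^2_0(\Omega)$ and $t\in(0,T)$, $u(0)=u^0$, $u_t(0)=v^0$, where $(\cdot,\cdot)$ is the $L^2(\Omega)$ inner product and $a(w,v)=\int_\Omega D^2w:D^2v\,dx$ (Hessians). Spectral spaces: let $0<\lambda_1\le\lambda_2\le\dots\to\infty$ be the eigenvalues and $\{\psi_n\}$ the eigenfunctions, forming an orthonormal basis of $L^2(\Omega)$, of $\Delta^2\psi=\lambda\psi$ in $\Omega$, $\psi=\partial\psi/\partial n=0$ on $\partial\Omega$. The operator $A$ is $A\psi=\Delta^2\psi$ with $D(A)=\{\psi\in H^2_0(\Omega):\Delta^2\psi\in L^2(\Omega)\}$. For real $r\ge0$, $A^rw=\sum_n\lambda_n^r(w,\psi_n)\psi_n$ with domain $D(A^r)=\{w\in L^2(\Omega):\sum_n\lambda_n^{2r}|(w,\psi_n)|^2<\infty\}$ and norm $\|w\|_{D(A^r)}=\big(\sum_n\lambda_n^{2r}|(w,\psi_n)|^2\big)^{1/2}$. In particular $D(A^0)=L^2(\Omega)$ and $D(A^{1/2})=H^2_0(\Omega)$. The elliptic regularity index $\gamma_0\in(1/2,1]$ is a number, depending only on $\Omega$, for which $D(A)\subset H^2_0(\Omega)\cap H^{2+\gamma_0}(\Omega)$ with $\|w\|_{H^{2+\gamma_0}(\Omega)}\lesssim\|w\|_{D(A)}$. *)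

theory Defs
  imports "HOL-Analysis.Analysis"
begin

section \<open>Polygonal Lipschitz domains in the plane\<close>

definition lipschitz_domain :: "(real^2) set \<Rightarrow> bool" where
  "lipschitz_domain \<Omega> \<longleftrightarrow>
     open \<Omega> \<and> connected \<Omega> \<and> \<Omega> \<noteq> {} \<and>
     (\<forall>p \<in> frontier \<Omega>. \<exists>e1 e2 r g L.
        norm e1 = 1 \<and> norm e2 = 1 \<and> e1 \<bullet> e2 = 0 \<and> r > 0 \<and>
        L-lipschitz_on (UNIV::real set) (g :: real \<Rightarrow> real) \<and>
        \<Omega> \<inter> ball p r = {x \<in> ball p r. (x - p) \<bullet> e2 > g ((x - p) \<bullet> e1)})"

definition polygonal_boundary :: "(real^2) set \<Rightarrow> bool" where
  "polygonal_boundary \<Omega> \<longleftrightarrow>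
     (\<exists>S. finite S \<and> frontier \<Omega> = (\<Union>(a, b)\<in>S. closed_segment a b))"

definition bounded_polygonal_lipschitz_domain :: "(real^2) set \<Rightarrow> bool" where
  "bounded_polygonal_lipschitz_domain \<Omega> \<longleftrightarrow>
     bounded \<Omega> \<and> lipschitz_domain \<Omega> \<and> polygonal_boundary \<Omega>"

section \<open>The space of square-integrable functions\<close>

text \<open>Elements of the function spaces below are represented by functions rather than by
  classes modulo null sets; accordingly the norms are seminorms on representatives.\<close>

definition L2 :: "(real^2) set \<Rightarrow> (real^2 \<Rightarrow> real) set" where
  "L2 \<Omega> = {w. w \<in> borel_measurable (lebesgue_on \<Omega>) \<and>
               integrable (lebesgue_on \<Omega>) (\<lambda>x. (w x)\<^sup>2)}"

definition l2_inner :: "(real^2) set \<Rightarrow> (real^2 \<Rightarrow> real) \<Rightarrow> (real^2 \<Rightarrow> real) \<Rightarrow> real" where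
  "l2_inner \<Omega> w v = (LINT x|lebesgue_on \<Omega>. w x * v x)"

definition l2_norm :: "(real^2) set \<Rightarrow> (real^2 \<Rightarrow> real) \<Rightarrow> real" where
  "l2_norm \<Omega> w = sqrt (l2_inner \<Omega> w w)"

section \<open>Test functions and weak derivatives in space\<close>

definition partial_d :: "2 \<Rightarrow> (real^2 \<Rightarrow> real) \<Rightarrow> real^2 \<Rightarrow> real" where
  "partial_d i \<phi> x = frechet_derivative \<phi> (at x) (axis i 1)"

text \<open>Derivatives are indexed by lists of coordinate directions, so the derivatives
  of order \<open>m\<close> are all entries of the tensor \<open>D\<^sup>m\<close>.\<close>

primrec iter_partial :: "2 list \<Rightarrow> (real^2 \<Rightarrow> real) \<Rightarrow> real^2 \<Rightarrow> real" where
  "iter_partial [] \<phi> = \<phi>"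
| "iter_partial (i # \<alpha>) \<phi> = partial_d i (iter_partial \<alpha> \<phi>)"

definition test_functions :: "(real^2) set \<Rightarrow> (real^2 \<Rightarrow> real) set" where
  "test_functions \<Omega> = {\<phi>. (\<forall>\<alpha>. iter_partial \<alpha> \<phi> differentiable_on UNIV) \<and>
     compact (closure {x. \<phi> x \<noteq> 0}) \<and> closure {x. \<phi> x \<noteq> 0} \<subseteq> \<Omega>}"

definition has_weak_deriv ::
    "(real^2) set \<Rightarrow> 2 list \<Rightarrow> (real^2 \<Rightarrow> real) \<Rightarrow> (real^2 \<Rightarrow> real) \<Rightarrow> bool" where
  "has_weak_deriv \<Omega> \<alpha> w g \<longleftrightarrow>
     (\<forall>\<phi> \<in> test_functions \<Omega>.
        l2_inner \<Omega> w (iter_partial \<alpha> \<phi>) = (-1) ^ length \<alpha> * l2_inner \<Omega> g \<phi>)"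

definition weak_deriv :: "(real^2) set \<Rightarrow> 2 list \<Rightarrow> (real^2 \<Rightarrow> real) \<Rightarrow> real^2 \<Rightarrow> real" where
  "weak_deriv \<Omega> \<alpha> w =
     (if \<alpha> = [] then w else (SOME g. g \<in> L2 \<Omega> \<and> has_weak_deriv \<Omega> \<alpha> w g))"

section \<open>Sobolev spaces\<close>

definition slobodeckij :: "(real^2) set \<Rightarrow> real \<Rightarrow> (real^2 \<Rightarrow> real) \<Rightarrow> ennreal" where
  "slobodeckij \<Omega> \<sigma> g =
     (\<integral>\<^sup>+x. \<integral>\<^sup>+y. ennreal ((g x - g y)\<^sup>2 / dist x y powr (2 + 2 * \<sigma>))
        \<partial>lebesgue_on \<Omega> \<partial>lebesgue_on \<Omega>)"

text \<open>Sobolev--Slobodeckij space of real order \<open>s \<ge> 0\<close>; for integer \<open>s\<close> this is the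
  usual integer-order space.\<close>

definition sobolev :: "(real^2) set \<Rightarrow> real \<Rightarrow> (real^2 \<Rightarrow> real) set" where
  "sobolev \<Omega> s = {w \<in> L2 \<Omega>.
     (\<forall>\<alpha>. length \<alpha> \<le> nat \<lfloor>s\<rfloor> \<longrightarrow> (\<exists>g \<in> L2 \<Omega>. has_weak_deriv \<Omega> \<alpha> w g)) \<and>
     (frac s \<noteq> 0 \<longrightarrow>
        (\<forall>\<alpha>. length \<alpha> = nat \<lfloor>s\<rfloor> \<longrightarrow> slobodeckij \<Omega> (frac s) (weak_deriv \<Omega> \<alpha> w) < \<infinity>))}"

definition sobolev_norm :: "(real^2) set \<Rightarrow> real \<Rightarrow> (real^2 \<Rightarrow> real) \<Rightarrow> real" where
  "sobolev_norm \<Omega> s w = sqrt (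
     (\<Sum>\<alpha> | length \<alpha> \<le> nat \<lfloor>s\<rfloor>. (l2_norm \<Omega> (weak_deriv \<Omega> \<alpha> w))\<^sup>2) +
     (if frac s = 0 then 0
      else \<Sum>\<alpha> | length \<alpha> = nat \<lfloor>s\<rfloor>. enn2real (slobodeckij \<Omega> (frac s) (weak_deriv \<Omega> \<alpha> w))))"

definition H20 :: "(real^2) set \<Rightarrow> (real^2 \<Rightarrow> real) set" where
  "H20 \<Omega> = {w \<in> sobolev \<Omega> 2. \<exists>\<phi>. (\<forall>k::nat. \<phi> k \<in> test_functions \<Omega>) \<and>
     (\<lambda>k. sobolev_norm \<Omega> 2 (\<lambda>x. w x - \<phi> k x)) \<longlonglongrightarrow> 0}"

definition hessian_form ::
    "(real^2) set \<Rightarrow> (real^2 \<Rightarrow> real) \<Rightarrow> (real^2 \<Rightarrow> real) \<Rightarrow> real" where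
  "hessian_form \<Omega> w v =
     (LINT x|lebesgue_on \<Omega>.
        (\<Sum>i\<in>UNIV. \<Sum>j\<in>UNIV. weak_deriv \<Omega> [i, j] w x * weak_deriv \<Omega> [i, j] v x))"

section \<open>The clamped biharmonic operator and its spectral spaces\<close>

definition laplacian :: "(real^2 \<Rightarrow> real) \<Rightarrow> real^2 \<Rightarrow> real" where
  "laplacian \<phi> x = (\<Sum>i\<in>UNIV. iter_partial [i, i] \<phi> x)"

text \<open>\<open>\<Delta>\<^sup>2 w = g\<close> in the sense of distributions on \<open>\<Omega>\<close>.\<close>

definition has_weak_bilaplacian ::
    "(real^2) set \<Rightarrow> (real^2 \<Rightarrow> real) \<Rightarrow> (real^2 \<Rightarrow> real) \<Rightarrow> bool" where
  "has_weak_bilaplacian \<Omega> w g \<longleftrightarrow>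
     (\<forall>\<phi> \<in> test_functions \<Omega>. l2_inner \<Omega> w (laplacian (laplacian \<phi>)) = l2_inner \<Omega> g \<phi>)"

definition dom_A :: "(real^2) set \<Rightarrow> (real^2 \<Rightarrow> real) set" where
  "dom_A \<Omega> = {w \<in> H20 \<Omega>. \<exists>g \<in> L2 \<Omega>. has_weak_bilaplacian \<Omega> w g}"

text \<open>The clamped boundary conditions are encoded by membership in \<open>H20 \<Omega>\<close>;
  the enumeration of the eigenvalues starts at index \<open>0\<close>.\<close>

definition biharmonic_eigensystem ::
    "(real^2) set \<Rightarrow> (nat \<Rightarrow> real) \<Rightarrow> (nat \<Rightarrow> real^2 \<Rightarrow> real) \<Rightarrow> bool" where
  "biharmonic_eigensystem \<Omega> lam \<psi> \<longleftrightarrow>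
     0 < lam 0 \<and> mono lam \<and> filterlim lam at_top sequentially \<and>
     (\<forall>n. \<psi> n \<in> H20 \<Omega> \<and> has_weak_bilaplacian \<Omega> (\<psi> n) (\<lambda>x. lam n * \<psi> n x)) \<and>
     (\<forall>m n. l2_inner \<Omega> (\<psi> m) (\<psi> n) = (if m = n then 1 else 0)) \<and>
     (\<forall>w \<in> L2 \<Omega>.
        (\<lambda>N. l2_norm \<Omega> (\<lambda>x. w x - (\<Sum>n<N. l2_inner \<Omega> w (\<psi> n) * \<psi> n x))) \<longlonglongrightarrow> 0)"

definition dom_A_pow ::
    "(real^2) set \<Rightarrow> (nat \<Rightarrow> real) \<Rightarrow> (nat \<Rightarrow> real^2 \<Rightarrow> real) \<Rightarrow> real \<Rightarrow> (real^2 \<Rightarrow> real) set" where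
  "dom_A_pow \<Omega> lam \<psi> r =
     {w \<in> L2 \<Omega>. summable (\<lambda>n. lam n powr (2 * r) * (l2_inner \<Omega> w (\<psi> n))\<^sup>2)}"

definition norm_A_pow ::
    "(real^2) set \<Rightarrow> (nat \<Rightarrow> real) \<Rightarrow> (nat \<Rightarrow> real^2 \<Rightarrow> real) \<Rightarrow> real \<Rightarrow> (real^2 \<Rightarrow> real) \<Rightarrow> real" where
  "norm_A_pow \<Omega> lam \<psi> r w = sqrt (\<Sum>n. lam n powr (2 * r) * (l2_inner \<Omega> w (\<psi> n))\<^sup>2)"

definition elliptic_regularity_index ::
    "(real^2) set \<Rightarrow> (nat \<Rightarrow> real) \<Rightarrow> (nat \<Rightarrow> real^2 \<Rightarrow> real) \<Rightarrow> real \<Rightarrow> bool" where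
  "elliptic_regularity_index \<Omega> lam \<psi> \<gamma> \<longleftrightarrow>
     1 / 2 < \<gamma> \<and> \<gamma> \<le> 1 \<and>
     dom_A \<Omega> \<subseteq> H20 \<Omega> \<inter> sobolev \<Omega> (2 + \<gamma>) \<and>
     (\<exists>C. \<forall>w \<in> dom_A \<Omega>. sobolev_norm \<Omega> (2 + \<gamma>) w \<le> C * norm_A_pow \<Omega> lam \<psi> 1 w)"

section \<open>Functions of time with values in a function space\<close>

text \<open>Here \<open>X\<close> is a space of functions and \<open>N\<close> its (semi)norm.\<close>

definition continuous_in_time ::
    "real \<Rightarrow> ('a \<Rightarrow> real) set \<Rightarrow> (('a \<Rightarrow> real) \<Rightarrow> real) \<Rightarrow> (real \<Rightarrow> 'a \<Rightarrow> real) \<Rightarrow> bool" where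
  "continuous_in_time T X N u \<longleftrightarrow>
     (\<forall>t \<in> {0..T}. u t \<in> X \<and>
        ((\<lambda>s. N (\<lambda>x. u s x - u t x)) \<longlongrightarrow> 0) (at t within {0..T}))"

definition has_time_deriv ::
    "real \<Rightarrow> (('a \<Rightarrow> real) \<Rightarrow> real) \<Rightarrow> (real \<Rightarrow> 'a \<Rightarrow> real) \<Rightarrow> (real \<Rightarrow> 'a \<Rightarrow> real) \<Rightarrow> bool" where
  "has_time_deriv T N u u' \<longleftrightarrow>
     (\<forall>t \<in> {0..T}.
        ((\<lambda>s. N (\<lambda>x. (u s x - u t x) / (s - t) - u' t x)) \<longlongrightarrow> 0) (at t within {0..T}))"

definition bochner_measurable ::
    "real \<Rightarrow> ('a \<Rightarrow> real) set \<Rightarrow> (('a \<Rightarrow> real) \<Rightarrow> real) \<Rightarrow> (real \<Rightarrow> 'a \<Rightarrow> real) \<Rightarrow> bool" where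
  "bochner_measurable T X N u \<longleftrightarrow>
     (AE t in lebesgue_on {0<..<T}. u t \<in> X) \<and>
     (\<exists>s. (\<forall>k::nat. simple_function (lebesgue_on {0<..<T}) (s k) \<and> s k ` {0<..<T} \<subseteq> X) \<and>
          (AE t in lebesgue_on {0<..<T}. (\<lambda>k. N (\<lambda>x. u t x - s k t x)) \<longlonglongrightarrow> 0))"

definition L1_time ::
    "real \<Rightarrow> ('a \<Rightarrow> real) set \<Rightarrow> (('a \<Rightarrow> real) \<Rightarrow> real) \<Rightarrow> (real \<Rightarrow> 'a \<Rightarrow> real) set" where
  "L1_time T X N = {u. bochner_measurable T X N u \<and>
     integrable (lebesgue_on {0<..<T}) (\<lambda>t. N (u t))}"

definition L2_time ::
    "real \<Rightarrow> ('a \<Rightarrow> real) set \<Rightarrow> (('a \<Rightarrow> real) \<Rightarrow> real) \<Rightarrow> (real \<Rightarrow> 'a \<Rightarrow> real) set" where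
  "L2_time T X N = {u. bochner_measurable T X N u \<and>
     integrable (lebesgue_on {0<..<T}) (\<lambda>t. (N (u t))\<^sup>2)}"

text \<open>The norm of \<open>L\<^sup>\<infinity>(0,T;X)\<close>, with value \<open>\<infinity>\<close> for functions outside that space; in
  particular it is \<open>\<infinity>\<close> unless \<open>u t \<in> X\<close> for almost every \<open>t\<close>.\<close>

definition Linf_time_norm ::
    "real \<Rightarrow> ('a \<Rightarrow> real) set \<Rightarrow> (('a \<Rightarrow> real) \<Rightarrow> real) \<Rightarrow> (real \<Rightarrow> 'a \<Rightarrow> real) \<Rightarrow> ereal" where
  "Linf_time_norm T X N u =
     (if bochner_measurable T X N u
      then Inf {C. 0 \<le> C \<and> (AE t in lebesgue_on {0<..<T}. ereal (N (u t)) \<le> C)}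
      else \<infinity>)"

definition test_functions_time :: "real \<Rightarrow> (real \<Rightarrow> real) set" where
  "test_functions_time T = {\<theta>. (\<forall>k. (deriv ^^ k) \<theta> differentiable_on UNIV) \<and>
     compact (closure {t. \<theta> t \<noteq> 0}) \<and> closure {t. \<theta> t \<noteq> 0} \<subseteq> {0<..<T}}"

text \<open>Weak time derivative of functions with values in \<open>L2 \<Omega>\<close>. The identity
  \<open>\<integral> u \<theta>' dt = - \<integral> u' \<theta> dt\<close> between elements of \<open>L2 \<Omega>\<close> is expressed by testing it with
  every \<open>v \<in> L2 \<Omega>\<close>.\<close>

definition has_weak_time_deriv ::
    "(real^2) set \<Rightarrow> real \<Rightarrow> (real \<Rightarrow> real^2 \<Rightarrow> real) \<Rightarrow> (real \<Rightarrow> real^2 \<Rightarrow> real) \<Rightarrow> bool" where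
  "has_weak_time_deriv \<Omega> T u u' \<longleftrightarrow>
     u \<in> L1_time T (L2 \<Omega>) (l2_norm \<Omega>) \<and> u' \<in> L1_time T (L2 \<Omega>) (l2_norm \<Omega>) \<and>
     (\<forall>\<theta> \<in> test_functions_time T. \<forall>v \<in> L2 \<Omega>.
        (LINT t|lebesgue_on {0<..<T}. l2_inner \<Omega> (u t) v * deriv \<theta> t) =
        - (LINT t|lebesgue_on {0<..<T}. l2_inner \<Omega> (u' t) v * \<theta> t))"

text \<open>\<open>g(0) = y\<close>, read off from the representative of \<open>g\<close> in \<open>C\<^sup>0([0,T];L\<^sup>2(\<Omega>))\<close>.\<close>

definition has_initial_value ::
    "(real^2) set \<Rightarrow> real \<Rightarrow> (real \<Rightarrow> real^2 \<Rightarrow> real) \<Rightarrow> (real^2 \<Rightarrow> real) \<Rightarrow> bool" where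
  "has_initial_value \<Omega> T g y \<longleftrightarrow>
     (\<exists>h. continuous_in_time T (L2 \<Omega>) (l2_norm \<Omega>) h \<and>
        (AE t in lebesgue_on {0<..<T}. AE x in lebesgue_on \<Omega>. g t x = h t x) \<and> h 0 = y)"

section \<open>Weak solutions of the biharmonic wave problem\<close>

text \<open>Since \<open>u\<^sub>t\<close> is only continuous into \<open>L\<^sup>2(\<Omega>)\<close>, the term \<open>(u\<^sub>t\<^sub>t, v)\<close> stands for the time
  derivative of \<open>(u\<^sub>t, v)\<close>.\<close>

definition biharmonic_wave_weak_solution ::
    "(real^2) set \<Rightarrow> real \<Rightarrow> (real \<Rightarrow> real^2 \<Rightarrow> real) \<Rightarrow> (real^2 \<Rightarrow> real) \<Rightarrow> (real^2 \<Rightarrow> real) \<Rightarrow>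
     (real \<Rightarrow> real^2 \<Rightarrow> real) \<Rightarrow> bool" where
  "biharmonic_wave_weak_solution \<Omega> T f u0 v0 u \<longleftrightarrow>
     continuous_in_time T (H20 \<Omega>) (sobolev_norm \<Omega> 2) u \<and>
     (\<exists>ut. continuous_in_time T (L2 \<Omega>) (l2_norm \<Omega>) ut \<and>
        has_time_deriv T (l2_norm \<Omega>) u ut \<and>
        (\<forall>v \<in> H20 \<Omega>. \<forall>t \<in> {0<..<T}. \<exists>d.
           ((\<lambda>s. l2_inner \<Omega> (ut s) v) has_real_derivative d) (at t) \<and>
           d + hessian_form \<Omega> (u t) v = l2_inner \<Omega> (f t) v) \<and>
        (AE x in lebesgue_on \<Omega>. u 0 x = u0 x) \<and>
        (AE x in lebesgue_on \<Omega>. ut 0 x = v0 x))"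

end

theory Submission
  imports Defs
begin

text \<open>
  In the eigenbasis the problem decouples into oscillators \<open>u\<^sub>n'' + \<lambda>\<^sub>n u\<^sub>n = f\<^sub>n\<close>. Duhamel's formula
  for the fourth derivative,
  \<open>u\<^sub>n''''(t) = u\<^sub>n''''(0) cos (\<omega>\<^sub>n t) - \<omega>\<^sub>n u\<^sub>n'''(0) sin (\<omega>\<^sub>n t) + \<integral>\<^sub>0\<^sup>t f\<^sub>n'''(s) cos (\<omega>\<^sub>n (t - s)) ds\<close>
  with \<open>\<omega>\<^sub>n\<^sup>2 = \<lambda>\<^sub>n\<close>, bounds \<open>u\<^sub>n''''\<close> uniformly in time by a square-summable sequence: the hypotheses
  on the data make the initial terms square-summable. Since \<open>\<lambda>\<^sub>n u\<^sub>n'' = f\<^sub>n'' - u\<^sub>n''''\<close>, integrating in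
  time bounds \<open>\<lambda>\<^sub>n u\<^sub>n''\<close>, \<open>\<lambda>\<^sub>n u\<^sub>n'\<close>, \<open>\<lambda>\<^sub>n u\<^sub>n\<close> and \<open>u\<^sub>n'''\<close> in the same way. Hence \<open>u\<close>, \<open>u\<^sub>t\<close>, \<open>u\<^sub>t\<^sub>t\<close> are
  continuous in time with values in \<open>D(A)\<close>, which elliptic regularity embeds into \<open>H\<^bsup>2+\<gamma>\<^esup>\<close>.
\<close>

section \<open>The space of square-integrable functions\<close>

text \<open>The candidate derivatives come from solving the equation for its top term, coefficient
  by coefficient: u_tt = f - A u, u_ttt = f_t - A u_t, u_tttt = f_tt - A u_tt. Hence u_tttt(0) =
  f_tt(0) - A f(0) + A^2 u^0 lies in L^2 and u_ttt(0) = f_t(0) - A v^0 lies in D(A^(1/2)), which is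
  what the two initial terms of Duhamel's formula need, the factor omega_n being half a power of A.
  The obstacle is that \<open>fttt\<close> is only a square-integrable weak derivative, so
  \<open>ftt\<close> cannot be differentiated classically; a one-dimensional du Bois-Reymond
  argument takes the place of that derivative. Bounding a sum at each time is not enough, since
  \<open>Linf_time_norm\<close> is infinite without Bochner measurability. A dominating sequence
  that does not depend on time gives continuity in time as well, by Tannery's theorem, and sampling
  on a grid then gives measurability. Elliptic regularity is assumed on \<open>dom_A\<close>, which
  is defined by distributions, while the estimates concern coefficients. The two are reconciled by
  approximating the Hessians of eigenfunction expansions by Hessians of test functions.\<close>

lemma L2_borel_measurable: "w \<in> L2 \<Omega> \<Longrightarrow> w \<in> borel_measurable (lebesgue_on \<Omega>)"
  by (simp add: L2_def)

lemma l2_integrable_mult: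
  assumes "w \<in> L2 \<Omega>" "v \<in> L2 \<Omega>"
  shows "integrable (lebesgue_on \<Omega>) (\<lambda>x. w x * v x)"
proof (rule Bochner_Integration.integrable_bound)
  show "integrable (lebesgue_on \<Omega>) (\<lambda>x. (w x)\<^sup>2 + (v x)\<^sup>2)"
    using assms by (auto simp: L2_def)
  show "(\<lambda>x. w x * v x) \<in> borel_measurable (lebesgue_on \<Omega>)"
    using assms by (auto simp: L2_def)
  have "\<bar>a * b\<bar> \<le> a\<^sup>2 + b\<^sup>2" for a b :: real
  proof -
    have "0 \<le> (\<bar>a\<bar> - \<bar>b\<bar>)\<^sup>2" by simp
    then have "2 * \<bar>a * b\<bar> \<le> a\<^sup>2 + b\<^sup>2"
      by (simp add: power2_diff abs_mult)
    then show ?thesis by linarith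
  qed
  then show "AE x in lebesgue_on \<Omega>. norm (w x * v x) \<le> norm ((w x)\<^sup>2 + (v x)\<^sup>2)"
    by (auto simp: abs_mult)
qed

lemma L2_zero: "(\<lambda>x. 0) \<in> L2 \<Omega>"
  by (simp add: L2_def)

lemma L2_scale: "w \<in> L2 \<Omega> \<Longrightarrow> (\<lambda>x. c * w x) \<in> L2 \<Omega>"
  by (auto simp: L2_def power_mult_distrib)

lemma L2_add:
  assumes "w \<in> L2 \<Omega>" "v \<in> L2 \<Omega>" shows "(\<lambda>x. w x + v x) \<in> L2 \<Omega>"
proof -
  have "integrable (lebesgue_on \<Omega>) (\<lambda>x. (w x)\<^sup>2 + (v x)\<^sup>2 + 2 * (w x * v x))"
    using assms l2_integrable_mult[OF assms] by (auto simp: L2_def)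
  then show ?thesis
    using assms by (auto simp: L2_def power2_sum mult.assoc)
qed

lemma L2_diff:
  assumes "w \<in> L2 \<Omega>" "v \<in> L2 \<Omega>" shows "(\<lambda>x. w x - v x) \<in> L2 \<Omega>"
  using L2_add[OF assms(1) L2_scale[OF assms(2), of "-1"]] by simp

lemma L2_sum:
  assumes "finite I" "\<And>i. i \<in> I \<Longrightarrow> w i \<in> L2 \<Omega>" shows "(\<lambda>x. \<Sum>i\<in>I. w i x) \<in> L2 \<Omega>"
  using assms by (induction I rule: finite_induct) (auto simp: L2_zero intro: L2_add)

lemma L2_bounded:
  assumes "\<Omega> \<in> lmeasurable" "w \<in> borel_measurable (lebesgue_on \<Omega>)" "\<And>x. \<bar>w x\<bar> \<le> B"
  shows "w \<in> L2 \<Omega>"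
proof -
  interpret finite_measure "lebesgue_on \<Omega>"
    using assms(1) by (rule finite_measure_lebesgue_on)
  have "integrable (lebesgue_on \<Omega>) (\<lambda>x. (w x)\<^sup>2)"
  proof (rule integrable_const_bound[where B = "B\<^sup>2"])
    show "AE x in lebesgue_on \<Omega>. norm ((w x)\<^sup>2) \<le> B\<^sup>2"
      using assms(3) by (auto simp: abs_le_square_iff[symmetric] intro!: order_trans[OF assms(3)])
  qed (use assms(2) in auto)
  then show ?thesis using assms(2) by (simp add: L2_def)
qed

lemma l2_inner_commute: "l2_inner \<Omega> w v = l2_inner \<Omega> v w"
  by (simp add: l2_inner_def mult.commute)

lemma l2_inner_add_left:
  "w \<in> L2 \<Omega> \<Longrightarrow> v \<in> L2 \<Omega> \<Longrightarrow> z \<in> L2 \<Omega> \<Longrightarrow>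
    l2_inner \<Omega> (\<lambda>x. w x + v x) z = l2_inner \<Omega> w z + l2_inner \<Omega> v z"
  by (simp add: l2_inner_def distrib_right l2_integrable_mult)

lemma l2_inner_diff_left:
  "w \<in> L2 \<Omega> \<Longrightarrow> v \<in> L2 \<Omega> \<Longrightarrow> z \<in> L2 \<Omega> \<Longrightarrow>
    l2_inner \<Omega> (\<lambda>x. w x - v x) z = l2_inner \<Omega> w z - l2_inner \<Omega> v z"
  by (simp add: l2_inner_def left_diff_distrib l2_integrable_mult)

lemma l2_inner_scale_left: "l2_inner \<Omega> (\<lambda>x. c * w x) z = c * l2_inner \<Omega> w z"
  by (simp add: l2_inner_def mult.assoc)

lemma l2_inner_zero_left: "l2_inner \<Omega> (\<lambda>x. 0) z = 0"
  by (simp add: l2_inner_def)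

lemma l2_inner_sum_left:
  assumes "finite I" "\<And>i. i \<in> I \<Longrightarrow> w i \<in> L2 \<Omega>" "z \<in> L2 \<Omega>"
  shows "l2_inner \<Omega> (\<lambda>x. \<Sum>i\<in>I. w i x) z = (\<Sum>i\<in>I. l2_inner \<Omega> (w i) z)"
  using assms(1,2)
  by (induction I rule: finite_induct)
    (auto simp: l2_inner_zero_left l2_inner_add_left L2_sum assms(3))

lemma l2_inner_add_right:
  "w \<in> L2 \<Omega> \<Longrightarrow> v \<in> L2 \<Omega> \<Longrightarrow> z \<in> L2 \<Omega> \<Longrightarrow>
    l2_inner \<Omega> z (\<lambda>x. w x + v x) = l2_inner \<Omega> z w + l2_inner \<Omega> z v"
  using l2_inner_add_left[of w \<Omega> v z] by (simp add: l2_inner_commute)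

lemma l2_inner_scale_right: "l2_inner \<Omega> z (\<lambda>x. c * w x) = c * l2_inner \<Omega> z w"
  using l2_inner_scale_left[of \<Omega> c w z] by (simp add: l2_inner_commute)

lemma l2_inner_sum_right:
  assumes "finite I" "\<And>i. i \<in> I \<Longrightarrow> w i \<in> L2 \<Omega>" "z \<in> L2 \<Omega>"
  shows "l2_inner \<Omega> z (\<lambda>x. \<Sum>i\<in>I. w i x) = (\<Sum>i\<in>I. l2_inner \<Omega> z (w i))"
  using l2_inner_sum_left[OF assms] by (simp add: l2_inner_commute)

lemma l2_inner_self_nonneg: "0 \<le> l2_inner \<Omega> w w"
  by (simp add: l2_inner_def)

lemma l2_norm_nonneg: "0 \<le> l2_norm \<Omega> w"
  by (simp add: l2_norm_def l2_inner_self_nonneg)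

lemma l2_norm_power2: "(l2_norm \<Omega> w)\<^sup>2 = l2_inner \<Omega> w w"
  by (simp add: l2_norm_def l2_inner_self_nonneg)

lemma l2_inner_cong_AE:
  assumes "w \<in> borel_measurable (lebesgue_on \<Omega>)" "w' \<in> borel_measurable (lebesgue_on \<Omega>)"
    and "v \<in> borel_measurable (lebesgue_on \<Omega>)" "AE x in lebesgue_on \<Omega>. w x = w' x"
  shows "l2_inner \<Omega> w v = l2_inner \<Omega> w' v"
  unfolding l2_inner_def by (rule integral_cong_AE) (use assms in auto)

lemma l2_norm_cong_AE:
  assumes "w \<in> borel_measurable (lebesgue_on \<Omega>)" "w' \<in> borel_measurable (lebesgue_on \<Omega>)"
    and "AE x in lebesgue_on \<Omega>. w x = w' x"
  shows "l2_norm \<Omega> w = l2_norm \<Omega> w'"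
  unfolding l2_norm_def l2_inner_def
  by (rule arg_cong[where f = sqrt], rule integral_cong_AE) (use assms in auto)

lemma l2_norm_scale: "l2_norm \<Omega> (\<lambda>x. c * w x) = \<bar>c\<bar> * l2_norm \<Omega> w"
  by (simp add: l2_norm_def l2_inner_scale_left l2_inner_scale_right real_sqrt_mult
      mult.assoc[symmetric])

lemma l2_norm_zero: "l2_norm \<Omega> (\<lambda>x. 0) = 0"
  by (simp add: l2_norm_def l2_inner_zero_left)

abbreviation l2_dist :: "(real^2) set \<Rightarrow> (real^2 \<Rightarrow> real) \<Rightarrow> (real^2 \<Rightarrow> real) \<Rightarrow> real" where
  "l2_dist \<Omega> w v \<equiv> l2_norm \<Omega> (\<lambda>x. w x - v x)"

lemma l2_dist_commute: "l2_dist \<Omega> w v = l2_dist \<Omega> v w"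
  by (simp add: l2_norm_def l2_inner_def algebra_simps)

lemma l2_norm_eq_0_AE:
  assumes "w \<in> L2 \<Omega>" "l2_norm \<Omega> w = 0"
  shows "AE x in lebesgue_on \<Omega>. w x = 0"
proof -
  have "(LINT x|lebesgue_on \<Omega>. (w x)\<^sup>2) = 0"
    using assms(2) by (simp add: l2_norm_def l2_inner_def power2_eq_square)
  then have "AE x in lebesgue_on \<Omega>. (w x)\<^sup>2 = 0"
    using assms(1) by (subst (asm) integral_nonneg_eq_0_iff_AE) (auto simp: L2_def)
  then show ?thesis by simp
qed

text \<open>The squared norm of w + t v is a nonnegative polynomial in t. Functions are not
  identified modulo null sets, so its leading coefficient \<open>c\<close> can vanish for a nonzero
  \<open>v\<close>; that case is treated apart.\<close>

lemma l2_Cauchy_Schwarz: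
  assumes "w \<in> L2 \<Omega>" "v \<in> L2 \<Omega>"
  shows "\<bar>l2_inner \<Omega> w v\<bar> \<le> l2_norm \<Omega> w * l2_norm \<Omega> v"
proof -
  define a b c where "a = l2_inner \<Omega> w w" and "b = l2_inner \<Omega> w v" and "c = l2_inner \<Omega> v v"
  have q: "0 \<le> a + 2 * t * b + t\<^sup>2 * c" for t
  proof -
    have "0 \<le> l2_inner \<Omega> (\<lambda>x. w x + t * v x) (\<lambda>x. w x + t * v x)"
      by (rule l2_inner_self_nonneg)
    also have "\<dots> = a + 2 * t * b + t\<^sup>2 * c"
      using assms by (simp add: l2_inner_add_left l2_inner_add_right L2_add L2_scale
          l2_inner_scale_left l2_inner_scale_right a_def b_def c_def l2_inner_commute[of \<Omega> v w]
          power2_eq_square algebra_simps)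
    finally show ?thesis .
  qed
  have ac: "0 \<le> a" "0 \<le> c" by (auto simp: a_def c_def l2_inner_self_nonneg)
  have "b\<^sup>2 \<le> a * c"
  proof (cases "c = 0")
    case True
    have "b = 0"
    proof (rule ccontr)
      assume "b \<noteq> 0"
      \<comment> \<open>With \<open>c = 0\<close> this choice of t gives the polynomial the value
        -1.\<close>
      then show False
        using q[of "- (a + 1) / (2 * b)"] True by (simp add: field_simps)
    qed
    then show ?thesis using ac by simp
  next
    case False
    then have "c > 0" using ac by simp
    then show ?thesis
      using q[of "- b / c"] by (simp add: field_simps power2_eq_square)
  qed
  then have "sqrt (b\<^sup>2) \<le> sqrt (a * c)" by (rule real_sqrt_le_mono)
  then show ?thesis
    by (simp add: l2_norm_def real_sqrt_mult a_def b_def c_def)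
qed

lemma l2_norm_triangle:
  assumes "w \<in> L2 \<Omega>" "v \<in> L2 \<Omega>"
  shows "l2_norm \<Omega> (\<lambda>x. w x + v x) \<le> l2_norm \<Omega> w + l2_norm \<Omega> v"
proof (rule power2_le_imp_le)
  have "(l2_norm \<Omega> (\<lambda>x. w x + v x))\<^sup>2
      = (l2_norm \<Omega> w)\<^sup>2 + 2 * l2_inner \<Omega> w v + (l2_norm \<Omega> v)\<^sup>2"
    using assms by (simp add: l2_norm_power2 l2_inner_add_left l2_inner_add_right L2_add
        l2_inner_commute[of \<Omega> v w])
  also have "\<dots> \<le> (l2_norm \<Omega> w + l2_norm \<Omega> v)\<^sup>2"
    using l2_Cauchy_Schwarz[OF assms] by (simp add: power2_sum)
  finally show "(l2_norm \<Omega> (\<lambda>x. w x + v x))\<^sup>2 \<le> (l2_norm \<Omega> w + l2_norm \<Omega> v)\<^sup>2" .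
qed (simp add: l2_norm_nonneg)

lemma l2_dist_triangle:
  assumes "w \<in> L2 \<Omega>" "v \<in> L2 \<Omega>" "z \<in> L2 \<Omega>"
  shows "l2_dist \<Omega> w z \<le> l2_dist \<Omega> w v + l2_dist \<Omega> v z"
  using l2_norm_triangle[OF L2_diff[OF assms(1,2)] L2_diff[OF assms(2,3)]] by simp

abbreviation l2_lim ::
    "(real^2) set \<Rightarrow> (nat \<Rightarrow> real^2 \<Rightarrow> real) \<Rightarrow> (real^2 \<Rightarrow> real) \<Rightarrow> bool" where
  "l2_lim \<Omega> s w \<equiv> (\<lambda>k. l2_dist \<Omega> (s k) w) \<longlonglongrightarrow> 0"

lemma l2_inner_tendsto:
  assumes "\<And>k. s k \<in> L2 \<Omega>" "w \<in> L2 \<Omega>" "v \<in> L2 \<Omega>"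
    and "l2_lim \<Omega> s w"
  shows "(\<lambda>k. l2_inner \<Omega> (s k) v) \<longlonglongrightarrow> l2_inner \<Omega> w v"
proof -
  have "(\<lambda>k. l2_inner \<Omega> (s k) v - l2_inner \<Omega> w v) \<longlonglongrightarrow> 0"
  proof (rule Lim_null_comparison)
    show "\<forall>\<^sub>F k in sequentially. norm (l2_inner \<Omega> (s k) v - l2_inner \<Omega> w v)
        \<le> l2_dist \<Omega> (s k) w * l2_norm \<Omega> v"
      using l2_Cauchy_Schwarz[OF L2_diff[OF assms(1,2)] assms(3)] assms(1-3)
      by (auto simp: l2_inner_diff_left)
    show "(\<lambda>k. l2_dist \<Omega> (s k) w * l2_norm \<Omega> v) \<longlonglongrightarrow> 0"
      using tendsto_mult_left_zero[OF assms(4)] by simp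
  qed
  then show ?thesis by (simp add: LIM_zero_iff)
qed

text \<open>A subsequence with geometrically decreasing increments converges almost everywhere: the
  measure is finite, so the constant 1 is in \<open>L2\<close> and the increments are summable in
  L^1 by Cauchy-Schwarz. Fatou's lemma then shows that the pointwise limit is the \<open>L2\<close>
  limit of the whole sequence.\<close>

lemma L2_complete:
  assumes \<Omega>: "\<Omega> \<in> lmeasurable" and s: "\<And>k::nat. s k \<in> L2 \<Omega>"
    and Cau: "\<And>e. e > 0 \<Longrightarrow> \<exists>N. \<forall>m\<ge>N. \<forall>n\<ge>N. l2_dist \<Omega> (s m) (s n) < e"
  shows "\<exists>w \<in> L2 \<Omega>. l2_lim \<Omega> s w"
proof -
  let ?M = "lebesgue_on \<Omega>"
  interpret finite_measure ?M
    using \<Omega> by (rule finite_measure_lebesgue_on)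
  note sm[measurable] = L2_borel_measurable[OF s]
  have one: "(\<lambda>x. 1) \<in> L2 \<Omega>" by (rule L2_bounded[OF \<Omega>]) auto
  have "\<exists>N. \<forall>k. \<forall>m\<ge>N k. \<forall>n\<ge>N k. l2_dist \<Omega> (s m) (s n) < (1/2)^k"
    using Cau by (intro choice) auto
  then obtain N where N: "\<And>k m n. m \<ge> N k \<Longrightarrow> n \<ge> N k \<Longrightarrow> l2_dist \<Omega> (s m) (s n) < (1/2)^k"
    by blast
  \<comment> \<open>The sum makes \<open>r\<close> monotone and at least \<open>N k\<close>, so that
    the increment from \<open>r k\<close> to \<open>r (Suc k)\<close> is below (1/2)^k; the added
    \<open>k\<close> forces \<open>r\<close> to infinity, which the Fatou argument needs.\<close>
  define r where "r k = (\<Sum>j\<le>k. N j) + k" for k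
  have rN: "N k \<le> r k" for k
    unfolding r_def by (rule trans_le_add1) (auto intro: member_le_sum)
  have rmono: "r k \<le> r (Suc k)" for k by (simp add: r_def)
  have rk: "k \<le> r k" for k by (simp add: r_def)
  define d where "d k x = \<bar>s (r (Suc k)) x - s (r k) x\<bar>" for k x
  have dL: "d k \<in> L2 \<Omega>" for k
    using L2_diff[OF s s] by (auto simp: d_def[abs_def] L2_def)
  have dint: "integrable ?M (d k)" for k
    using l2_integrable_mult[OF dL one, of k] by simp
  have dbd: "(LINT x|?M. d k x) \<le> (1/2)^k * l2_norm \<Omega> (\<lambda>x. 1)" for k
  proof -
    have "(LINT x|?M. d k x) = l2_inner \<Omega> (d k) (\<lambda>x. 1)" by (simp add: l2_inner_def)
    also have "\<dots> \<le> l2_norm \<Omega> (d k) * l2_norm \<Omega> (\<lambda>x. 1)"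
      using l2_Cauchy_Schwarz[OF dL one, of k] by simp
    also have "l2_norm \<Omega> (d k) = l2_dist \<Omega> (s (r (Suc k))) (s (r k))"
      by (simp add: l2_norm_def l2_inner_def d_def)
    also have "\<dots> * l2_norm \<Omega> (\<lambda>x. 1) \<le> (1/2)^k * l2_norm \<Omega> (\<lambda>x. 1)"
      using N[of k "r (Suc k)" "r k"] rN[of k] rmono[of k]
      by (intro mult_right_mono) (auto simp: l2_norm_nonneg)
    finally show ?thesis .
  qed
  have dm[measurable]: "d k \<in> borel_measurable ?M" for k by (rule L2_borel_measurable[OF dL])
  have "AE x in ?M. summable (\<lambda>k. d k x)"
  proof -
    have "(\<integral>\<^sup>+x. (\<Sum>k. ennreal (d k x)) \<partial>?M) = (\<Sum>k. \<integral>\<^sup>+x. ennreal (d k x) \<partial>?M)"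
      by (rule nn_integral_suminf) auto
    also have "\<dots> = (\<Sum>k. ennreal (LINT x|?M. d k x))"
      by (intro suminf_cong nn_integral_eq_integral dint) (auto simp: d_def)
    also have "\<dots> \<le> (\<Sum>k. ennreal ((1/2)^k * l2_norm \<Omega> (\<lambda>x. 1)))"
      by (intro suminf_le ennreal_leI dbd) auto
    also have "\<dots> < \<infinity>"
      by (subst suminf_ennreal2)
        (auto intro!: summable_mult2 summable_geometric simp: l2_norm_nonneg)
    finally have "(\<integral>\<^sup>+x. (\<Sum>k. ennreal (d k x)) \<partial>?M) \<noteq> \<infinity>" by simp
    then have "AE x in ?M. (\<Sum>k. ennreal (d k x)) \<noteq> \<infinity>"
      by (intro nn_integral_PInf_AE) auto
    then show ?thesis
      by (rule AE_mp) (auto intro!: AE_I2 summable_suminf_not_top simp: d_def)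
  qed
  then have conv: "AE x in ?M. convergent (\<lambda>k. s (r k) x)"
  proof (rule AE_mp, intro AE_I2 impI)
    fix x assume "summable (\<lambda>k. d k x)"
    then have "summable (\<lambda>k. s (r (Suc k)) x - s (r k) x)"
      unfolding d_def by (rule summable_rabs_cancel)
    then have "convergent (\<lambda>n. \<Sum>k<n. s (r (Suc k)) x - s (r k) x)"
      by (simp add: summable_iff_convergent)
    then have "convergent (\<lambda>n. s (r n) x - s (r 0) x)"
      by (simp add: sum_lessThan_telescope[of "\<lambda>k. s (r k) x"])
    then show "convergent (\<lambda>k. s (r k) x)"
      using convergent_add[OF _ convergent_const[of "s (r 0) x"]] by fastforce
  qed
  define w where "w x = lim (\<lambda>k. s (r k) x)" for x
  have wm[measurable]: "w \<in> borel_measurable ?M"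
    unfolding w_def by (rule borel_measurable_lim_metric) auto
  have lim: "AE x in ?M. (\<lambda>k. s (r k) x) \<longlonglongrightarrow> w x"
    using conv by (rule AE_mp) (auto simp: w_def convergent_LIMSEQ_iff)
  have nnsq: "(\<integral>\<^sup>+x. ennreal ((v x)\<^sup>2) \<partial>?M) = ennreal ((l2_norm \<Omega> v)\<^sup>2)" if "v \<in> L2 \<Omega>" for v
    using that by (subst nn_integral_eq_integral)
      (auto simp: L2_def l2_norm_power2 l2_inner_def simp flip: power2_eq_square)
  \<comment> \<open>Fatou's lemma along the subsequence, with \<open>m\<close> fixed. Working with
    extended integrals avoids assuming that \<open>w\<close> is square-integrable, which is deduced
    from this bound.\<close>
  have key: "(\<integral>\<^sup>+x. ennreal ((s m x - w x)\<^sup>2) \<partial>?M) \<le> ennreal (((1/2)^k)\<^sup>2)" if "m \<ge> N k" for m k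
  proof -
    have "(\<integral>\<^sup>+x. ennreal ((s m x - w x)\<^sup>2) \<partial>?M)
        = (\<integral>\<^sup>+x. liminf (\<lambda>j. ennreal ((s m x - s (r j) x)\<^sup>2)) \<partial>?M)"
    proof (rule nn_integral_cong_AE, rule AE_mp[OF lim], intro AE_I2 impI)
      fix x assume "(\<lambda>k. s (r k) x) \<longlonglongrightarrow> w x"
      then have "(\<lambda>j. ennreal ((s m x - s (r j) x)\<^sup>2)) \<longlonglongrightarrow> ennreal ((s m x - w x)\<^sup>2)"
        by (intro tendsto_intros)
      then show "ennreal ((s m x - w x)\<^sup>2) = liminf (\<lambda>j. ennreal ((s m x - s (r j) x)\<^sup>2))"
        by (rule lim_imp_Liminf[OF sequentially_bot, symmetric])
    qed
    also have "\<dots> \<le> liminf (\<lambda>j. \<integral>\<^sup>+x. ennreal ((s m x - s (r j) x)\<^sup>2) \<partial>?M)"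
      by (rule nn_integral_liminf) auto
    also have "\<dots> \<le> ennreal (((1/2)^k)\<^sup>2)"
    proof (rule Liminf_le[OF sequentially_bot])
      have "(\<integral>\<^sup>+x. ennreal ((s m x - s (r j) x)\<^sup>2) \<partial>?M) \<le> ennreal (((1/2)^k)\<^sup>2)" if "j \<ge> N k" for j
        unfolding nnsq[OF L2_diff[OF s s]]
        by (intro ennreal_leI power_mono l2_norm_nonneg less_imp_le N \<open>m \<ge> N k\<close>
            order_trans[OF that rk])
      then show "\<forall>\<^sub>F j in sequentially.
          (\<integral>\<^sup>+x. ennreal ((s m x - s (r j) x)\<^sup>2) \<partial>?M) \<le> ennreal (((1/2)^k)\<^sup>2)"
        by (auto simp: eventually_sequentially)
    qed
    finally show ?thesis .
  qed
  have dL: "(\<lambda>x. s m x - w x) \<in> L2 \<Omega>" if "m \<ge> N k" for m k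
  proof -
    have "integrable ?M (\<lambda>x. (s m x - w x)\<^sup>2)"
      by (rule integrableI_nonneg) (use key[OF that] in \<open>auto intro: le_less_trans\<close>)
    then show ?thesis by (simp add: L2_def)
  qed
  have nb: "l2_dist \<Omega> (s m) w \<le> (1/2)^k" if "m \<ge> N k" for m k
    using key[OF that] unfolding nnsq[OF dL[OF that]]
    by (auto intro: power2_le_imp_le)
  have wL: "w \<in> L2 \<Omega>"
    using L2_diff[OF s[of "N 0"] dL[of 0 "N 0"]] by simp
  have "l2_lim \<Omega> s w"
  proof (rule LIMSEQ_I)
    fix e :: real assume "e > 0"
    then obtain k where "(1/2::real)^k < e" using real_arch_pow_inv[of e "1/2"] by auto
    then show "\<exists>no. \<forall>n\<ge>no. norm (l2_dist \<Omega> (s n) w - 0) < e"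
      using nb[of k] by (intro exI[of _ "N k"]) (auto simp: l2_norm_nonneg intro: le_less_trans)
  qed
  then show ?thesis using wL by blast
qed

text \<open>Adapted to partial sums of orthogonal series, where the squared distance is controlled
  by a block of a convergent scalar series. It serves both for eigenfunction expansions and for the
  Hessians of their partial sums.\<close>

lemma L2_complete_summable:
  assumes \<Omega>: "\<Omega> \<in> lmeasurable" and s: "\<And>k::nat. s k \<in> L2 \<Omega>" and a: "summable a"
    and bd: "\<And>m n. m \<le> n \<Longrightarrow> (l2_dist \<Omega> (s n) (s m))\<^sup>2 \<le> (\<Sum>k\<in>{m..<n}. a k)"
  shows "\<exists>w \<in> L2 \<Omega>. l2_lim \<Omega> s w"
proof (rule L2_complete[OF \<Omega> s])
  fix e :: real assume "e > 0"
  then obtain N where N: "\<And>m n. m \<ge> N \<Longrightarrow> norm (\<Sum>k\<in>{m..<n}. a k) < e\<^sup>2"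
    using a unfolding summable_Cauchy by (meson zero_less_power)
  have *: "l2_dist \<Omega> (s n) (s m) < e" if "m \<ge> N" "m \<le> n" for m n
  proof -
    have "(l2_dist \<Omega> (s n) (s m))\<^sup>2 < e\<^sup>2"
      using N[OF that(1), of n] bd[OF that(2)] by auto
    then show ?thesis using \<open>e > 0\<close> by (auto intro: power2_less_imp_less)
  qed
  show "\<exists>N. \<forall>m\<ge>N. \<forall>n\<ge>N. l2_dist \<Omega> (s m) (s n) < e"
  proof (intro exI[of _ N] allI impI)
    fix m n assume "N \<le> m" "N \<le> n"
    then show "l2_dist \<Omega> (s m) (s n) < e"
      using *[of m n] *[of n m] l2_dist_commute[of \<Omega> "s m" "s n"] by (cases "m \<le> n") auto
  qed
qed

section \<open>Test functions\<close>

lemma iter_partial_append: "iter_partial (\<alpha> @ \<beta>) \<phi> = iter_partial \<alpha> (iter_partial \<beta> \<phi>)"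
  by (induction \<alpha>) auto

lemma iter_partial_diff:
  "\<phi> \<in> test_functions \<Omega> \<Longrightarrow> iter_partial \<alpha> \<phi> differentiable (at x)"
  by (auto simp: test_functions_def differentiable_on_def)

lemma test_differentiable: "\<phi> \<in> test_functions \<Omega> \<Longrightarrow> \<phi> differentiable (at x)"
  using iter_partial_diff[of \<phi> \<Omega> "[]"] by simp

lemma partial_d_outside_support:
  assumes "x \<notin> closure {x. \<phi> x \<noteq> 0}" shows "partial_d i \<phi> x = 0"
proof -
  have "(\<phi> has_derivative (\<lambda>h. 0)) (at x)"
  proof (rule has_derivative_transform_within_open)
    show "((\<lambda>x. 0) has_derivative (\<lambda>h. 0)) (at x)" by simp
    show "open (- closure {x. \<phi> x \<noteq> 0})" by (intro open_Compl closed_closure)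
    show "0 = \<phi> y" if "y \<in> - closure {x. \<phi> x \<noteq> 0}" for y
      using that closure_subset[of "{x. \<phi> x \<noteq> 0}"] by auto
  qed (use assms in auto)
  then show ?thesis by (simp add: partial_d_def frechet_derivative_at[symmetric])
qed

lemma closure_support_iter_partial:
  "closure {x. iter_partial \<alpha> \<phi> x \<noteq> 0} \<subseteq> closure {x. \<phi> x \<noteq> 0}"
proof (induction \<alpha>)
  case (Cons i \<alpha>)
  have "{x. iter_partial (i # \<alpha>) \<phi> x \<noteq> 0} \<subseteq> closure {x. iter_partial \<alpha> \<phi> x \<noteq> 0}"
    using partial_d_outside_support[of _ "iter_partial \<alpha> \<phi>"] by auto
  then have "closure {x. iter_partial (i # \<alpha>) \<phi> x \<noteq> 0} \<subseteq> closure {x. iter_partial \<alpha> \<phi> x \<noteq> 0}"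
    by (rule closure_minimal) (rule closed_closure)
  then show ?case using Cons by (rule order_trans)
qed simp

lemma compact_closure_subset:
  fixes K :: "(real^2) set"
  assumes "compact K" "closure A \<subseteq> K" shows "compact (closure A)"
  using bounded_subset[OF compact_imp_bounded[OF assms(1)] order_trans[OF closure_subset assms(2)]]
  by simp

lemma test_iter_partial:
  assumes "\<phi> \<in> test_functions \<Omega>" shows "iter_partial \<alpha> \<phi> \<in> test_functions \<Omega>"
proof -
  note sub = closure_support_iter_partial[of \<alpha> \<phi>]
  have K: "compact (closure {x. \<phi> x \<noteq> 0})" "closure {x. \<phi> x \<noteq> 0} \<subseteq> \<Omega>"
    and d: "iter_partial \<beta> \<phi> differentiable_on UNIV" for \<beta>
    using assms unfolding test_functions_def by blast+
  have "iter_partial \<beta> (iter_partial \<alpha> \<phi>) differentiable_on UNIV" for \<beta>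
    using d[of "\<beta> @ \<alpha>"] by (simp only: iter_partial_append)
  then show ?thesis
    using compact_closure_subset[OF K(1) sub] order_trans[OF sub K(2)]
    unfolding test_functions_def by blast
qed

lemma test_partial_d:
  "\<phi> \<in> test_functions \<Omega> \<Longrightarrow> partial_d i \<phi> \<in> test_functions \<Omega>"
  using test_iter_partial[of \<phi> \<Omega> "[i]"] by simp

lemma test_continuous_on: "\<phi> \<in> test_functions \<Omega> \<Longrightarrow> continuous_on A \<phi>"
  by (meson continuous_at_imp_continuous_on differentiable_imp_continuous_within test_differentiable)

lemma test_zero_outside:
  assumes "\<phi> \<in> test_functions \<Omega>" "x \<notin> \<Omega>" shows "\<phi> x = 0"
  using assms closure_subset[of "{x. \<phi> x \<noteq> 0}"] by (auto simp: test_functions_def)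

lemma test_bounded:
  assumes "\<phi> \<in> test_functions \<Omega>" shows "\<exists>B. \<forall>x. \<bar>\<phi> x\<bar> \<le> B"
proof -
  let ?K = "closure {x. \<phi> x \<noteq> 0}"
  have "compact (\<phi> ` ?K)"
    using assms by (intro compact_continuous_image test_continuous_on) (auto simp: test_functions_def)
  then obtain B where B: "\<forall>x\<in>?K. \<bar>\<phi> x\<bar> \<le> B"
    by (auto dest!: compact_imp_bounded simp: bounded_iff)
  have "\<bar>\<phi> x\<bar> \<le> max B 0" for x
  proof (cases "\<phi> x = 0")
    case False
    then have "x \<in> ?K" using closure_subset[of "{x. \<phi> x \<noteq> 0}"] by blast
    then show ?thesis using B by fastforce
  qed auto
  then show ?thesis by blast
qed

lemma test_borel_measurable: "\<phi> \<in> test_functions \<Omega> \<Longrightarrow> \<phi> \<in> borel_measurable borel"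
  by (intro borel_measurable_continuous_onI test_continuous_on)

lemma test_L2:
  assumes "\<Omega> \<in> lmeasurable" "\<phi> \<in> test_functions \<Omega>" shows "\<phi> \<in> L2 \<Omega>"
proof -
  obtain B where "\<And>x. \<bar>\<phi> x\<bar> \<le> B" using test_bounded[OF assms(2)] by blast
  moreover have "\<phi> \<in> borel_measurable (lebesgue_on \<Omega>)"
    using test_borel_measurable[OF assms(2)]
    by (intro measurable_restrict_space1 measurable_completion) simp
  ultimately show ?thesis using L2_bounded assms(1) by blast
qed

lemma partial_d_add:
  "\<phi> differentiable (at x) \<Longrightarrow> \<eta> differentiable (at x) \<Longrightarrow>
    partial_d i (\<lambda>x. \<phi> x + \<eta> x) x = partial_d i \<phi> x + partial_d i \<eta> x"
  unfolding partial_d_def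
  by (subst frechet_derivative_at[OF has_derivative_add, symmetric])
    (auto simp: frechet_derivative_works[symmetric])

lemma partial_d_mult:
  "\<phi> differentiable (at x) \<Longrightarrow> \<eta> differentiable (at x) \<Longrightarrow>
    partial_d i (\<lambda>x. \<phi> x * \<eta> x) x = \<phi> x * partial_d i \<eta> x + partial_d i \<phi> x * \<eta> x"
  unfolding partial_d_def
  by (subst frechet_derivative_at[OF has_derivative_mult, symmetric])
    (auto simp: frechet_derivative_works[symmetric])

lemma partial_d_scale:
  assumes "\<phi> differentiable (at x)"
  shows "partial_d i (\<lambda>x. c * \<phi> x) x = c * partial_d i \<phi> x"
proof -
  have "((\<lambda>x. c * \<phi> x) has_derivative (\<lambda>h. c * frechet_derivative \<phi> (at x) h)) (at x)"
    using assms by (intro has_derivative_mult_right) (simp add: frechet_derivative_works[symmetric])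
  then show ?thesis by (simp add: partial_d_def frechet_derivative_at[symmetric])
qed

lemma iter_partial_add:
  assumes "\<phi> \<in> test_functions \<Omega>" "\<eta> \<in> test_functions \<Omega>"
  shows "iter_partial \<alpha> (\<lambda>x. \<phi> x + \<eta> x) = (\<lambda>x. iter_partial \<alpha> \<phi> x + iter_partial \<alpha> \<eta> x)"
proof (induction \<alpha>)
  case (Cons i \<alpha>)
  have "partial_d i (\<lambda>x. iter_partial \<alpha> \<phi> x + iter_partial \<alpha> \<eta> x)
      = (\<lambda>x. partial_d i (iter_partial \<alpha> \<phi>) x + partial_d i (iter_partial \<alpha> \<eta>) x)"
    by (intro ext partial_d_add iter_partial_diff[OF assms(1)] iter_partial_diff[OF assms(2)])
  then show ?case by (simp add: Cons)
qed simp

lemma iter_partial_scale: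
  assumes "\<phi> \<in> test_functions \<Omega>"
  shows "iter_partial \<alpha> (\<lambda>x. c * \<phi> x) = (\<lambda>x. c * iter_partial \<alpha> \<phi> x)"
proof (induction \<alpha>)
  case (Cons i \<alpha>)
  have "partial_d i (\<lambda>x. c * iter_partial \<alpha> \<phi> x) = (\<lambda>x. c * partial_d i (iter_partial \<alpha> \<phi>) x)"
    by (intro ext partial_d_scale iter_partial_diff[OF assms])
  then show ?case by (simp add: Cons)
qed simp

lemma test_add:
  assumes "\<phi> \<in> test_functions \<Omega>" "\<eta> \<in> test_functions \<Omega>"
  shows "(\<lambda>x. \<phi> x + \<eta> x) \<in> test_functions \<Omega>"
proof -
  let ?A = "closure {x. \<phi> x \<noteq> 0}" and ?B = "closure {x. \<eta> x \<noteq> 0}"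
    and ?C = "closure {x. \<phi> x + \<eta> x \<noteq> 0}"
  have "?C \<subseteq> closure ({x. \<phi> x \<noteq> 0} \<union> {x. \<eta> x \<noteq> 0})"
    by (rule closure_mono) auto
  then have C: "?C \<subseteq> ?A \<union> ?B" by simp
  have "compact (?A \<union> ?B)" using assms by (auto simp: test_functions_def)
  then have "compact ?C"
    using C by (rule compact_closure_subset)
  then show ?thesis
    using assms C by (auto simp: test_functions_def iter_partial_add[OF assms] intro!: differentiable_on_add)
qed

lemma test_scale:
  assumes "\<phi> \<in> test_functions \<Omega>"
  shows "(\<lambda>x. c * \<phi> x) \<in> test_functions \<Omega>"
proof -
  let ?A = "closure {x. \<phi> x \<noteq> 0}" and ?C = "closure {x. c * \<phi> x \<noteq> 0}"
  have C: "?C \<subseteq> ?A" by (rule closure_mono) auto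
  have "compact ?A" using assms by (auto simp: test_functions_def)
  then have "compact ?C"
    using C by (rule compact_closure_subset)
  then show ?thesis
    using assms C by (auto simp: test_functions_def iter_partial_scale[OF assms] intro!: differentiable_on_mult)
qed

lemma test_zero: "(\<lambda>x. 0) \<in> test_functions \<Omega>"
proof -
  have "iter_partial \<alpha> (\<lambda>x. 0) = (\<lambda>x. 0)" for \<alpha>
    by (induction \<alpha>) (auto simp: partial_d_def)
  then show ?thesis by (simp add: test_functions_def)
qed

section \<open>Integration by parts and symmetry of second derivatives\<close>

lemma has_real_derivative_along_axis:
  assumes "\<phi> differentiable (at (x + s *\<^sub>R axis i 1))"
  shows "((\<lambda>s. \<phi> (x + s *\<^sub>R axis i 1)) has_real_derivative partial_d i \<phi> (x + s *\<^sub>R axis i 1)) (at s)"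
proof -
  let ?D = "frechet_derivative \<phi> (at (x + s *\<^sub>R axis i 1))"
  have "(\<phi> has_derivative ?D) (at (x + s *\<^sub>R axis i 1))"
    using assms by (simp add: frechet_derivative_works[symmetric])
  moreover have "((\<lambda>s. x + s *\<^sub>R axis i 1) has_derivative (\<lambda>h. h *\<^sub>R axis i 1)) (at s)"
    by (auto intro!: derivative_eq_intros)
  ultimately have "((\<lambda>s. \<phi> (x + s *\<^sub>R axis i 1)) has_derivative (\<lambda>h. ?D (h *\<^sub>R axis i 1))) (at s)"
    using diff_chain_at[of "\<lambda>s. x + s *\<^sub>R axis i 1" _ s \<phi>] by (auto simp: o_def)
  moreover have "?D (h *\<^sub>R axis i 1) = h * partial_d i \<phi> (x + s *\<^sub>R axis i 1)" for h
    using linear_frechet_derivative[OF assms] by (simp add: partial_d_def linear_cmul)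
  ultimately show ?thesis
    by (simp add: has_field_derivative_def mult.commute[of _ "partial_d i \<phi> _"])
qed

text \<open>Translation invariance of the integral makes the integral of each difference quotient vanish;
  dominated convergence passes to the derivative.\<close>

lemma integral_partial_d_eq_0:
  fixes F :: "real^2 \<Rightarrow> real"
  assumes F: "\<And>x. F differentiable (at x)" and cont: "continuous_on UNIV (partial_d i F)"
    and supp: "\<And>x. norm x \<ge> R \<Longrightarrow> F x = 0"
  shows "(LINT x|lborel. partial_d i F x) = 0"
proof -
  let ?e = "axis i 1 :: real^2"
  define h where "h k = 1 / real (Suc k)" for k
  have h: "0 < h k" "h k \<le> 1" for k by (auto simp: h_def field_simps)
  have hlim: "h \<longlonglongrightarrow> 0" unfolding h_def by (rule LIMSEQ_Suc[OF lim_1_over_n])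
  have Fc: "continuous_on A F" for A
    by (meson continuous_at_imp_continuous_on differentiable_imp_continuous_within F)
  have Fm[measurable]: "F \<in> borel_measurable borel"
    by (intro borel_measurable_continuous_onI Fc)
  have Dm[measurable]: "partial_d i F \<in> borel_measurable borel"
    by (intro borel_measurable_continuous_onI cont)
  have zero: "partial_d i F x = 0" if "norm x > R" for x
  proof (rule partial_d_outside_support)
    have "closure {x. F x \<noteq> 0} \<subseteq> cball 0 R"
      using supp by (intro closure_minimal) (force simp: not_le[symmetric])+
    then show "x \<notin> closure {x. F x \<noteq> 0}" using that by auto
  qed
  have "compact (partial_d i F ` cball 0 R)"
    by (intro compact_continuous_image continuous_on_subset[OF cont]) auto
  then obtain B0 where "\<forall>x\<in>cball 0 R. \<bar>partial_d i F x\<bar> \<le> B0"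
    by (auto dest!: compact_imp_bounded simp: bounded_iff)
  then have B: "\<bar>partial_d i F x\<bar> \<le> max B0 0" for x
    using zero[of x] by (cases "norm x > R") (auto simp: le_max_iff_disj)
  define q where "q k x = (F (x + h k *\<^sub>R ?e) - F x) / h k" for k x
  have Fint: "integrable lborel F"
  proof -
    have "integrable lborel (\<lambda>x. indicator (cball 0 R) x *\<^sub>R F x)"
      by (rule borel_integrable_compact) (auto intro: Fc)
    moreover have "(\<lambda>x. indicator (cball 0 R) x *\<^sub>R F x) = F"
      using supp by (auto simp: fun_eq_iff indicator_def)
    ultimately show ?thesis by simp
  qed
  have tr: "integrable lborel (\<lambda>x. F (x + c))" "(LINT x|lborel. F (x + c)) = (LINT x|lborel. F x)" for c
  proof -
    have "integrable (distr lborel borel ((+) c)) F" using Fint by (simp add: lborel_distr_plus)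
    then show "integrable lborel (\<lambda>x. F (x + c))"
      by (subst (asm) integrable_distr_eq) (auto simp: add.commute)
    have "(LINT x|lborel. F x) = (LINT x|distr lborel borel ((+) c). F x)" by (simp add: lborel_distr_plus)
    also have "\<dots> = (LINT x|lborel. F (x + c))"
      by (subst integral_distr) (auto simp: add.commute)
    finally show "(LINT x|lborel. F (x + c)) = (LINT x|lborel. F x)" by simp
  qed
  have q0: "(LINT x|lborel. q k x) = 0" for k
    using tr Fint by (simp add: q_def)
  have "(\<lambda>k. LINT x|lborel. q k x) \<longlonglongrightarrow> (LINT x|lborel. partial_d i F x)"
  proof (rule integral_dominated_convergence)
    \<comment> \<open>The steps \<open>h k\<close> are at most 1, so every difference quotient
      vanishes outside the ball of radius \<open>R + 1\<close>; the mean value theorem bounds it by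
      the bound of the derivative inside.\<close>
    show "integrable lborel (\<lambda>x. indicator (cball (0::real^2) (R + 1)) x *\<^sub>R max B0 0)"
      by (rule borel_integrable_compact) auto
    show "AE x in lborel. (\<lambda>k. q k x) \<longlonglongrightarrow> partial_d i F x"
    proof (rule AE_I2)
      fix x
      have "((\<lambda>s. F (x + s *\<^sub>R ?e)) has_real_derivative partial_d i F (x + 0 *\<^sub>R ?e)) (at 0)"
        by (rule has_real_derivative_along_axis) (simp add: F)
      then have "((\<lambda>s. (F (x + s *\<^sub>R ?e) - F x) / s) \<longlongrightarrow> partial_d i F x) (at 0)"
        by (simp add: has_field_derivative_iff)
      moreover have "filterlim h (at 0) sequentially"
        using h(1) hlim by (auto simp: filterlim_at intro!: always_eventually) (metis less_irrefl)
      ultimately show "(\<lambda>k. q k x) \<longlonglongrightarrow> partial_d i F x"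
        unfolding q_def by (rule filterlim_compose)
    qed
    show "AE x in lborel. norm (q k x) \<le> indicator (cball (0::real^2) (R + 1)) x *\<^sub>R max B0 0" for k
    proof (rule AE_I2)
      fix x
      show "norm (q k x) \<le> indicator (cball (0::real^2) (R + 1)) x *\<^sub>R max B0 0"
      proof (cases "norm x \<le> R + 1")
        case False
        have "norm x \<le> norm (x + h k *\<^sub>R ?e) + norm (h k *\<^sub>R ?e)"
          by (metis add_diff_cancel norm_triangle_ineq4)
        then have "norm (x + h k *\<^sub>R ?e) \<ge> R"
          using False h[of k] by simp
        then show ?thesis using False supp by (auto simp: q_def)
      next
        case True
        have "\<exists>z. 0 < z \<and> z < h k \<and>
            F (x + h k *\<^sub>R ?e) - F (x + 0 *\<^sub>R ?e) = (h k - 0) * partial_d i F (x + z *\<^sub>R ?e)"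
          by (rule MVT2[OF h(1)]) (intro has_real_derivative_along_axis F)
        then obtain z where "F (x + h k *\<^sub>R ?e) - F (x + 0 *\<^sub>R ?e) = (h k - 0) * partial_d i F (x + z *\<^sub>R ?e)"
          by blast
        then show ?thesis
          using True h(1)[of k] B[of "x + z *\<^sub>R ?e"] by (simp add: q_def)
      qed
    qed
  qed (auto simp: q_def)
  then show ?thesis by (simp add: q0 LIMSEQ_const_iff)
qed

lemma l2_inner_test_lborel:
  assumes "open \<Omega>" "\<phi> \<in> test_functions \<Omega>" "\<eta> \<in> test_functions \<Omega>"
  shows "l2_inner \<Omega> \<phi> \<eta> = (LINT x|lborel. \<phi> x * \<eta> x)"
proof -
  have "l2_inner \<Omega> \<phi> \<eta> = (LINT x|lebesgue. indicator \<Omega> x *\<^sub>R (\<phi> x * \<eta> x))"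
    unfolding l2_inner_def using assms(1)
    by (intro integral_restrict_space) (auto simp: sets_completionI_sets)
  also have "\<dots> = (LINT x|lebesgue. \<phi> x * \<eta> x)"
    by (intro Bochner_Integration.integral_cong)
      (auto simp: indicator_def test_zero_outside[OF assms(2)])
  also have "\<dots> = (LINT x|lborel. \<phi> x * \<eta> x)"
    using assms(2,3)[THEN test_borel_measurable] by (intro integral_completion) auto
  finally show ?thesis .
qed

lemma test_integrable_lborel:
  assumes "\<phi> \<in> test_functions \<Omega>" "\<eta> \<in> test_functions \<Omega>"
  shows "integrable lborel (\<lambda>x. \<phi> x * \<eta> x)"
proof -
  let ?K = "closure {x. \<phi> x \<noteq> 0}"
  have "integrable lborel (\<lambda>x. indicator ?K x *\<^sub>R (\<phi> x * \<eta> x))"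
    using assms by (intro borel_integrable_compact continuous_intros test_continuous_on)
      (auto simp: test_functions_def)
  moreover have "(\<lambda>x. indicator ?K x *\<^sub>R (\<phi> x * \<eta> x)) = (\<lambda>x. \<phi> x * \<eta> x)"
    using closure_subset[of "{x. \<phi> x \<noteq> 0}"] by (auto simp: fun_eq_iff indicator_def)
  ultimately show ?thesis by simp
qed

text \<open>The derivative of the product integrates to zero over the plane. Test functions vanish
  outside \<Omega>, so its integral over \<Omega> is the same and no boundary term arises.\<close>

lemma test_integration_by_parts:
  assumes "open \<Omega>" "\<phi> \<in> test_functions \<Omega>" "\<eta> \<in> test_functions \<Omega>"
  shows "l2_inner \<Omega> \<phi> (partial_d i \<eta>) = - l2_inner \<Omega> (partial_d i \<phi>) \<eta>"
proof -
  note p = test_partial_d[OF assms(2), of i] test_partial_d[OF assms(3), of i]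
  note d = test_differentiable[OF assms(2)] test_differentiable[OF assms(3)]
  have eq: "partial_d i (\<lambda>x. \<phi> x * \<eta> x) = (\<lambda>x. \<phi> x * partial_d i \<eta> x + partial_d i \<phi> x * \<eta> x)"
    by (rule ext) (rule partial_d_mult[OF d])
  have "bounded (closure {x. \<phi> x \<noteq> 0})"
    using assms(2) by (auto simp: test_functions_def compact_imp_bounded)
  then obtain R where R: "\<forall>x\<in>closure {x. \<phi> x \<noteq> 0}. norm x \<le> R" by (auto simp: bounded_iff)
  have "(LINT x|lborel. partial_d i (\<lambda>x. \<phi> x * \<eta> x) x) = 0"
  proof (rule integral_partial_d_eq_0[where R = "R + 1"])
    show "(\<lambda>x. \<phi> x * \<eta> x) differentiable at x" for x
      using d by (intro differentiable_mult)
    show "continuous_on UNIV (partial_d i (\<lambda>x. \<phi> x * \<eta> x))"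
      unfolding eq using p assms by (intro continuous_intros test_continuous_on)
    show "\<phi> x * \<eta> x = 0" if "R + 1 \<le> norm x" for x
    proof (rule ccontr)
      assume "\<not> ?thesis"
      then have "x \<in> closure {x. \<phi> x \<noteq> 0}"
        using closure_subset[of "{x. \<phi> x \<noteq> 0}"] by auto
      then show False using R that by fastforce
    qed
  qed
  then show ?thesis
    unfolding eq using assms p by (simp add: l2_inner_test_lborel test_integrable_lborel)
qed

text \<open>Two applications of the mean value theorem, the first to the difference in direction
  \<open>j\<close> as a function of the step in direction \<open>i\<close>. The left-hand side is
  symmetric in \<open>i\<close> and \<open>j\<close> while the right-hand side fixes an order of
  differentiation.\<close>

lemma mixed_difference_quotient:
  assumes "\<phi> \<in> test_functions \<Omega>" "h > 0"
  shows "\<exists>y. norm (y - x) \<le> 2 * h \<and>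
    \<phi> (x + h *\<^sub>R axis i 1 + h *\<^sub>R axis j 1) - \<phi> (x + h *\<^sub>R axis i 1) - \<phi> (x + h *\<^sub>R axis j 1) + \<phi> x
      = h\<^sup>2 * partial_d j (partial_d i \<phi>) y"
proof -
  let ?a = "axis i 1 :: real^2" and ?b = "axis j 1 :: real^2"
  note d = test_differentiable[OF assms(1)]
    test_differentiable[OF test_partial_d[OF assms(1), of i]]
  let ?G = "\<lambda>s. \<phi> ((x + h *\<^sub>R ?b) + s *\<^sub>R ?a) - \<phi> (x + s *\<^sub>R ?a)"
  let ?H = "\<lambda>s r. partial_d i \<phi> ((x + s *\<^sub>R ?a) + r *\<^sub>R ?b)"
  have "\<exists>s. 0 < s \<and> s < h \<and> ?G h - ?G 0
      = (h - 0) * (partial_d i \<phi> ((x + h *\<^sub>R ?b) + s *\<^sub>R ?a) - partial_d i \<phi> (x + s *\<^sub>R ?a))"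
    by (rule MVT2[OF assms(2)]) (intro DERIV_diff has_real_derivative_along_axis d)
  then obtain s where s: "0 < s" "s < h" and 1: "?G h - ?G 0 = h * (?H s h - ?H s 0)"
    by (auto simp: algebra_simps)
  have "\<exists>r. 0 < r \<and> r < h \<and> ?H s h - ?H s 0
      = (h - 0) * partial_d j (partial_d i \<phi>) ((x + s *\<^sub>R ?a) + r *\<^sub>R ?b)"
    by (rule MVT2[OF assms(2)]) (intro has_real_derivative_along_axis d)
  then obtain r where r: "0 < r" "r < h"
    and 2: "?H s h - ?H s 0 = h * partial_d j (partial_d i \<phi>) ((x + s *\<^sub>R ?a) + r *\<^sub>R ?b)" by auto
  let ?y = "(x + s *\<^sub>R ?a) + r *\<^sub>R ?b"
  have "norm (?y - x) \<le> norm (s *\<^sub>R ?a) + norm (r *\<^sub>R ?b)"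
    using norm_triangle_ineq[of "s *\<^sub>R ?a" "r *\<^sub>R ?b"] by (simp add: algebra_simps)
  also have "\<dots> \<le> 2 * h" using s r by simp
  finally have "norm (?y - x) \<le> 2 * h" .
  moreover have "\<phi> (x + h *\<^sub>R ?a + h *\<^sub>R ?b) - \<phi> (x + h *\<^sub>R ?a) - \<phi> (x + h *\<^sub>R ?b) + \<phi> x
      = h\<^sup>2 * partial_d j (partial_d i \<phi>) ?y"
    using 1 2 by (simp add: power2_eq_square algebra_simps)
  ultimately show ?thesis by blast
qed

text \<open>Schwarz's theorem: the same second difference is represented by both mixed derivatives
  at points within 2 h of \<open>x\<close>, and both are continuous, being test functions
  themselves.\<close>

lemma partial_d_commute:
  assumes "\<phi> \<in> test_functions \<Omega>"
  shows "partial_d i (partial_d j \<phi>) = partial_d j (partial_d i \<phi>)"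
proof
  fix x
  define P where "P = partial_d i (partial_d j \<phi>)"
  define Q where "Q = partial_d j (partial_d i \<phi>)"
  have c: "isCont P x" "isCont Q x"
    unfolding P_def Q_def
    by (intro differentiable_imp_continuous_within test_differentiable[of _ \<Omega>]
        test_partial_d assms)+
  define h where "h k = 1 / real (Suc k)" for k
  have h: "0 < h k" for k by (auto simp: h_def field_simps)
  have hlim: "(\<lambda>k. 2 * h k) \<longlonglongrightarrow> 0"
    unfolding h_def by (rule tendsto_mult_right_zero) (rule LIMSEQ_Suc[OF lim_1_over_n])
  have "\<exists>y z. norm (y - x) \<le> 2 * h k \<and> norm (z - x) \<le> 2 * h k \<and> P y = Q z" for k
  proof -
    obtain y where y: "norm (y - x) \<le> 2 * h k"
      "\<phi> (x + h k *\<^sub>R axis j 1 + h k *\<^sub>R axis i 1) - \<phi> (x + h k *\<^sub>R axis j 1) - \<phi> (x + h k *\<^sub>R axis i 1) + \<phi> x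
        = (h k)\<^sup>2 * P y"
      using mixed_difference_quotient[OF assms h] unfolding P_def by blast
    obtain z where z: "norm (z - x) \<le> 2 * h k"
      "\<phi> (x + h k *\<^sub>R axis i 1 + h k *\<^sub>R axis j 1) - \<phi> (x + h k *\<^sub>R axis i 1) - \<phi> (x + h k *\<^sub>R axis j 1) + \<phi> x
        = (h k)\<^sup>2 * Q z"
      using mixed_difference_quotient[OF assms h] unfolding Q_def by blast
    have "(h k)\<^sup>2 * P y = (h k)\<^sup>2 * Q z"
      using y(2) z(2) by (simp add: algebra_simps)
    then show ?thesis using y z h[of k] by auto
  qed
  then obtain y z where yz: "\<And>k. norm (y k - x) \<le> 2 * h k" "\<And>k. norm (z k - x) \<le> 2 * h k" "\<And>k. P (y k) = Q (z k)"
    by metis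
  have "y \<longlonglongrightarrow> x" "z \<longlonglongrightarrow> x"
    using yz hlim by (auto intro!: LIM_zero_cancel Lim_null_comparison[OF _ hlim] always_eventually)
  then have "(\<lambda>k. P (y k)) \<longlonglongrightarrow> P x" "(\<lambda>k. Q (z k)) \<longlonglongrightarrow> Q x"
    using c by (auto intro: isCont_tendsto_compose)
  then have "P x = Q x" using yz(3) LIMSEQ_unique by auto
  then show "partial_d i (partial_d j \<phi>) x = partial_d j (partial_d i \<phi>) x"
    by (simp add: P_def Q_def)
qed

text \<open>Commuting derivatives turns the square of the Laplacian into the double divergence of
  the Hessian. This is the only link between \<open>has_weak_bilaplacian\<close>, stated with
  Laplacians, and \<open>hessian_form\<close>.\<close>

lemma laplacian_laplacian_test:
  assumes "\<phi> \<in> test_functions \<Omega>"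
  shows "laplacian (laplacian \<phi>)
    = (\<lambda>x. \<Sum>i\<in>UNIV. \<Sum>j\<in>UNIV. iter_partial [i, j] (iter_partial [i, j] \<phi>) x)"
proof -
  note it = test_iter_partial[OF assms]
  have lap: "laplacian \<phi> = (\<lambda>x. iter_partial [1, 1] \<phi> x + iter_partial [2, 2] \<phi> x)"
    by (rule ext) (simp only: laplacian_def sum_2)
  have c: "iter_partial [i, i] (iter_partial [j, j] \<phi>) = iter_partial [i, j] (iter_partial [i, j] \<phi>)" for i j
    using partial_d_commute[OF test_partial_d[OF assms, of j], of i j] by simp
  have "iter_partial [i, i] (laplacian \<phi>)
      = (\<lambda>x. \<Sum>j\<in>UNIV. iter_partial [i, j] (iter_partial [i, j] \<phi>) x)" for i
    unfolding lap iter_partial_add[OF it it] c[of i 1] c[of i 2] sum_2 ..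
  then show ?thesis unfolding laplacian_def[of "laplacian \<phi>"] by simp
qed

lemma test_laplacian:
  assumes "\<phi> \<in> test_functions \<Omega>" shows "laplacian \<phi> \<in> test_functions \<Omega>"
proof -
  have lap: "laplacian \<phi> = (\<lambda>x. iter_partial [1, 1] \<phi> x + iter_partial [2, 2] \<phi> x)"
    by (rule ext) (simp only: laplacian_def sum_2)
  show ?thesis unfolding lap by (intro test_add test_iter_partial assms)
qed

section \<open>Eigenfunction expansions and the domain of the biharmonic operator\<close>

lemma has_weak_deriv_diff:
  assumes \<Omega>: "\<Omega> \<in> lmeasurable" and L: "w \<in> L2 \<Omega>" "v \<in> L2 \<Omega>" "g \<in> L2 \<Omega>" "h \<in> L2 \<Omega>"
    and "has_weak_deriv \<Omega> \<alpha> w g" "has_weak_deriv \<Omega> \<alpha> v h"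
  shows "has_weak_deriv \<Omega> \<alpha> (\<lambda>x. w x - v x) (\<lambda>x. g x - h x)"
  unfolding has_weak_deriv_def
proof
  fix \<phi> assume p: "\<phi> \<in> test_functions \<Omega>"
  have t: "iter_partial \<alpha> \<phi> \<in> L2 \<Omega>" "\<phi> \<in> L2 \<Omega>"
    using p \<Omega> by (auto intro: test_L2 test_iter_partial)
  show "l2_inner \<Omega> (\<lambda>x. w x - v x) (iter_partial \<alpha> \<phi>)
      = (- 1) ^ length \<alpha> * l2_inner \<Omega> (\<lambda>x. g x - h x) \<phi>"
    using assms p t by (simp add: l2_inner_diff_left has_weak_deriv_def right_diff_distrib)
qed

lemma has_weak_deriv_limit:
  assumes \<Omega>: "\<Omega> \<in> lmeasurable" and L: "\<And>k. s k \<in> L2 \<Omega>" "\<And>k. d k \<in> L2 \<Omega>" "w \<in> L2 \<Omega>" "g \<in> L2 \<Omega>"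
    and wd: "\<And>k. has_weak_deriv \<Omega> \<alpha> (s k) (d k)"
    and lim: "l2_lim \<Omega> s w" "l2_lim \<Omega> d g"
  shows "has_weak_deriv \<Omega> \<alpha> w g"
  unfolding has_weak_deriv_def
proof
  fix \<phi> assume p: "\<phi> \<in> test_functions \<Omega>"
  have t: "iter_partial \<alpha> \<phi> \<in> L2 \<Omega>" "\<phi> \<in> L2 \<Omega>"
    using p \<Omega> by (auto intro: test_L2 test_iter_partial)
  have "(\<lambda>k. l2_inner \<Omega> (s k) (iter_partial \<alpha> \<phi>)) \<longlonglongrightarrow> l2_inner \<Omega> w (iter_partial \<alpha> \<phi>)"
    by (rule l2_inner_tendsto[OF L(1,3) t(1) lim(1)])
  moreover have "(\<lambda>k. l2_inner \<Omega> (s k) (iter_partial \<alpha> \<phi>)) \<longlonglongrightarrow> (- 1) ^ length \<alpha> * l2_inner \<Omega> g \<phi>"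
    using tendsto_mult_left[OF l2_inner_tendsto[OF L(2,4) t(2) lim(2)], of "(- 1) ^ length \<alpha>"]
      wd p by (simp add: has_weak_deriv_def)
  ultimately show "l2_inner \<Omega> w (iter_partial \<alpha> \<phi>) = (- 1) ^ length \<alpha> * l2_inner \<Omega> g \<phi>"
    by (rule LIMSEQ_unique)
qed

lemma length_le_2_cases:
  assumes "length \<alpha> \<le> 2"
  obtains "\<alpha> = []" | i where "\<alpha> = [i]" | i j where "\<alpha> = [i, j]"
  using assms by (cases \<alpha>; cases "tl \<alpha>") auto

lemma test_has_weak_deriv:
  assumes "open \<Omega>" "\<phi> \<in> test_functions \<Omega>" "length \<alpha> \<le> 2"
  shows "has_weak_deriv \<Omega> \<alpha> \<phi> (iter_partial \<alpha> \<phi>)"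
  unfolding has_weak_deriv_def
proof
  fix \<eta> assume e: "\<eta> \<in> test_functions \<Omega>"
  show "l2_inner \<Omega> \<phi> (iter_partial \<alpha> \<eta>) = (- 1) ^ length \<alpha> * l2_inner \<Omega> (iter_partial \<alpha> \<phi>) \<eta>"
    using assms(3)
  proof (cases rule: length_le_2_cases)
    case (3 i j)
    have "l2_inner \<Omega> \<phi> (partial_d i (partial_d j \<eta>)) = l2_inner \<Omega> (partial_d j (partial_d i \<phi>)) \<eta>"
      using test_integration_by_parts[OF assms(1,2) test_partial_d[OF e]]
        test_integration_by_parts[OF assms(1) test_partial_d[OF assms(2)] e] by simp
    then show ?thesis using 3 partial_d_commute[OF assms(2), of i j] by simp
  qed (use test_integration_by_parts[OF assms(1,2) e] in auto)
qed

lemma finite_lists_length_le_2: "finite {\<alpha> :: 2 list. length \<alpha> \<le> 2}"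
  using finite_lists_length_le[of "UNIV :: 2 set" 2] by simp

lemma sobolev_norm_2:
  "sobolev_norm \<Omega> 2 w = sqrt (\<Sum>\<alpha> | length \<alpha> \<le> 2. (l2_norm \<Omega> (weak_deriv \<Omega> \<alpha> w))\<^sup>2)"
  by (simp add: sobolev_norm_def)

lemma l2_norm_weak_deriv_le:
  assumes "length \<alpha> \<le> 2"
  shows "l2_norm \<Omega> (weak_deriv \<Omega> \<alpha> w) \<le> sobolev_norm \<Omega> 2 w"
  unfolding sobolev_norm_2
  using assms by (intro real_le_rsqrt member_le_sum finite_lists_length_le_2) auto

lemma H20_L2: "w \<in> H20 \<Omega> \<Longrightarrow> w \<in> L2 \<Omega>"
  by (simp add: H20_def sobolev_def)

text \<open>Interpolation makes the first derivatives converge as well, so the \<open>w\<close> below are exactly the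
  elements of \<open>H\<^sup>2\<^sub>0\<close>, with Hessian \<open>g\<close>.\<close>

definition h2_limit ::
    "(real^2) set \<Rightarrow> (real^2 \<Rightarrow> real) \<Rightarrow> (2 \<Rightarrow> 2 \<Rightarrow> real^2 \<Rightarrow> real) \<Rightarrow> bool" where
  "h2_limit \<Omega> w g \<longleftrightarrow> w \<in> L2 \<Omega> \<and> (\<forall>i j. g i j \<in> L2 \<Omega>) \<and>
     (\<exists>\<phi>. (\<forall>k::nat. \<phi> k \<in> test_functions \<Omega>) \<and> l2_lim \<Omega> \<phi> w \<and>
        (\<forall>i j. l2_lim \<Omega> (\<lambda>k. iter_partial [i, j] (\<phi> k)) (g i j)))"

text \<open>One integration by parts followed by Cauchy-Schwarz. Applied to differences of
  approximants, it makes first derivatives Cauchy as soon as the functions and their pure second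
  derivatives are.\<close>

lemma l2_norm_first_derivative:
  assumes "open \<Omega>" "\<Omega> \<in> lmeasurable" "\<phi> \<in> test_functions \<Omega>"
  shows "(l2_norm \<Omega> (partial_d i \<phi>))\<^sup>2 \<le> l2_norm \<Omega> \<phi> * l2_norm \<Omega> (iter_partial [i, i] \<phi>)"
proof -
  have "(l2_norm \<Omega> (partial_d i \<phi>))\<^sup>2 = - l2_inner \<Omega> \<phi> (iter_partial [i, i] \<phi>)"
    using test_integration_by_parts[OF assms(1,3) test_partial_d[OF assms(3), of i], of i]
    by (simp add: l2_norm_power2)
  also have "\<dots> \<le> l2_norm \<Omega> \<phi> * l2_norm \<Omega> (iter_partial [i, i] \<phi>)"
    using l2_Cauchy_Schwarz[OF test_L2[OF assms(2,3)]
        test_L2[OF assms(2) test_iter_partial[OF assms(3)]], of "[i, i]"] by linarith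
  finally show ?thesis .
qed

lemma l2_convergent_Cauchy:
  assumes "\<And>k::nat. s k \<in> L2 \<Omega>" "w \<in> L2 \<Omega>" "l2_lim \<Omega> s w" "e > 0"
  shows "\<exists>N. \<forall>m\<ge>N. \<forall>n\<ge>N. l2_dist \<Omega> (s m) (s n) < e"
proof -
  obtain N where N: "\<And>k. k \<ge> N \<Longrightarrow> l2_dist \<Omega> (s k) w < e / 2"
    using LIMSEQ_D[OF assms(3), of "e / 2"] assms(4) by (auto simp: l2_norm_nonneg)
  have "l2_dist \<Omega> (s m) (s n) < e" if "m \<ge> N" "n \<ge> N" for m n
    using l2_dist_triangle[OF assms(1,2,1), of m n] N[OF that(1)] N[OF that(2)]
      l2_dist_commute[of \<Omega> w "s n"] by linarith
  then show ?thesis by blast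
qed

lemma h2_limit_add:
  assumes \<Omega>: "\<Omega> \<in> lmeasurable" and "h2_limit \<Omega> w g" "h2_limit \<Omega> v h"
  shows "h2_limit \<Omega> (\<lambda>x. w x + v x) (\<lambda>i j x. g i j x + h i j x)"
proof -
  obtain \<phi> \<eta> where t: "\<And>k. \<phi> k \<in> test_functions \<Omega>" "\<And>k. \<eta> k \<in> test_functions \<Omega>"
    and l: "l2_lim \<Omega> \<phi> w" "l2_lim \<Omega> \<eta> v"
      "\<And>i j. l2_lim \<Omega> (\<lambda>k. iter_partial [i, j] (\<phi> k)) (g i j)"
      "\<And>i j. l2_lim \<Omega> (\<lambda>k. iter_partial [i, j] (\<eta> k)) (h i j)"
    using assms(2,3) unfolding h2_limit_def by blast
  have L: "w \<in> L2 \<Omega>" "v \<in> L2 \<Omega>" "\<And>i j. g i j \<in> L2 \<Omega>" "\<And>i j. h i j \<in> L2 \<Omega>"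
    using assms(2,3) unfolding h2_limit_def by blast+
  have add: "(\<lambda>k. l2_norm \<Omega> (\<lambda>x. (a k x + b k x) - (c x + d x))) \<longlonglongrightarrow> 0"
    if "\<And>k. a k \<in> L2 \<Omega>" "\<And>k. b k \<in> L2 \<Omega>" "c \<in> L2 \<Omega>" "d \<in> L2 \<Omega>"
      "l2_lim \<Omega> a c" "l2_lim \<Omega> b d" for a b c d
  proof (rule Lim_null_comparison[OF always_eventually tendsto_add_zero[OF that(5,6)]], rule allI)
    fix k
    show "norm (l2_norm \<Omega> (\<lambda>x. (a k x + b k x) - (c x + d x)))
        \<le> l2_dist \<Omega> (a k) c + l2_dist \<Omega> (b k) d"
      using l2_norm_triangle[OF L2_diff[OF that(1,3)] L2_diff[OF that(2,4)], of k k]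
      by (simp add: l2_norm_nonneg algebra_simps)
  qed
  note it = test_L2[OF \<Omega> test_iter_partial]
  have "(\<lambda>k. l2_norm \<Omega> (\<lambda>x. (\<phi> k x + \<eta> k x) - (w x + v x))) \<longlonglongrightarrow> 0"
    by (rule add[OF test_L2[OF \<Omega> t(1)] test_L2[OF \<Omega> t(2)] L(1,2) l(1,2)])
  moreover have "(\<lambda>k. l2_norm \<Omega> (\<lambda>x. iter_partial [i, j] (\<lambda>x. \<phi> k x + \<eta> k x) x - (g i j x + h i j x))) \<longlonglongrightarrow> 0" for i j
    unfolding iter_partial_add[OF t] by (rule add[OF it[OF t(1)] it[OF t(2)] L(3,4) l(3,4)])
  ultimately show ?thesis
    unfolding h2_limit_def using L t
    by (intro conjI allI L2_add exI[of _ "\<lambda>k x. \<phi> k x + \<eta> k x"] test_add) auto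
qed

lemma h2_limit_scale:
  assumes "h2_limit \<Omega> w g"
  shows "h2_limit \<Omega> (\<lambda>x. c * w x) (\<lambda>i j x. c * g i j x)"
proof -
  obtain \<phi> where t: "\<And>k. \<phi> k \<in> test_functions \<Omega>"
    and l: "l2_lim \<Omega> \<phi> w"
      "\<And>i j. l2_lim \<Omega> (\<lambda>k. iter_partial [i, j] (\<phi> k)) (g i j)"
    using assms unfolding h2_limit_def by blast
  have L: "w \<in> L2 \<Omega>" "\<And>i j. g i j \<in> L2 \<Omega>"
    using assms unfolding h2_limit_def by blast+
  have sc: "l2_norm \<Omega> (\<lambda>x. c * a x - c * b x) = \<bar>c\<bar> * l2_dist \<Omega> a b" for a b
    using l2_norm_scale[of \<Omega> c "\<lambda>x. a x - b x"] by (simp add: right_diff_distrib)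
  show ?thesis
    unfolding h2_limit_def using L t
    by (intro conjI allI L2_scale exI[of _ "\<lambda>k x. c * \<phi> k x"] test_scale)
      (auto simp: sc iter_partial_scale[OF t] simp del: iter_partial.simps
        intro!: tendsto_mult_right_zero l)
qed

lemma h2_limit_zero: "h2_limit \<Omega> (\<lambda>x. 0) (\<lambda>i j x. 0)"
proof -
  have "iter_partial \<alpha> (\<lambda>x. 0) = (\<lambda>x. 0)" for \<alpha>
    by (induction \<alpha>) (auto simp: partial_d_def)
  then show ?thesis
    unfolding h2_limit_def
    by (intro conjI allI exI[of _ "\<lambda>k x. 0"] L2_zero test_zero)
      (simp_all add: l2_norm_zero del: iter_partial.simps)
qed

text \<open>Here the payoff of carrying the Hessian as an explicit argument:
  \<open>weak_deriv\<close> is an arbitrary choice and need not be linear pointwise, whereas the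
  Hessian of a combination is literally the combination of the Hessians.\<close>

lemma h2_limit_sum:
  assumes "\<Omega> \<in> lmeasurable" "finite I" "\<And>n. n \<in> I \<Longrightarrow> h2_limit \<Omega> (w n) (g n)"
  shows "h2_limit \<Omega> (\<lambda>x. \<Sum>n\<in>I. w n x) (\<lambda>i j x. \<Sum>n\<in>I. g n i j x)"
  using assms(2,3)
  by (induction I rule: finite_induct) (auto simp: h2_limit_zero intro!: h2_limit_add[OF assms(1)])

text \<open>Diagonal argument: for each \<open>N\<close> a single test function is picked within 1 /
  (N + 1) of \<open>w N\<close> in the function and in all second derivatives at once.\<close>

lemma h2_limit_closed:
  assumes \<Omega>: "\<Omega> \<in> lmeasurable" and h: "\<And>N::nat. h2_limit \<Omega> (w N) (g N)"
    and L: "v \<in> L2 \<Omega>" "\<And>i j. p i j \<in> L2 \<Omega>"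
    and lim: "l2_lim \<Omega> w v"
      "\<And>i j. l2_lim \<Omega> (\<lambda>N. g N i j) (p i j)"
  shows "h2_limit \<Omega> v p"
proof -
  have L': "w N \<in> L2 \<Omega>" "g N i j \<in> L2 \<Omega>" for N i j
    using h unfolding h2_limit_def by blast+
  have "\<exists>\<phi>. \<phi> \<in> test_functions \<Omega> \<and> l2_dist \<Omega> \<phi> (w N) < 1 / real (Suc N) \<and>
      (\<forall>i j. l2_dist \<Omega> (iter_partial [i, j] \<phi>) (g N i j) < 1 / real (Suc N))" for N
  proof -
    obtain \<phi> where t: "\<And>k. \<phi> k \<in> test_functions \<Omega>"
      and l: "l2_lim \<Omega> \<phi> (w N)"
        "\<And>i j. l2_lim \<Omega> (\<lambda>k. iter_partial [i, j] (\<phi> k)) (g N i j)"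
      using h[of N] unfolding h2_limit_def by blast
    have e: "0 < 1 / real (Suc N)" by simp
    \<comment> \<open>There are finitely many index pairs, so one \<open>k\<close> serves all of
      these conditions.\<close>
    have "\<forall>\<^sub>F k in sequentially. l2_dist \<Omega> (\<phi> k) (w N) < 1 / real (Suc N) \<and>
        (\<forall>i\<in>UNIV. \<forall>j\<in>UNIV. l2_dist \<Omega> (iter_partial [i, j] (\<phi> k)) (g N i j) < 1 / real (Suc N))"
      by (intro eventually_conj eventually_ball_finite ballI finite order_tendstoD(2)[OF l(1) e]
          order_tendstoD(2)[OF l(2) e])
    then obtain k where "l2_dist \<Omega> (\<phi> k) (w N) < 1 / real (Suc N) \<and>
        (\<forall>i\<in>UNIV. \<forall>j\<in>UNIV. l2_dist \<Omega> (iter_partial [i, j] (\<phi> k)) (g N i j) < 1 / real (Suc N))"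
      using eventually_happens'[OF sequentially_bot] by blast
    then show ?thesis using t[of k] by blast
  qed
  then obtain \<phi> where t: "\<And>N. \<phi> N \<in> test_functions \<Omega>"
    and l: "\<And>N. l2_dist \<Omega> (\<phi> N) (w N) < 1 / real (Suc N)"
      "\<And>N i j. l2_dist \<Omega> (iter_partial [i, j] (\<phi> N)) (g N i j) < 1 / real (Suc N)"
    by metis
  have sq: "l2_lim \<Omega> a c"
    if "\<And>N. a N \<in> L2 \<Omega>" "\<And>N. b N \<in> L2 \<Omega>" "c \<in> L2 \<Omega>"
      "\<And>N. l2_dist \<Omega> (a N) (b N) < 1 / real (Suc N)"
      "l2_lim \<Omega> b c" for a b c
  proof (rule Lim_null_comparison[OF always_eventually tendsto_add_zero[OF LIMSEQ_Suc[OF lim_1_over_n] that(5)]],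
      rule allI)
    fix N
    show "norm (l2_dist \<Omega> (a N) c) \<le> 1 / real (Suc N) + l2_dist \<Omega> (b N) c"
      using l2_dist_triangle[OF that(1,2,3), of N N] that(4)[of N] by (simp add: l2_norm_nonneg)
  qed
  note it = test_L2[OF \<Omega> test_iter_partial[OF t]]
  show ?thesis
    unfolding h2_limit_def
    by (intro conjI allI L exI[of _ \<phi>] t sq[OF test_L2[OF \<Omega> t] L'(1) L(1) l(1) lim(1)]
        sq[OF it L'(2) L(2) l(2) lim(2)])
qed

section \<open>Eigenfunction expansions and the energy space\<close>

locale clamped_plate =
  fixes \<Omega> :: "(real^2) set" and lam :: "nat \<Rightarrow> real" and \<psi> :: "nat \<Rightarrow> real^2 \<Rightarrow> real"
  assumes open_domain: "open \<Omega>" and bounded_domain: "bounded \<Omega>"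
    and eigensystem: "biharmonic_eigensystem \<Omega> lam \<psi>"
begin

abbreviation coeff :: "(real^2 \<Rightarrow> real) \<Rightarrow> nat \<Rightarrow> real" where
  "coeff w n \<equiv> l2_inner \<Omega> w (\<psi> n)"

lemma lmeas_domain: "\<Omega> \<in> lmeasurable"
  using open_domain bounded_domain by (rule lmeasurable_open[rotated])

lemma lam_ge: "lam 0 \<le> lam n" and lam_pos: "0 < lam n"
proof -
  show "lam 0 \<le> lam n" using eigensystem by (auto simp: biharmonic_eigensystem_def mono_def)
  then show "0 < lam n" using eigensystem by (auto simp: biharmonic_eigensystem_def)
qed

lemma psi_H20: "\<psi> n \<in> H20 \<Omega>"
  and psi_bilaplacian: "has_weak_bilaplacian \<Omega> (\<psi> n) (\<lambda>x. lam n * \<psi> n x)"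
  and psi_orthonormal: "l2_inner \<Omega> (\<psi> m) (\<psi> n) = (if m = n then 1 else 0)"
  and psi_expansion: "w \<in> L2 \<Omega> \<Longrightarrow>
    (\<lambda>N. l2_norm \<Omega> (\<lambda>x. w x - (\<Sum>n<N. coeff w n * \<psi> n x))) \<longlonglongrightarrow> 0"
  using eigensystem unfolding biharmonic_eigensystem_def by blast+

lemma psi_L2: "\<psi> n \<in> L2 \<Omega>"
  using psi_H20 by (rule H20_L2)

lemma psi_norm: "l2_norm \<Omega> (\<psi> n) = 1"
  by (simp add: l2_norm_def psi_orthonormal)

lemma combination_L2: "finite I \<Longrightarrow> (\<lambda>x. \<Sum>n\<in>I. c n * \<psi> n x) \<in> L2 \<Omega>"
  by (intro L2_sum L2_scale psi_L2)

lemma l2_inner_combination: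
  assumes "finite I" "w \<in> L2 \<Omega>"
  shows "l2_inner \<Omega> (\<lambda>x. \<Sum>n\<in>I. c n * \<psi> n x) w = (\<Sum>n\<in>I. c n * coeff w n)"
  using assms by (simp add: l2_inner_sum_left L2_scale psi_L2 l2_inner_scale_left l2_inner_commute[of \<Omega> w])

lemma coeff_combination:
  "finite I \<Longrightarrow> coeff (\<lambda>x. \<Sum>n\<in>I. c n * \<psi> n x) m = (if m \<in> I then c m else 0)"
  by (simp add: l2_inner_combination psi_L2 psi_orthonormal if_distrib[of "times _"] cong: if_cong)

lemma Parseval:
  assumes "w \<in> L2 \<Omega>" "v \<in> L2 \<Omega>"
  shows "(\<lambda>n. coeff w n * coeff v n) sums l2_inner \<Omega> w v"
proof -
  have "(\<lambda>N. l2_inner \<Omega> (\<lambda>x. \<Sum>n<N. coeff w n * \<psi> n x) v) \<longlonglongrightarrow> l2_inner \<Omega> w v"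
    using psi_expansion[OF assms(1)] combination_L2 assms
    by (intro l2_inner_tendsto) (auto simp: l2_dist_commute[of \<Omega> w])
  then show ?thesis using assms by (simp add: sums_def l2_inner_combination)
qed

lemma Parseval_norm: "w \<in> L2 \<Omega> \<Longrightarrow> (\<lambda>n. (coeff w n)\<^sup>2) sums (l2_norm \<Omega> w)\<^sup>2"
  using Parseval[of w w] unfolding l2_norm_power2 by (simp add: power2_eq_square)

lemma coeff_bound: "w \<in> L2 \<Omega> \<Longrightarrow> \<bar>coeff w n\<bar> \<le> l2_norm \<Omega> w"
  using l2_Cauchy_Schwarz[OF _ psi_L2, of w n] by (simp add: psi_norm)

lemma Riesz_Fischer:
  assumes "summable (\<lambda>n. (c n)\<^sup>2)"
  shows "\<exists>w \<in> L2 \<Omega>. \<forall>n. coeff w n = c n"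
proof -
  define s where "s N x = (\<Sum>n<N. c n * \<psi> n x)" for N x
  have sL: "s N \<in> L2 \<Omega>" for N unfolding s_def[abs_def] by (rule combination_L2) simp
  have diff: "(l2_dist \<Omega> (s n) (s m))\<^sup>2 = (\<Sum>i\<in>{m..<n}. (c i)\<^sup>2)" if "m \<le> n" for m n
  proof -
    have "(\<lambda>x. s n x - s m x) = (\<lambda>x. \<Sum>i\<in>{m..<n}. c i * \<psi> i x)"
      using that by (auto simp: s_def fun_eq_iff lessThan_atLeast0 sum_diff_nat_ivl)
    then show ?thesis
      unfolding l2_norm_power2
      by (simp add: l2_inner_combination combination_L2 coeff_combination power2_eq_square)
  qed
  have "\<exists>w \<in> L2 \<Omega>. l2_lim \<Omega> s w"
    using L2_complete_summable[OF lmeas_domain sL assms] diff by simp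
  then obtain w where w: "w \<in> L2 \<Omega>" "l2_lim \<Omega> s w" by blast
  have "coeff w n = c n" for n
  proof (rule LIMSEQ_unique)
    show "(\<lambda>N. coeff (s N) n) \<longlonglongrightarrow> coeff w n" by (rule l2_inner_tendsto[OF sL w(1) psi_L2 w(2)])
    have "\<forall>\<^sub>F N in sequentially. coeff (s N) n = c n"
      using eventually_gt_at_top[of n]
      by eventually_elim (simp add: s_def[abs_def] coeff_combination)
    then show "(\<lambda>N. coeff (s N) n) \<longlonglongrightarrow> c n" by (rule tendsto_eventually)
  qed
  then show ?thesis using w(1) by blast
qed

text \<open>No mollification is needed for the uniqueness of weak derivatives: the eigenfunctions are
  \<open>L\<^sup>2\<close> limits of test functions and form a basis.\<close>

lemma l2_norm_eq_0_if_orthogonal: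
  assumes g: "g \<in> L2 \<Omega>" and orth: "\<And>\<phi>. \<phi> \<in> test_functions \<Omega> \<Longrightarrow> l2_inner \<Omega> g \<phi> = 0"
  shows "l2_norm \<Omega> g = 0"
proof -
  have "coeff g n = 0" for n
  proof -
    obtain \<phi> where t: "\<And>k::nat. \<phi> k \<in> test_functions \<Omega>"
      and l: "(\<lambda>k. sobolev_norm \<Omega> 2 (\<lambda>x. \<psi> n x - \<phi> k x)) \<longlonglongrightarrow> 0"
      using psi_H20[of n] by (auto simp: H20_def)
    have "l2_lim \<Omega> \<phi> (\<psi> n)"
    proof (rule Lim_null_comparison[OF always_eventually l], rule allI)
      fix k
      show "norm (l2_dist \<Omega> (\<phi> k) (\<psi> n)) \<le> sobolev_norm \<Omega> 2 (\<lambda>x. \<psi> n x - \<phi> k x)"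
        using l2_norm_weak_deriv_le[of "[]" \<Omega> "\<lambda>x. \<psi> n x - \<phi> k x"]
        by (simp add: weak_deriv_def l2_norm_nonneg l2_dist_commute[of \<Omega> "\<phi> k"])
    qed
    then have "(\<lambda>k. l2_inner \<Omega> (\<phi> k) g) \<longlonglongrightarrow> l2_inner \<Omega> (\<psi> n) g"
      by (intro l2_inner_tendsto test_L2[OF lmeas_domain] t psi_L2 g)
    moreover have "l2_inner \<Omega> (\<phi> k) g = 0" for k
      using orth[OF t] by (subst l2_inner_commute)
    ultimately have "l2_inner \<Omega> (\<psi> n) g = 0" by (simp add: LIMSEQ_const_iff)
    then show ?thesis by (subst l2_inner_commute)
  qed
  then have "(\<lambda>n. 0 :: real) sums (l2_norm \<Omega> g)\<^sup>2" using Parseval_norm[OF g] by simp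
  then have "(l2_norm \<Omega> g)\<^sup>2 = 0" using sums_zero by (rule sums_unique2)
  then show ?thesis by simp
qed

text \<open>Replaces the function selected by \<open>SOME\<close> by any weak derivative that is at
  hand. Two weak derivatives have a difference orthogonal to all test functions, hence zero almost
  everywhere. The empty list is separate because \<open>weak_deriv\<close> then returns
  \<open>w\<close> without a choice.\<close>

lemma weak_deriv_eq:
  assumes w: "w \<in> L2 \<Omega>" and g: "g \<in> L2 \<Omega>" and wd: "has_weak_deriv \<Omega> \<alpha> w g"
  shows "weak_deriv \<Omega> \<alpha> w \<in> L2 \<Omega>" "has_weak_deriv \<Omega> \<alpha> w (weak_deriv \<Omega> \<alpha> w)"
    and "AE x in lebesgue_on \<Omega>. weak_deriv \<Omega> \<alpha> w x = g x"
proof -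
  let ?d = "weak_deriv \<Omega> \<alpha> w"
  have *: "?d \<in> L2 \<Omega> \<and> has_weak_deriv \<Omega> \<alpha> w ?d"
  proof (cases "\<alpha> = []")
    case True
    then show ?thesis using w by (simp add: weak_deriv_def has_weak_deriv_def)
  next
    case False
    then show ?thesis
      using someI_ex[of "\<lambda>g. g \<in> L2 \<Omega> \<and> has_weak_deriv \<Omega> \<alpha> w g"] g wd
      by (auto simp: weak_deriv_def)
  qed
  then show d: "?d \<in> L2 \<Omega>" and wd': "has_weak_deriv \<Omega> \<alpha> w ?d" by auto
  have "l2_dist \<Omega> ?d g = 0"
  proof (rule l2_norm_eq_0_if_orthogonal[OF L2_diff[OF d g]])
    fix \<phi> assume p: "\<phi> \<in> test_functions \<Omega>"
    then have "l2_inner \<Omega> ?d \<phi> = l2_inner \<Omega> g \<phi>"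
      using wd wd' by (auto simp: has_weak_deriv_def)
    then show "l2_inner \<Omega> (\<lambda>x. ?d x - g x) \<phi> = 0"
      using d g test_L2[OF lmeas_domain p] by (simp add: l2_inner_diff_left)
  qed
  then show "AE x in lebesgue_on \<Omega>. ?d x = g x"
    using l2_norm_eq_0_AE[OF L2_diff[OF d g]] by auto
qed

text \<open>The convergence in \<open>H20\<close> involves the chosen weak derivative of the
  difference w - \<phi>, a choice unrelated to the one made for w. The norms do not see the choice,
  so distances between known derivatives can be used instead.\<close>

lemma l2_norm_weak_deriv_diff_test:
  assumes w: "w \<in> L2 \<Omega>" and g: "g \<in> L2 \<Omega>" and wd: "has_weak_deriv \<Omega> \<alpha> w g"
    and p: "\<phi> \<in> test_functions \<Omega>" and \<alpha>: "length \<alpha> \<le> 2"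
  shows "l2_norm \<Omega> (weak_deriv \<Omega> \<alpha> (\<lambda>x. w x - \<phi> x)) = l2_dist \<Omega> (iter_partial \<alpha> \<phi>) g"
proof -
  note t = test_L2[OF lmeas_domain p]
    test_L2[OF lmeas_domain test_iter_partial[OF p]]
  have "has_weak_deriv \<Omega> \<alpha> (\<lambda>x. w x - \<phi> x) (\<lambda>x. g x - iter_partial \<alpha> \<phi> x)"
    by (rule has_weak_deriv_diff[OF lmeas_domain w t(1) g t(2) wd
          test_has_weak_deriv[OF open_domain p \<alpha>]])
  note d = weak_deriv_eq[OF L2_diff[OF w t(1)] L2_diff[OF g t(2)] this]
  have "l2_norm \<Omega> (weak_deriv \<Omega> \<alpha> (\<lambda>x. w x - \<phi> x)) = l2_dist \<Omega> g (iter_partial \<alpha> \<phi>)"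
    by (rule l2_norm_cong_AE[OF L2_borel_measurable[OF d(1)] L2_borel_measurable[OF L2_diff[OF g t(2)]] d(3)])
  then show ?thesis by (simp add: l2_dist_commute[of \<Omega> g])
qed

lemma h2_limit_weak_deriv:
  assumes "h2_limit \<Omega> w g"
  shows "has_weak_deriv \<Omega> [i, j] w (g i j)"
proof -
  obtain \<phi> where t: "\<And>k. \<phi> k \<in> test_functions \<Omega>"
    and l: "l2_lim \<Omega> \<phi> w"
      "\<And>i j. l2_lim \<Omega> (\<lambda>k. iter_partial [i, j] (\<phi> k)) (g i j)"
    using assms unfolding h2_limit_def by blast
  have L: "w \<in> L2 \<Omega>" "\<And>i j. g i j \<in> L2 \<Omega>"
    using assms unfolding h2_limit_def by blast+
  show ?thesis
    by (rule has_weak_deriv_limit[OF lmeas_domain test_L2[OF lmeas_domain t]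
          test_L2[OF lmeas_domain test_iter_partial[OF t]] L(1,2)
          test_has_weak_deriv[OF open_domain t] l(1,2)]) simp
qed

lemma H20_h2_limit:
  assumes "w \<in> H20 \<Omega>"
  shows "h2_limit \<Omega> w (\<lambda>i j. weak_deriv \<Omega> [i, j] w)"
proof -
  note w = H20_L2[OF assms]
  obtain \<phi> where t: "\<And>k::nat. \<phi> k \<in> test_functions \<Omega>"
    and l: "(\<lambda>k. sobolev_norm \<Omega> 2 (\<lambda>x. w x - \<phi> k x)) \<longlonglongrightarrow> 0"
    using assms by (auto simp: H20_def)
  have "\<exists>g\<in>L2 \<Omega>. has_weak_deriv \<Omega> \<alpha> w g" if "length \<alpha> \<le> 2" for \<alpha>
    using assms that by (simp add: H20_def sobolev_def)
  then have d: "weak_deriv \<Omega> \<alpha> w \<in> L2 \<Omega>" "has_weak_deriv \<Omega> \<alpha> w (weak_deriv \<Omega> \<alpha> w)"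
    if "length \<alpha> \<le> 2" for \<alpha>
    using weak_deriv_eq[OF w] that by blast+
  have lim: "l2_lim \<Omega> (\<lambda>k. iter_partial \<alpha> (\<phi> k)) (weak_deriv \<Omega> \<alpha> w)"
    if "length \<alpha> \<le> 2" for \<alpha>
  proof (rule Lim_null_comparison[OF always_eventually l], rule allI)
    fix k
    show "norm (l2_dist \<Omega> (iter_partial \<alpha> (\<phi> k)) (weak_deriv \<Omega> \<alpha> w))
        \<le> sobolev_norm \<Omega> 2 (\<lambda>x. w x - \<phi> k x)"
      using l2_norm_weak_deriv_diff_test[OF w d[OF that] t that, of k]
        l2_norm_weak_deriv_le[OF that, of \<Omega> "\<lambda>x. w x - \<phi> k x"] by (simp add: l2_norm_nonneg)
  qed
  have "l2_lim \<Omega> \<phi> w"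
    using lim[of "[]"] by (simp add: weak_deriv_def)
  then show ?thesis
    unfolding h2_limit_def using lim d(1) t w
    by (intro conjI allI exI[of _ \<phi>]) (auto simp del: iter_partial.simps)
qed

text \<open>\<open>h2_limit\<close> says nothing about first derivatives. The interpolation
  inequality, applied to differences of approximants, makes them Cauchy; completeness supplies
  limits, which are weak derivatives because these pass to \<open>L2\<close> limits.\<close>

lemma h2_limit_H20:
  assumes "h2_limit \<Omega> w g" shows "w \<in> H20 \<Omega>"
proof -
  obtain \<phi> where t: "\<And>k. \<phi> k \<in> test_functions \<Omega>"
    and l: "l2_lim \<Omega> \<phi> w"
      "\<And>i j. l2_lim \<Omega> (\<lambda>k. iter_partial [i, j] (\<phi> k)) (g i j)"
    using assms unfolding h2_limit_def by blast
  have L: "w \<in> L2 \<Omega>" "\<And>i j. g i j \<in> L2 \<Omega>"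
    using assms unfolding h2_limit_def by blast+
  note tL = test_L2[OF lmeas_domain t]
    and itL = test_L2[OF lmeas_domain test_iter_partial[OF t]]
  have "\<exists>p \<in> L2 \<Omega>. l2_lim \<Omega> (\<lambda>k. iter_partial [i] (\<phi> k)) p" for i
  proof (rule L2_complete[OF lmeas_domain itL])
    fix e :: real assume "e > 0"
    obtain N1 where N1: "\<And>m n. m \<ge> N1 \<Longrightarrow> n \<ge> N1 \<Longrightarrow> l2_dist \<Omega> (\<phi> m) (\<phi> n) < e"
      using l2_convergent_Cauchy[OF tL L(1) l(1) \<open>e > 0\<close>] by blast
    obtain N2 where N2: "\<And>m n. m \<ge> N2 \<Longrightarrow> n \<ge> N2 \<Longrightarrow>
        l2_dist \<Omega> (iter_partial [i, i] (\<phi> m)) (iter_partial [i, i] (\<phi> n)) < e"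
      using l2_convergent_Cauchy[OF itL L(2) l(2) \<open>e > 0\<close>] by blast
    have "l2_dist \<Omega> (iter_partial [i] (\<phi> m)) (iter_partial [i] (\<phi> n)) < e"
      if "m \<ge> max N1 N2" "n \<ge> max N1 N2" for m n
    proof -
      \<comment> \<open>The difference in this form is a test function by the closure lemmas for
        sums and multiples, which also give its derivatives.\<close>
      define \<eta> where "\<eta> x = \<phi> m x + (-1) * \<phi> n x" for x
      have \<eta>: "\<eta> \<in> test_functions \<Omega>"
        unfolding \<eta>_def[abs_def] by (intro test_add test_scale t)
      have it: "iter_partial \<alpha> \<eta> = (\<lambda>x. iter_partial \<alpha> (\<phi> m) x - iter_partial \<alpha> (\<phi> n) x)" for \<alpha>
        unfolding \<eta>_def[abs_def] iter_partial_add[OF t test_scale[OF t]] iter_partial_scale[OF t]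
        by simp
      have "l2_norm \<Omega> \<eta> < e" using N1[of m n] that by (simp add: \<eta>_def[abs_def])
      moreover have "l2_norm \<Omega> (iter_partial [i, i] \<eta>) < e" using N2[of m n] that unfolding it by simp
      ultimately have "l2_norm \<Omega> \<eta> * l2_norm \<Omega> (iter_partial [i, i] \<eta>) < e * e"
        by (intro mult_strict_mono' l2_norm_nonneg)
      moreover have "(l2_norm \<Omega> (iter_partial [i] \<eta>))\<^sup>2 \<le> l2_norm \<Omega> \<eta> * l2_norm \<Omega> (iter_partial [i, i] \<eta>)"
        using l2_norm_first_derivative[OF open_domain lmeas_domain \<eta>, of i]
        unfolding iter_partial.simps .
      ultimately have "(l2_norm \<Omega> (iter_partial [i] \<eta>))\<^sup>2 < e\<^sup>2"
        unfolding power2_eq_square[of e] by (rule le_less_trans[rotated])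
      then have "l2_norm \<Omega> (iter_partial [i] \<eta>) < e"
        using \<open>e > 0\<close> by (auto intro: power2_less_imp_less simp del: iter_partial.simps)
      then show ?thesis unfolding it .
    qed
    then show "\<exists>N. \<forall>m\<ge>N. \<forall>n\<ge>N.
        l2_dist \<Omega> (iter_partial [i] (\<phi> m)) (iter_partial [i] (\<phi> n)) < e" by blast
  qed
  then have "\<exists>p. \<forall>i. p i \<in> L2 \<Omega> \<and> l2_lim \<Omega> (\<lambda>k. iter_partial [i] (\<phi> k)) (p i)"
    by (intro choice) blast
  then obtain p where p: "\<And>i. p i \<in> L2 \<Omega>"
    "\<And>i. l2_lim \<Omega> (\<lambda>k. iter_partial [i] (\<phi> k)) (p i)" by blast
  have "\<exists>G \<in> L2 \<Omega>. l2_lim \<Omega> (\<lambda>k. iter_partial \<alpha> (\<phi> k)) G"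
    if "length \<alpha> \<le> 2" for \<alpha>
    using that
  proof (cases rule: length_le_2_cases)
    case 1 then show ?thesis using L(1) l(1) by auto
  next
    case (2 i) then show ?thesis using p by blast
  next
    case (3 i j) then show ?thesis using L(2) l(2) by blast
  qed
  then have "\<exists>G. \<forall>\<alpha>. length \<alpha> \<le> 2 \<longrightarrow> G \<alpha> \<in> L2 \<Omega> \<and>
      l2_lim \<Omega> (\<lambda>k. iter_partial \<alpha> (\<phi> k)) (G \<alpha>)"
    by (intro choice) blast
  then obtain G where G: "\<And>\<alpha>. length \<alpha> \<le> 2 \<Longrightarrow> G \<alpha> \<in> L2 \<Omega>"
    "\<And>\<alpha>. length \<alpha> \<le> 2 \<Longrightarrow> l2_lim \<Omega> (\<lambda>k. iter_partial \<alpha> (\<phi> k)) (G \<alpha>)" by blast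
  have wd: "has_weak_deriv \<Omega> \<alpha> w (G \<alpha>)" if "length \<alpha> \<le> 2" for \<alpha>
    by (rule has_weak_deriv_limit[OF lmeas_domain tL itL L(1) G(1)[OF that]
          test_has_weak_deriv[OF open_domain t that] l(1) G(2)[OF that]])
  have "w \<in> sobolev \<Omega> 2"
    using L(1) wd G(1) by (auto simp: sobolev_def)
  moreover have "(\<lambda>k. sobolev_norm \<Omega> 2 (\<lambda>x. w x - \<phi> k x)) \<longlonglongrightarrow> sqrt (\<Sum>\<alpha>::2 list | length \<alpha> \<le> 2. 0\<^sup>2)"
    unfolding sobolev_norm_2
  proof (intro tendsto_real_sqrt tendsto_sum tendsto_power)
    fix \<alpha> :: "2 list" assume "\<alpha> \<in> {\<alpha>. length \<alpha> \<le> 2}"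
    then have a: "length \<alpha> \<le> 2" by simp
    show "(\<lambda>k. l2_norm \<Omega> (weak_deriv \<Omega> \<alpha> (\<lambda>x. w x - \<phi> k x))) \<longlonglongrightarrow> 0"
      using G(2)[OF a] by (simp only: l2_norm_weak_deriv_diff_test[OF L(1) G(1)[OF a] wd[OF a] t a])
  qed
  ultimately show ?thesis using t by (auto simp: H20_def intro!: exI[of _ \<phi>])
qed

text \<open>Green's formula a(w, v) = (w, A v) for w in the energy space and v in the domain of the
  operator. For a test function in place of w it is the definition of the distributional derivatives
  of v; only w has to be approximated, as both sides are continuous in it.\<close>

lemma h2_limit_bilaplacian:
  assumes w: "h2_limit \<Omega> w g" and v: "h2_limit \<Omega> v h"
    and b: "b \<in> L2 \<Omega>" "has_weak_bilaplacian \<Omega> v b"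
  shows "(\<Sum>i\<in>UNIV. \<Sum>j\<in>UNIV. l2_inner \<Omega> (g i j) (h i j)) = l2_inner \<Omega> w b"
proof -
  obtain \<phi> where t: "\<And>k. \<phi> k \<in> test_functions \<Omega>"
    and l: "l2_lim \<Omega> \<phi> w"
      "\<And>i j. l2_lim \<Omega> (\<lambda>k. iter_partial [i, j] (\<phi> k)) (g i j)"
    using w unfolding h2_limit_def by blast
  have L: "w \<in> L2 \<Omega>" "v \<in> L2 \<Omega>" "\<And>i j. g i j \<in> L2 \<Omega>" "\<And>i j. h i j \<in> L2 \<Omega>"
    using w v unfolding h2_limit_def by blast+
  note tL = test_L2[OF lmeas_domain t]
    and it = test_iter_partial[OF t]
    and itL = test_L2[OF lmeas_domain test_iter_partial[OF t]]
  have eq: "(\<Sum>i\<in>UNIV. \<Sum>j\<in>UNIV. l2_inner \<Omega> (iter_partial [i, j] (\<phi> k)) (h i j)) = l2_inner \<Omega> (\<phi> k) b" for k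
  proof -
    have "l2_inner \<Omega> (iter_partial [i, j] (\<phi> k)) (h i j)
        = l2_inner \<Omega> v (iter_partial [i, j] (iter_partial [i, j] (\<phi> k)))" for i j
      using h2_limit_weak_deriv[OF v, of i j] it[of "[i, j]" k]
      by (simp add: has_weak_deriv_def l2_inner_commute[of \<Omega> _ "h i j"] del: iter_partial.simps)
    moreover have "l2_inner \<Omega> v (laplacian (laplacian (\<phi> k)))
        = (\<Sum>i\<in>UNIV. \<Sum>j\<in>UNIV. l2_inner \<Omega> v (iter_partial [i, j] (iter_partial [i, j] (\<phi> k))))"
      unfolding laplacian_laplacian_test[OF t]
      by (simp add: l2_inner_sum_right L2_sum test_L2[OF lmeas_domain]
          test_iter_partial it L del: iter_partial.simps)
    moreover have "l2_inner \<Omega> v (laplacian (laplacian (\<phi> k))) = l2_inner \<Omega> (\<phi> k) b"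
      using b(2) t by (simp add: has_weak_bilaplacian_def l2_inner_commute[of \<Omega> b])
    ultimately show ?thesis by simp
  qed
  have "(\<lambda>k. \<Sum>i\<in>UNIV. \<Sum>j\<in>UNIV. l2_inner \<Omega> (iter_partial [i, j] (\<phi> k)) (h i j))
      \<longlonglongrightarrow> (\<Sum>i\<in>UNIV. \<Sum>j\<in>UNIV. l2_inner \<Omega> (g i j) (h i j))"
    by (intro tendsto_sum l2_inner_tendsto[OF itL L(3,4) l(2)])
  moreover have "(\<lambda>k. l2_inner \<Omega> (\<phi> k) b) \<longlonglongrightarrow> l2_inner \<Omega> w b"
    by (rule l2_inner_tendsto[OF tL L(1) b(1) l(1)])
  ultimately show ?thesis unfolding eq by (rule LIMSEQ_unique)
qed

lemma hessian_form_eq: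
  assumes "w \<in> H20 \<Omega>" "v \<in> H20 \<Omega>"
  shows "hessian_form \<Omega> w v
    = (\<Sum>i\<in>UNIV. \<Sum>j\<in>UNIV. l2_inner \<Omega> (weak_deriv \<Omega> [i, j] w) (weak_deriv \<Omega> [i, j] v))"
proof -
  have "weak_deriv \<Omega> [i, j] w \<in> L2 \<Omega>" "weak_deriv \<Omega> [i, j] v \<in> L2 \<Omega>" for i j
    using assms[THEN H20_h2_limit] unfolding h2_limit_def by blast+
  then show ?thesis
    by (simp add: hessian_form_def l2_inner_def l2_integrable_mult)
qed

text \<open>Turns the variational equation tested with an eigenfunction into the scalar oscillator
  equation for one coefficient.\<close>

lemma hessian_form_psi:
  assumes "w \<in> H20 \<Omega>"
  shows "hessian_form \<Omega> w (\<psi> n) = lam n * coeff w n"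
  unfolding hessian_form_eq[OF assms psi_H20]
    h2_limit_bilaplacian[OF H20_h2_limit[OF assms] H20_h2_limit[OF psi_H20] L2_scale[OF psi_L2] psi_bilaplacian]
  by (rule l2_inner_scale_right)

text \<open>Symmetry of the operator: the Hessian pairing of \<open>w\<close> and \<psi>_n is
  evaluated once by the bilaplacian of \<psi>_n and once, with exchanged roles, by that of
  \<open>w\<close>.\<close>

lemma coeff_bilaplacian:
  assumes "w \<in> H20 \<Omega>" "g \<in> L2 \<Omega>" "has_weak_bilaplacian \<Omega> w g"
  shows "lam n * coeff w n = coeff g n"
proof -
  have "lam n * coeff w n = (\<Sum>i\<in>UNIV. \<Sum>j\<in>UNIV. l2_inner \<Omega> (weak_deriv \<Omega> [i, j] w) (weak_deriv \<Omega> [i, j] (\<psi> n)))"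
    using hessian_form_psi[OF assms(1)] hessian_form_eq[OF assms(1) psi_H20] by simp
  also have "\<dots> = (\<Sum>i\<in>UNIV. \<Sum>j\<in>UNIV. l2_inner \<Omega> (weak_deriv \<Omega> [i, j] (\<psi> n)) (weak_deriv \<Omega> [i, j] w))"
    by (simp add: l2_inner_commute)
  also have "\<dots> = l2_inner \<Omega> (\<psi> n) g"
    by (rule h2_limit_bilaplacian[OF H20_h2_limit[OF psi_H20] H20_h2_limit[OF assms(1)] assms(2,3)])
  finally show ?thesis by (simp add: l2_inner_commute)
qed

lemma dom_A_summable:
  assumes "w \<in> dom_A \<Omega>"
  shows "summable (\<lambda>n. (lam n * coeff w n)\<^sup>2)"
proof -
  obtain g where g: "g \<in> L2 \<Omega>" "has_weak_bilaplacian \<Omega> w g" and w: "w \<in> H20 \<Omega>"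
    using assms by (auto simp: dom_A_def)
  show ?thesis
    using Parseval_norm[OF g(1)] by (simp add: coeff_bilaplacian[OF w g] sums_iff)
qed

lemma combination_bilaplacian:
  assumes "finite I"
  shows "has_weak_bilaplacian \<Omega> (\<lambda>x. \<Sum>n\<in>I. c n * \<psi> n x) (\<lambda>x. \<Sum>n\<in>I. (c n * lam n) * \<psi> n x)"
  unfolding has_weak_bilaplacian_def
proof
  fix \<phi> assume p: "\<phi> \<in> test_functions \<Omega>"
  have "l2_inner \<Omega> (\<psi> n) (laplacian (laplacian \<phi>)) = lam n * l2_inner \<Omega> (\<psi> n) \<phi>" for n
    using psi_bilaplacian[of n] p by (simp add: has_weak_bilaplacian_def l2_inner_scale_left)
  then show "l2_inner \<Omega> (\<lambda>x. \<Sum>n\<in>I. c n * \<psi> n x) (laplacian (laplacian \<phi>))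
      = l2_inner \<Omega> (\<lambda>x. \<Sum>n\<in>I. (c n * lam n) * \<psi> n x) \<phi>"
    unfolding l2_inner_combination[OF assms test_L2[OF lmeas_domain p]]
      l2_inner_combination[OF assms test_L2[OF lmeas_domain
          test_laplacian[OF test_laplacian[OF p]]]]
    by (simp add: l2_inner_commute[of \<Omega> _ "\<psi> _"] mult.assoc)
qed

text \<open>The difficulty is to get from coefficients to \<open>H20\<close>. The Hessians of a
  block of the expansion have total squared norm equal to the sum of lam_k c_k^2 over the block, so
  the Hessians of the partial sums converge and closedness of \<open>h2_limit\<close> applies. The
  bilaplacian is the function with coefficients lam_n c_n, identified by Parseval against test
  functions.\<close>

lemma dom_A_I:
  assumes w: "w \<in> L2 \<Omega>" and sm: "summable (\<lambda>n. (lam n * coeff w n)\<^sup>2)"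
  shows "w \<in> dom_A \<Omega>"
proof -
  define c where "c n = coeff w n" for n
  define s where "s N x = (\<Sum>n<N. c n * \<psi> n x)" for N x
  define d where "d N i j x = (\<Sum>n<N. c n * weak_deriv \<Omega> [i, j] (\<psi> n) x)" for N i j x
  \<comment> \<open>Since lam_n is at least lam_0 > 0, finite A-norm implies finite energy; 1 /
    lam_0 is the constant of that embedding.\<close>
  have "summable (\<lambda>n. (1 / lam 0) * (lam n * c n)\<^sup>2)"
    using sm unfolding c_def by (rule summable_mult)
  then have sm1: "summable (\<lambda>n. lam n * (c n)\<^sup>2)"
  proof (rule summable_comparison_test')
    fix n
    have "lam 0 * (lam n * (c n)\<^sup>2) \<le> lam n * (lam n * (c n)\<^sup>2)"
      using lam_ge[of n] lam_pos[of n] by (intro mult_right_mono) auto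
    then have "lam n * (c n)\<^sup>2 \<le> 1 / lam 0 * (lam n * c n)\<^sup>2"
      using lam_pos[of 0] by (simp add: field_simps power2_eq_square)
    then show "norm (lam n * (c n)\<^sup>2) \<le> 1 / lam 0 * (lam n * c n)\<^sup>2"
      using lam_pos[of n] by simp
  qed
  have H: "h2_limit \<Omega> (\<lambda>x. \<Sum>n\<in>I. c n * \<psi> n x) (\<lambda>i j x. \<Sum>n\<in>I. c n * weak_deriv \<Omega> [i, j] (\<psi> n) x)"
    if "finite I" for I
    by (intro h2_limit_sum[OF lmeas_domain that] h2_limit_scale H20_h2_limit psi_H20)
  have h: "h2_limit \<Omega> (s N) (d N)" for N
    using H[of "{..<N}"] by (simp add: s_def[abs_def] d_def[abs_def])
  have dL: "d N i j \<in> L2 \<Omega>" for N i j using h unfolding h2_limit_def by blast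
  \<comment> \<open>A single Hessian entry is bounded by the full energy of the block, to which
    Green's formula applies with both arguments equal to the block; orthonormality leaves only the
    diagonal.\<close>
  have en: "(l2_dist \<Omega> (d n i j) (d m i j))\<^sup>2 \<le> (\<Sum>k\<in>{m..<n}. lam k * (c k)\<^sup>2)"
    if "m \<le> n" for m n i j
  proof -
    define g where "g i j x = (\<Sum>k\<in>{m..<n}. c k * weak_deriv \<Omega> [i, j] (\<psi> k) x)" for i j x
    have "(\<lambda>x. d n i j x - d m i j x) = g i j"
      using that by (auto simp: d_def g_def fun_eq_iff lessThan_atLeast0 sum_diff_nat_ivl)
    then have "(l2_dist \<Omega> (d n i j) (d m i j))\<^sup>2 = (l2_norm \<Omega> (g i j))\<^sup>2" by simp
    also have "\<dots> \<le> (\<Sum>j\<in>UNIV. (l2_norm \<Omega> (g i j))\<^sup>2)"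
      by (rule member_le_sum) auto
    also have "\<dots> \<le> (\<Sum>i\<in>UNIV. \<Sum>j\<in>UNIV. (l2_norm \<Omega> (g i j))\<^sup>2)"
      by (rule member_le_sum[of i UNIV "\<lambda>i. \<Sum>j\<in>UNIV. (l2_norm \<Omega> (g i j))\<^sup>2"]) (auto intro: sum_nonneg)
    also have "\<dots> = (\<Sum>i\<in>UNIV. \<Sum>j\<in>UNIV. l2_inner \<Omega> (g i j) (g i j))"
      by (simp add: l2_norm_power2)
    also have "\<dots> = l2_inner \<Omega> (\<lambda>x. \<Sum>k\<in>{m..<n}. c k * \<psi> k x) (\<lambda>x. \<Sum>k\<in>{m..<n}. (c k * lam k) * \<psi> k x)"
      unfolding g_def
      by (rule h2_limit_bilaplacian[OF H H combination_L2 combination_bilaplacian]) simp_all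
    also have "\<dots> = (\<Sum>k\<in>{m..<n}. lam k * (c k)\<^sup>2)"
      unfolding l2_inner_combination[OF finite_atLeastLessThan combination_L2[OF finite_atLeastLessThan]]
      by (intro sum.cong) (auto simp: coeff_combination power2_eq_square)
    finally show ?thesis .
  qed
  have "\<exists>p \<in> L2 \<Omega>. l2_lim \<Omega> (\<lambda>k. d k i j) p" for i j
    using L2_complete_summable[OF lmeas_domain dL sm1 en] .
  then have "\<exists>p. \<forall>i. \<forall>j. p i j \<in> L2 \<Omega> \<and> l2_lim \<Omega> (\<lambda>k. d k i j) (p i j)"
    by (intro choice allI) blast
  then obtain p where p: "\<And>i j. p i j \<in> L2 \<Omega>"
    "\<And>i j. l2_lim \<Omega> (\<lambda>k. d k i j) (p i j)" by blast
  have "l2_lim \<Omega> s w"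
    using psi_expansion[OF w] by (simp add: s_def c_def l2_dist_commute[of \<Omega> w])
  then have H20: "w \<in> H20 \<Omega>"
    by (rule h2_limit_H20[OF h2_limit_closed[OF lmeas_domain h w p(1) _ p(2)]])
  obtain g where g: "g \<in> L2 \<Omega>" "\<And>n. coeff g n = lam n * c n"
    using Riesz_Fischer[OF sm] unfolding c_def by blast
  have "has_weak_bilaplacian \<Omega> w g"
    unfolding has_weak_bilaplacian_def
  proof
    fix \<phi> assume t: "\<phi> \<in> test_functions \<Omega>"
    \<comment> \<open>The eigenvalue equation of \<psi>_n in the sense of distributions, read as a
      statement about the test function.\<close>
    have "coeff (laplacian (laplacian \<phi>)) n = lam n * coeff \<phi> n" for n
      using psi_bilaplacian[of n] t
      by (simp add: has_weak_bilaplacian_def l2_inner_scale_left l2_inner_commute[of \<Omega> _ "\<psi> n"])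
    then have "(\<lambda>n. coeff g n * coeff \<phi> n) sums l2_inner \<Omega> w (laplacian (laplacian \<phi>))"
      using Parseval[OF w test_L2[OF lmeas_domain test_laplacian[OF test_laplacian[OF t]]]]
      by (simp add: g(2) c_def algebra_simps)
    then show "l2_inner \<Omega> w (laplacian (laplacian \<phi>)) = l2_inner \<Omega> g \<phi>"
      using Parseval[OF g(1) test_L2[OF lmeas_domain t]] by (rule sums_unique2)
  qed
  then show ?thesis using H20 g(1) by (auto simp: dom_A_def)
qed

end

section \<open>Smooth functions of one real variable\<close>

text \<open>The derivative is an existential witness rather than an iterate of \<open>deriv\<close>,
  so closure under sums, products and affine substitution follows by induction.
  \<open>times_differentiable_iff\<close> returns to the iterated \<open>deriv\<close> of
  \<open>test_functions_time\<close>.\<close>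

primrec times_differentiable :: "nat \<Rightarrow> (real \<Rightarrow> real) \<Rightarrow> bool" where
  "times_differentiable 0 f \<longleftrightarrow> True"
| "times_differentiable (Suc n) f \<longleftrightarrow>
     (\<exists>f'. (\<forall>x. (f has_real_derivative f' x) (at x)) \<and> times_differentiable n f')"

lemma times_differentiable_SucI:
  "times_differentiable n f' \<Longrightarrow> (\<And>x. (f has_real_derivative f' x) (at x)) \<Longrightarrow>
    times_differentiable (Suc n) f"
  by auto

lemma times_differentiable_Suc_D: "times_differentiable (Suc n) f \<Longrightarrow> times_differentiable n f"
  by (induction n arbitrary: f) auto

lemma times_differentiable_iff:
  "times_differentiable n f \<longleftrightarrow> (\<forall>k<n. (deriv ^^ k) f differentiable_on UNIV)"
proof (induction n arbitrary: f)
  case (Suc n)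
  have "times_differentiable (Suc n) f \<longleftrightarrow> f differentiable_on UNIV \<and> times_differentiable n (deriv f)"
  proof
    assume "times_differentiable (Suc n) f"
    then obtain f' where f': "\<And>x. (f has_real_derivative f' x) (at x)" "times_differentiable n f'" by auto
    then have "deriv f = f'" by (intro ext DERIV_imp_deriv)
    then show "f differentiable_on UNIV \<and> times_differentiable n (deriv f)"
      using f' by (auto simp: differentiable_on_def real_differentiable_def)
  next
    assume *: "f differentiable_on UNIV \<and> times_differentiable n (deriv f)"
    then have "(f has_real_derivative deriv f x) (at x)" for x
      by (metis DERIV_imp_deriv UNIV_I differentiable_on_def real_differentiable_def)
    then show "times_differentiable (Suc n) f" using * by auto
  qed
  also have "\<dots> \<longleftrightarrow> (\<forall>k<Suc n. (deriv ^^ k) f differentiable_on UNIV)"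
    unfolding Suc.IH by (auto simp: less_Suc_eq_0_disj funpow_Suc_right simp del: funpow.simps)
  finally show ?case .
qed simp

lemma times_differentiable_const: "times_differentiable n (\<lambda>x. c)"
  by (induction n arbitrary: c) (auto intro!: exI[of _ "\<lambda>x. 0"])

lemma times_differentiable_add:
  "times_differentiable n f \<Longrightarrow> times_differentiable n g \<Longrightarrow> times_differentiable n (\<lambda>x. f x + g x)"
proof (induction n arbitrary: f g)
  case (Suc n)
  then obtain f' g' where "\<And>x. (f has_real_derivative f' x) (at x)" "times_differentiable n f'"
    "\<And>x. (g has_real_derivative g' x) (at x)" "times_differentiable n g'" by auto
  then show ?case
    by (intro times_differentiable_SucI[where f' = "\<lambda>x. f' x + g' x"] Suc.IH DERIV_add)
qed simp

lemma times_differentiable_mult: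
  "times_differentiable n f \<Longrightarrow> times_differentiable n g \<Longrightarrow> times_differentiable n (\<lambda>x. f x * g x)"
proof (induction n arbitrary: f g)
  case (Suc n)
  then obtain f' g' where *: "\<And>x. (f has_real_derivative f' x) (at x)" "times_differentiable n f'"
    "\<And>x. (g has_real_derivative g' x) (at x)" "times_differentiable n g'" by auto
  have "times_differentiable n (\<lambda>x. f' x * g x + g' x * f x)"
    using * Suc.prems[THEN times_differentiable_Suc_D]
    by (intro times_differentiable_add Suc.IH)
  moreover have "((\<lambda>x. f x * g x) has_real_derivative f' x * g x + g' x * f x) (at x)" for x
    by (rule DERIV_mult[OF *(1,3)])
  ultimately show ?case by (rule times_differentiable_SucI)
qed simp

lemma times_differentiable_affine:
  "times_differentiable n f \<Longrightarrow> times_differentiable n (\<lambda>x. f (a * x + b))"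
proof (induction n arbitrary: f)
  case (Suc n)
  then obtain f' where *: "\<And>x. (f has_real_derivative f' x) (at x)" "times_differentiable n f'" by auto
  have "times_differentiable n (\<lambda>x. f' (a * x + b) * a)"
    by (rule times_differentiable_mult[OF Suc.IH[OF *(2)] times_differentiable_const])
  moreover have "((\<lambda>x. f (a * x + b)) has_real_derivative f' (a * x + b) * a) (at x)" for x
    by (rule DERIV_chain'[OF _ *(1)]) (auto intro!: derivative_eq_intros)
  ultimately show ?case by (rule times_differentiable_SucI)
qed simp

lemma times_differentiable_sin_cos: "times_differentiable n sin \<and> times_differentiable n cos"
proof (induction n)
  case (Suc n)
  have "times_differentiable n (\<lambda>x. - 1 * sin x)"
    using Suc by (intro times_differentiable_mult times_differentiable_const) auto
  then have "times_differentiable (Suc n) cos"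
    by (rule times_differentiable_SucI) (auto intro!: derivative_eq_intros)
  moreover have "times_differentiable (Suc n) sin"
    using Suc by (intro times_differentiable_SucI[of n cos]) (auto intro!: derivative_eq_intros)
  ultimately show ?case by blast
qed simp

text \<open>The classical function exp(-1/x), extended by zero, times x^(-k). Derivatives of members
  are linear combinations of members, so smoothness can be proved for all \<open>k\<close> at once
  by induction on the order.\<close>

definition flat :: "nat \<Rightarrow> real \<Rightarrow> real" where
  "flat k x = (if x > 0 then inverse x ^ k * exp (- inverse x) else 0)"

lemma flat_tendsto_0: "(flat k \<longlongrightarrow> 0) (at 0)"
proof (rule filterlim_split_at)
  have "(flat k \<longlongrightarrow> 0) (at_left 0) \<longleftrightarrow> ((\<lambda>x. 0 :: real) \<longlongrightarrow> 0) (at_left (0::real))"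
    by (rule tendsto_cong) (auto simp: eventually_at_filter flat_def)
  then show "(flat k \<longlongrightarrow> 0) (at_left 0)" by simp
  have "((\<lambda>x. inverse x ^ k / exp (inverse x)) \<longlongrightarrow> (0::real)) (at_right 0)"
    by (rule filterlim_compose[OF tendsto_power_div_exp_0 filterlim_inverse_at_top_right])
  moreover have "(flat k \<longlongrightarrow> 0) (at_right 0)
      \<longleftrightarrow> ((\<lambda>x. inverse x ^ k / exp (inverse x)) \<longlongrightarrow> (0::real)) (at_right 0)"
    by (rule tendsto_cong) (auto simp: eventually_at_filter flat_def exp_minus divide_inverse)
  ultimately show "(flat k \<longlongrightarrow> 0) (at_right 0)" by simp
qed

lemma flat_has_derivative:
  "(flat k has_real_derivative flat (k + 2) x - real k * flat (k + 1) x) (at x)"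
proof -
  consider "x < 0" | "x = 0" | "x > 0" by linarith
  then show ?thesis
  proof cases
    case 1
    have "(flat k has_real_derivative 0) (at x)"
      by (rule has_field_derivative_transform_within_open[of "\<lambda>x. 0" 0 x "{..<0}"]) (use 1 in \<open>auto simp: flat_def\<close>)
    then show ?thesis using 1 by (simp add: flat_def)
  next
    case 2
    \<comment> \<open>The difference quotient at the origin is itself a member of the family, namely
      \<open>flat (Suc k)\<close>.\<close>
    have "((\<lambda>h. (flat k (0 + h) - flat k 0) / h) \<longlongrightarrow> 0) (at 0)
        \<longleftrightarrow> (flat (Suc k) \<longlongrightarrow> 0) (at 0)"
      by (rule tendsto_cong) (auto simp: eventually_at_filter flat_def divide_inverse)
    then show ?thesis using 2 flat_tendsto_0[of "Suc k"] by (simp add: DERIV_def flat_def)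
  next
    case 3
    have "((\<lambda>x. inverse x ^ k) has_real_derivative real k * (- (inverse x * inverse x) * inverse x ^ (k - 1))) (at x)"
      "((\<lambda>x. exp (- inverse x)) has_real_derivative exp (- inverse x) * (inverse x * inverse x)) (at x)"
      using 3 by (auto intro!: derivative_eq_intros)
    note D = DERIV_mult[OF this]
    have "((\<lambda>x. inverse x ^ k * exp (- inverse x)) has_real_derivative
        flat (k + 2) x - real k * flat (k + 1) x) (at x)"
      using 3 by (intro DERIV_cong[OF D]) (cases k; simp add: flat_def algebra_simps)
    then show ?thesis
      by (rule has_field_derivative_transform_within_open[of _ _ x "{0<..}"]) (use 3 in \<open>auto simp: flat_def\<close>)
  qed
qed

lemma times_differentiable_flat: "times_differentiable n (flat k)"
proof (induction n arbitrary: k)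
  case (Suc n)
  have "times_differentiable n (\<lambda>x. flat (k + 2) x + (- real k) * flat (k + 1) x)"
    using Suc by (intro times_differentiable_add times_differentiable_mult times_differentiable_const)
  then show ?case
    by (rule times_differentiable_SucI) (use flat_has_derivative[of k] in simp)
qed simp

text \<open>Normalised primitive of a bump supported in [0, 1]. A difference of two rescaled steps
  is a smooth approximation of the indicator of an interval, and the rescaled \<beta> are
  approximate identities at its endpoints.\<close>

lemma smooth_step_exists:
  obtains \<sigma> \<beta> :: "real \<Rightarrow> real" where
    "\<And>x. (\<sigma> has_real_derivative \<beta> x) (at x)" "\<And>n. times_differentiable n \<sigma>" "continuous_on UNIV \<beta>"
    "\<And>x. x \<le> 0 \<Longrightarrow> \<sigma> x = 0" "\<And>x. x \<ge> 1 \<Longrightarrow> \<sigma> x = 1" "\<And>x. 0 \<le> \<sigma> x" "\<And>x. \<sigma> x \<le> 1"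
    "\<And>x. 0 \<le> \<beta> x" "\<And>x. x \<notin> {0..1} \<Longrightarrow> \<beta> x = 0"
proof -
  define b where "b x = flat 0 x * flat 0 ((-1) * x + 1)" for x
  have td: "times_differentiable n b" for n
    unfolding b_def[abs_def]
    by (rule times_differentiable_mult[OF times_differentiable_flat
          times_differentiable_affine[OF times_differentiable_flat]])
  have "\<exists>b'. \<forall>x. (b has_real_derivative b' x) (at x)" using td[of 1] by auto
  then have cont: "continuous_on A b" for A
    by (meson DERIV_isCont continuous_at_imp_continuous_on)
  have b0: "b x = 0" if "x \<le> 0 \<or> x \<ge> 1" for x using that by (auto simp: b_def flat_def)
  have bpos: "b x > 0" if "0 < x" "x < 1" for x using that by (auto simp: b_def flat_def)
  have bnn: "b x \<ge> 0" for x by (auto simp: b_def flat_def)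
  \<comment> \<open>Starting at -1 instead of 0 puts the origin in the interior of the interval of
    integration, so the derivative there is two-sided; the bump vanishes on [-1, 0].\<close>
  define B where "B x = integral {-1..x} b" for x
  have DB: "(B has_real_derivative b x) (at x)" for x
  proof (cases "x < 0")
    case True
    have "B y = 0" if "y < 0" for y
    proof -
      have "integral {-1..y} b = integral {-1..y} (\<lambda>x. 0)"
        using that b0 by (intro integral_cong) auto
      then show ?thesis by (simp add: B_def)
    qed
    then have "(B has_real_derivative 0) (at x)"
      using has_field_derivative_transform_within_open[of "\<lambda>x. 0" 0 x "{..<0}" B] True by auto
    then show ?thesis using True b0 by simp
  next
    case False
    have "((\<lambda>x. integral {-1..x} b) has_real_derivative b x) (at x within {-1..x+1})"
      using False by (intro integral_has_real_derivative cont) auto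
    then show ?thesis using False by (simp add: B_def[abs_def] at_within_Icc_at)
  qed
  have mono: "B x \<le> B y" if "x \<le> y" for x y
    using that DERIV_nonneg_imp_nondecreasing[of x y B] DB bnn by blast
  have B0: "B x = B 0" if "x \<le> 0" for x
  proof (cases "x = 0")
    case False
    then have "x < 0" using that by simp
    then obtain z where "z < 0" "B 0 - B x = (0 - x) * b z" using MVT2[of x 0 B b] DB by blast
    then show ?thesis using b0[of z] by simp
  qed simp
  have B1: "B x = B 1" if "x \<ge> 1" for x
  proof (cases "x = 1")
    case False
    then have "x > 1" using that by simp
    then obtain z where "z > 1" "B x - B 1 = (x - 1) * b z" using MVT2[of 1 x B b] DB by blast
    then show ?thesis using b0[of z] by simp
  qed simp
  have "B (-1) = 0" by (simp add: B_def)
  then have B00: "B 0 = 0" using B0[of "-1"] by simp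
  obtain z where "0 < z" "z < 1" "B 1 - B 0 = (1 - 0) * b z" using MVT2[of 0 1 B b] DB by auto
  then have Bpos: "B 1 > 0" using bpos[of z] B00 by simp
  define \<sigma> where "\<sigma> x = (1 / B 1) * B x" for x
  have "times_differentiable n B" for n
    using times_differentiable_SucI[OF td DB] by (rule times_differentiable_Suc_D)
  then have td\<sigma>: "times_differentiable n \<sigma>" for n
    unfolding \<sigma>_def[abs_def] by (intro times_differentiable_mult times_differentiable_const)
  have D\<sigma>: "(\<sigma> has_real_derivative (1 / B 1) * b x) (at x)" for x
    unfolding \<sigma>_def[abs_def] by (rule DERIV_cmult[OF DB])
  have Bge: "0 \<le> B x" for x
    using mono[of 0 x] B0[of x] B00 by (cases "x \<le> 0") auto
  have Ble: "B x \<le> B 1" for x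
    using mono[of x 1] B1[of x] by (cases "x \<le> 1") auto
  show ?thesis
  proof (rule that[OF D\<sigma> td\<sigma>])
    show "continuous_on UNIV (\<lambda>x. (1 / B 1) * b x)" by (intro continuous_intros cont)
    show "\<sigma> x = 0" if "x \<le> 0" for x using B0[OF that] B00 by (simp add: \<sigma>_def)
    show "\<sigma> x = 1" if "x \<ge> 1" for x using B1[OF that] Bpos by (simp add: \<sigma>_def)
    show "0 \<le> \<sigma> x" "\<sigma> x \<le> 1" for x using Bge[of x] Ble[of x] Bpos by (auto simp: \<sigma>_def)
    show "0 \<le> (1 / B 1) * b x" for x using bnn[of x] Bpos by simp
    show "(1 / B 1) * b x = 0" if "x \<notin> {0..1}" for x using b0[of x] that by auto
  qed
qed

section \<open>The du Bois-Reymond lemma\<close>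

lemma test_functions_timeI:
  assumes "\<And>n. times_differentiable n \<theta>" "\<And>t. t \<notin> {a..b} \<Longrightarrow> \<theta> t = 0" "{a..b} \<subseteq> {0<..<T}"
  shows "\<theta> \<in> test_functions_time T"
proof -
  have "closure {t. \<theta> t \<noteq> 0} \<subseteq> {a..b}"
    using assms(2) by (intro closure_minimal subsetI closed_atLeastAtMost) blast
  moreover from this have "bounded {t. \<theta> t \<noteq> 0}"
    by (meson bounded_closed_interval bounded_subset closure_subset)
  moreover have "(deriv ^^ k) \<theta> differentiable_on UNIV" for k
    using assms(1)[of "Suc k"] unfolding times_differentiable_iff by blast
  ultimately show ?thesis using assms(3) by (auto simp: test_functions_time_def)
qed

lemma test_functions_time_D:
  assumes "\<theta> \<in> test_functions_time T"
  shows "times_differentiable n \<theta>" "(\<theta> has_real_derivative deriv \<theta> t) (at t)"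
    and "continuous_on A \<theta>" "continuous_on A (deriv \<theta>)" "t \<notin> {0<..<T} \<Longrightarrow> \<theta> t = 0"
proof -
  show td: "times_differentiable n \<theta>" for n
    using assms by (auto simp: times_differentiable_iff test_functions_time_def)
  obtain f' where f': "\<And>t. (\<theta> has_real_derivative f' t) (at t)" "times_differentiable 1 f'"
    using td[of 2] by (auto simp: numeral_2_eq_2)
  have eq: "deriv \<theta> = f'" using f'(1) by (intro ext DERIV_imp_deriv)
  then show "(\<theta> has_real_derivative deriv \<theta> t) (at t)" using f' by simp
  show "continuous_on A \<theta>" using f'(1) by (meson DERIV_isCont continuous_at_imp_continuous_on)
  show "continuous_on A (deriv \<theta>)"
    using f'(2) DERIV_isCont unfolding eq by (fastforce intro!: continuous_at_imp_continuous_on)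
  show "\<theta> t = 0" if "t \<notin> {0<..<T}"
    using assms that closure_subset[of "{t. \<theta> t \<noteq> 0}"] by (auto simp: test_functions_time_def)
qed

lemma integrable_mult_continuous:
  fixes m \<kappa> :: "real \<Rightarrow> real"
  assumes m: "integrable (lebesgue_on {0<..<T}) m" and k: "continuous_on {0..T} \<kappa>"
  shows "integrable (lebesgue_on {0<..<T}) (\<lambda>t. m t * \<kappa> t)"
proof -
  have "compact (\<kappa> ` {0..T})" by (intro compact_continuous_image k) auto
  then obtain B where B: "\<forall>t\<in>{0..T}. \<bar>\<kappa> t\<bar> \<le> B"
    by (auto dest!: compact_imp_bounded simp: bounded_iff)
  have km: "\<kappa> \<in> borel_measurable (lebesgue_on {0<..<T})"
    by (intro continuous_imp_measurable_on_sets_lebesgue continuous_on_subset[OF k]) auto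
  show ?thesis
  proof (rule Bochner_Integration.integrable_bound)
    show "integrable (lebesgue_on {0<..<T}) (\<lambda>t. B * \<bar>m t\<bar>)" using m by auto
    show "(\<lambda>t. m t * \<kappa> t) \<in> borel_measurable (lebesgue_on {0<..<T})"
      by (rule borel_measurable_times[OF borel_measurable_integrable[OF m] km])
    show "AE t in lebesgue_on {0<..<T}. norm (m t * \<kappa> t) \<le> norm (B * \<bar>m t\<bar>)"
    proof (rule AE_I2)
      fix t assume "t \<in> space (lebesgue_on {0<..<T})"
      then have "\<bar>\<kappa> t\<bar> \<le> B" using B by auto
      then have "\<bar>m t\<bar> * \<bar>\<kappa> t\<bar> \<le> \<bar>m t\<bar> * \<bar>B\<bar>" by (intro mult_left_mono) auto
      then show "norm (m t * \<kappa> t) \<le> norm (B * \<bar>m t\<bar>)" by (simp add: abs_mult mult.commute)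
    qed
  qed
qed

lemma integrable_continuous_time:
  fixes c :: "real \<Rightarrow> real"
  assumes "continuous_on {0..T} c"
  shows "integrable (lebesgue_on {0<..<T}) c"
proof -
  interpret finite_measure "lebesgue_on {0<..<T}"
    by (rule finite_measure_lebesgue_on) auto
  show ?thesis using integrable_mult_continuous[of T "\<lambda>t. 1" c] assms by simp
qed

lemma LINT_eq_integral_Icc:
  fixes g :: "real \<Rightarrow> real"
  assumes "integrable (lebesgue_on {0<..<T}) g"
  shows "(LINT t|lebesgue_on {0<..<T}. g t) = integral {0..T} g" "g integrable_on {0..T}"
  using lebesgue_integral_eq_integral[OF assms] integrable_on_lebesgue_on[OF assms]
  by (auto simp: integral_open_interval_real integrable_on_open_interval_real)

lemma has_real_derivative_rescaled:
  assumes "\<And>x. (\<sigma> has_real_derivative \<beta> x) (at x)"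
  shows "((\<lambda>t. \<sigma> (l * (t - a))) has_real_derivative l * \<beta> (l * (t - a))) (at t)"
proof -
  have "((\<lambda>t. l * (t - a)) has_real_derivative l) (at t)" by (auto intro!: derivative_eq_intros)
  from DERIV_chain'[OF this assms] show ?thesis by (simp add: mult.commute)
qed

text \<open>The kernel is the derivative of the rescaled step: its mass is 1 by the fundamental
  theorem of calculus, and its support lies in the one-sided interval [a, a + 1 / (k + 1)], where
  \<open>c\<close> is close to \<open>c a\<close>.\<close>

lemma approximate_identity:
  fixes c \<beta> \<sigma> :: "real \<Rightarrow> real"
  assumes c: "continuous_on {0..T} c" and a: "0 < a" "a < T"
    and \<sigma>: "\<And>x. (\<sigma> has_real_derivative \<beta> x) (at x)" "continuous_on UNIV \<beta>"
      "\<And>x. x \<le> 0 \<Longrightarrow> \<sigma> x = 0" "\<And>x. x \<ge> 1 \<Longrightarrow> \<sigma> x = 1" "\<And>x. 0 \<le> \<beta> x" "\<And>x. x \<notin> {0..1} \<Longrightarrow> \<beta> x = 0"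
  shows "(\<lambda>k. integral {0..T} (\<lambda>t. c t * (real (Suc k) * \<beta> (real (Suc k) * (t - a))))) \<longlonglongrightarrow> c a"
proof (rule LIMSEQ_I)
  fix e :: real assume "e > 0"
  let ?\<eta> = "\<lambda>k t. real (Suc k) * \<beta> (real (Suc k) * (t - a))"
  have "\<exists>d>0. \<forall>t\<in>{0..T}. dist t a < d \<longrightarrow> dist (c t) (c a) < e / 2"
    using c[unfolded continuous_on_iff, rule_format, of a "e / 2"] a \<open>e > 0\<close> by auto
  then obtain d where d: "d > 0" "\<And>t. t \<in> {0..T} \<Longrightarrow> \<bar>t - a\<bar> < d \<Longrightarrow> \<bar>c t - c a\<bar> < e / 2"
    by (auto simp: dist_real_def)
  \<comment> \<open>The first bound puts the support within the range of continuity
    \<open>d\<close>, the second keeps it to the left of \<open>T\<close>, so that no mass is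
    lost.\<close>
  obtain K where K: "inverse (real (Suc K)) < d" "inverse (real (Suc K)) < T - a"
    using reals_Archimedean[of "min d (T - a)"] d a by auto
  have "norm (integral {0..T} (\<lambda>t. c t * ?\<eta> k t) - c a) < e" if "k \<ge> K" for k
  proof -
    have "inverse (real (Suc k)) \<le> inverse (real (Suc K))" using that by (intro le_imp_inverse_le) auto
    then have k: "inverse (real (Suc k)) < d" "inverse (real (Suc k)) < T - a" using K by linarith+
    have c\<eta>: "continuous_on {0..T} (?\<eta> k)"
      by (intro continuous_intros continuous_on_compose2[OF \<sigma>(2)]) auto
    have "((\<lambda>t. \<sigma> (real (Suc k) * (t - a))) has_real_derivative ?\<eta> k t) (at t)" for t
      by (rule has_real_derivative_rescaled[OF \<sigma>(1)])
    then have "(?\<eta> k has_integral \<sigma> (real (Suc k) * (T - a)) - \<sigma> (real (Suc k) * (0 - a))) {0..T}"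
      using a by (intro fundamental_theorem_of_calculus)
        (auto simp: has_real_derivative_iff_has_vector_derivative[symmetric] intro: DERIV_subset)
    moreover have "\<sigma> (real (Suc k) * (T - a)) = 1"
      using k(2) by (intro \<sigma>(4)) (simp add: field_simps)
    moreover have "\<sigma> (real (Suc k) * (0 - a)) = 0"
      using a by (intro \<sigma>(3)) (simp add: mult_nonneg_nonpos)
    ultimately have I: "(?\<eta> k has_integral 1) {0..T}" by simp
    have i1: "(\<lambda>t. c t * ?\<eta> k t) integrable_on {0..T}"
      by (intro integrable_continuous_real continuous_on_mult c c\<eta>)
    have i2: "((\<lambda>t. c a * ?\<eta> k t) has_integral c a) {0..T}"
      using has_integral_mult_right[OF I, of "c a"] by simp
    have "norm (integral {0..T} (\<lambda>t. c t * ?\<eta> k t - c a * ?\<eta> k t)) \<le> integral {0..T} (\<lambda>t. e / 2 * ?\<eta> k t)"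
    proof (rule integral_norm_bound_integral)
      show "(\<lambda>t. c t * ?\<eta> k t - c a * ?\<eta> k t) integrable_on {0..T}"
        using i1 i2 by (intro integrable_diff) auto
      show "(\<lambda>t. e / 2 * ?\<eta> k t) integrable_on {0..T}"
        using has_integral_mult_right[OF I, of "e / 2"] by auto
      fix t assume t: "t \<in> {0..T}"
      show "norm (c t * ?\<eta> k t - c a * ?\<eta> k t) \<le> e / 2 * ?\<eta> k t"
      proof (cases "real (Suc k) * (t - a) \<in> {0..1}")
        case True
        then have "0 \<le> t - a" by (simp add: zero_le_mult_iff)
        moreover have "t - a \<le> inverse (real (Suc k))" using True by (simp add: field_simps)
        ultimately have "\<bar>c t - c a\<bar> \<le> e / 2" using d(2)[OF t] k(1) by simp
        moreover have "0 \<le> ?\<eta> k t" using \<sigma>(5) by simp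
        ultimately have "\<bar>c t - c a\<bar> * ?\<eta> k t \<le> e / 2 * ?\<eta> k t" by (rule mult_right_mono)
        moreover have "norm (c t * ?\<eta> k t - c a * ?\<eta> k t) = \<bar>c t - c a\<bar> * ?\<eta> k t"
          unfolding left_diff_distrib[symmetric] real_norm_def abs_mult[of "c t - c a"]
          by (simp only: abs_of_nonneg[OF \<open>0 \<le> ?\<eta> k t\<close>])
        ultimately show ?thesis by simp
      qed (simp add: \<sigma>(6))
    qed
    also have "integral {0..T} (\<lambda>t. e / 2 * ?\<eta> k t) = e / 2"
      using integral_unique[OF has_integral_mult_right[OF I, of "e / 2"]] by (simp only: mult_1_right)
    also have "integral {0..T} (\<lambda>t. c t * ?\<eta> k t - c a * ?\<eta> k t) = integral {0..T} (\<lambda>t. c t * ?\<eta> k t) - c a"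
      by (simp only: integral_diff[OF i1 has_integral_integrable[OF i2]] integral_unique[OF i2])
    finally show ?thesis using \<open>e > 0\<close> by simp
  qed
  then show "\<exists>no. \<forall>k\<ge>no. norm (integral {0..T} (\<lambda>t. c t * ?\<eta> k t) - c a) < e" by blast
qed

definition has_weak_derivative_on :: "real \<Rightarrow> (real \<Rightarrow> real) \<Rightarrow> (real \<Rightarrow> real) \<Rightarrow> bool" where
  "has_weak_derivative_on T c m \<longleftrightarrow> (\<forall>\<theta> \<in> test_functions_time T.
     (LINT t|lebesgue_on {0<..<T}. c t * deriv \<theta> t) = - (LINT t|lebesgue_on {0<..<T}. m t * \<theta> t))"

text \<open>The weak identity is tested with smooth approximations of the indicator of the interval.
  Their derivatives concentrate at \<open>a\<close> and, with opposite sign, at \<open>b\<close>;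
  the other side converges by domination by |m|.\<close>

lemma weak_derivative_increment:
  assumes c: "continuous_on {0..T} c" and m: "integrable (lebesgue_on {0<..<T}) m"
    and wd: "has_weak_derivative_on T c m" and ab: "0 < a" "a < b" "b < T"
  shows "c b - c a = integral {a..b} m"
proof -
  let ?M = "lebesgue_on {0<..<T}"
  obtain \<sigma> \<beta> :: "real \<Rightarrow> real" where
    \<sigma>: "\<And>x. (\<sigma> has_real_derivative \<beta> x) (at x)" "continuous_on UNIV \<beta>"
      "\<And>x. x \<le> 0 \<Longrightarrow> \<sigma> x = 0" "\<And>x. x \<ge> 1 \<Longrightarrow> \<sigma> x = 1" "\<And>x. 0 \<le> \<beta> x" "\<And>x. x \<notin> {0..1} \<Longrightarrow> \<beta> x = 0"
    and td: "\<And>n. times_differentiable n \<sigma>" and \<sigma>01: "\<And>x. 0 \<le> \<sigma> x" "\<And>x. \<sigma> x \<le> 1"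
    using smooth_step_exists by metis
  define \<theta> where "\<theta> k t = \<sigma> (real (Suc k) * (t - a)) - \<sigma> (real (Suc k) * (t - b))" for k t
  define \<eta> where "\<eta> p k t = real (Suc k) * \<beta> (real (Suc k) * (t - p))" for p k t
  have D: "((\<lambda>t. \<sigma> (real (Suc k) * (t - p))) has_real_derivative \<eta> p k t) (at t)" for k p t
    unfolding \<eta>_def by (rule has_real_derivative_rescaled[OF \<sigma>(1)])
  have d\<theta>: "deriv (\<theta> k) = (\<lambda>t. \<eta> a k t - \<eta> b k t)" for k
    unfolding \<theta>_def[abs_def] by (intro ext DERIV_imp_deriv DERIV_diff D)
  \<comment> \<open>The approximate indicator lives on [a, b + 1 / (k + 1)], which is inside (0, T)
    only from \<open>K\<close> on; hence the index shift by \<open>K\<close> in both limits.\<close>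
  obtain K where K: "inverse (real (Suc K)) < T - b"
    using reals_Archimedean[of "T - b"] ab by auto
  have test: "\<theta> k \<in> test_functions_time T" if "k \<ge> K" for k
  proof (rule test_functions_timeI)
    show "times_differentiable n (\<theta> k)" for n
    proof -
      have "times_differentiable n (\<lambda>t. \<sigma> (real (Suc k) * t + (- real (Suc k) * a))
          + (-1) * \<sigma> (real (Suc k) * t + (- real (Suc k) * b)))"
        by (rule times_differentiable_add[OF times_differentiable_affine[OF td]
              times_differentiable_mult[OF times_differentiable_const times_differentiable_affine[OF td]]])
      then show ?thesis by (simp add: \<theta>_def[abs_def] algebra_simps)
    qed
    have "inverse (real (Suc k)) \<le> inverse (real (Suc K))" using that by (intro le_imp_inverse_le) auto
    then have "b + inverse (real (Suc k)) < T" using K by linarith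
    then show "{a..b + inverse (real (Suc k))} \<subseteq> {0<..<T}" using ab by auto
    show "\<theta> k t = 0" if "t \<notin> {a..b + inverse (real (Suc k))}" for t
    proof (cases "t < a")
      case True
      then have "real (Suc k) * (t - a) \<le> 0" "real (Suc k) * (t - b) \<le> 0"
        using ab by (auto intro!: mult_nonneg_nonpos simp del: of_nat_Suc)
      then show ?thesis using \<sigma>(3) by (simp add: \<theta>_def del: of_nat_Suc)
    next
      case False
      then have "t - b > inverse (real (Suc k))" using that by auto
      then have "1 \<le> real (Suc k) * (t - b)" by (simp add: field_simps)
      moreover from this have "1 \<le> real (Suc k) * (t - a)"
        by (rule order_trans) (use ab in \<open>auto intro!: mult_left_mono simp del: of_nat_Suc\<close>)
      ultimately show ?thesis using \<sigma>(4) by (simp add: \<theta>_def del: of_nat_Suc)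
    qed
  qed
  have c\<eta>: "continuous_on A (\<eta> p k)" for A p k
    unfolding \<eta>_def[abs_def] by (intro continuous_intros continuous_on_compose2[OF \<sigma>(2)]) auto
  have ic: "(\<lambda>t. c t * \<eta> p k t) integrable_on {0..T}" for p k
    by (intro integrable_continuous_real continuous_on_mult c c\<eta>)
  have lhs: "(LINT t|?M. c t * deriv (\<theta> k) t)
      = integral {0..T} (\<lambda>t. c t * \<eta> a k t) - integral {0..T} (\<lambda>t. c t * \<eta> b k t)" for k
  proof -
    have "integrable (?M) (\<lambda>t. c t * deriv (\<theta> k) t)"
      unfolding d\<theta> by (intro integrable_continuous_time continuous_intros c c\<eta>)
    then have "(LINT t|?M. c t * deriv (\<theta> k) t) = integral {0..T} (\<lambda>t. c t * deriv (\<theta> k) t)"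
      by (rule LINT_eq_integral_Icc)
    also have "\<dots> = integral {0..T} (\<lambda>t. c t * \<eta> a k t - c t * \<eta> b k t)"
      by (simp add: d\<theta> right_diff_distrib)
    also have "\<dots> = integral {0..T} (\<lambda>t. c t * \<eta> a k t) - integral {0..T} (\<lambda>t. c t * \<eta> b k t)"
      by (rule integral_diff[OF ic ic])
    finally show ?thesis .
  qed
  have "(\<lambda>k. LINT t|?M. c t * deriv (\<theta> k) t) \<longlonglongrightarrow> c a - c b"
    unfolding lhs unfolding \<eta>_def using ab
    by (intro tendsto_diff approximate_identity[OF c _ _ \<sigma>]) auto
  then have l1: "(\<lambda>k. LINT t|?M. c t * deriv (\<theta> (k + K)) t) \<longlonglongrightarrow> c a - c b"
    by (rule LIMSEQ_ignore_initial_segment)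
  have \<theta>c: "continuous_on A (\<theta> k)" for A k
    unfolding \<theta>_def[abs_def] using D by (intro continuous_on_diff) (meson DERIV_isCont continuous_at_imp_continuous_on)+
  \<comment> \<open>The step vanishes at 0, so the pointwise limit is the indicator of the interval
    open at \<open>a\<close> and closed at \<open>b\<close>.\<close>
  have "(\<lambda>k. LINT t|?M. m t * \<theta> k t)
      \<longlonglongrightarrow> (LINT t|?M. m t * indicator {a<..b} t)"
  proof (rule integral_dominated_convergence[where w = "\<lambda>t. \<bar>m t\<bar>"])
    have mm[measurable]: "m \<in> borel_measurable (?M)" using m by auto
    have ind: "indicator {a<..b} \<in> borel_measurable (?M)"
      by (intro measurable_restrict_space1 measurable_completion) auto
    show "(\<lambda>t. m t * indicator {a<..b} t) \<in> borel_measurable (?M)"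
      using mm ind by (rule borel_measurable_times)
    show "(\<lambda>t. m t * \<theta> k t) \<in> borel_measurable (?M)" for k
      by (intro borel_measurable_times mm continuous_imp_measurable_on_sets_lebesgue \<theta>c) auto
    show "integrable (?M) (\<lambda>t. \<bar>m t\<bar>)" using m by auto
    show "AE t in ?M. (\<lambda>k. m t * \<theta> k t) \<longlonglongrightarrow> m t * indicator {a<..b} t"
    proof (intro AE_I2 tendsto_mult tendsto_const)
      fix t
      have one: "(\<lambda>k. \<sigma> (real (Suc k) * (t - p))) \<longlonglongrightarrow> (if t > p then 1 else 0)" for p
      proof (cases "t > p")
        case True
        then obtain k0 where k0: "inverse (real (Suc k0)) < t - p"
          using reals_Archimedean[of "t - p"] by auto
        have "\<sigma> (real (Suc k) * (t - p)) = 1" if "k \<ge> k0" for k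
        proof (rule \<sigma>(4))
          have "inverse (real (Suc k)) \<le> inverse (real (Suc k0))" using that by (intro le_imp_inverse_le) auto
          then have "inverse (real (Suc k)) < t - p" using k0 by linarith
          then show "1 \<le> real (Suc k) * (t - p)" by (simp add: field_simps)
        qed
        then have "\<forall>\<^sub>F k in sequentially. \<sigma> (real (Suc k) * (t - p)) = 1"
          unfolding eventually_sequentially by blast
        then show ?thesis using True by (simp add: tendsto_eventually)
      next
        case False
        then have "\<sigma> (real (Suc k) * (t - p)) = 0" for k
          by (intro \<sigma>(3) mult_nonneg_nonpos) auto
        then show ?thesis using False by simp
      qed
      have "(\<lambda>k. \<theta> k t) \<longlonglongrightarrow> (if t > a then 1 else 0) - (if t > b then 1 else 0)"
        unfolding \<theta>_def by (intro tendsto_diff one)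
      also have "(if t > a then 1 else 0) - (if t > b then 1 else 0) = (indicator {a<..b} t :: real)"
        using ab by (auto simp: indicator_def)
      finally show "(\<lambda>k. \<theta> k t) \<longlonglongrightarrow> indicator {a<..b} t" .
    qed
    show "AE t in ?M. norm (m t * \<theta> k t) \<le> \<bar>m t\<bar>" for k
    proof (rule AE_I2)
      fix t
      have "\<bar>\<theta> k t\<bar> \<le> 1"
        using \<sigma>01[of "real (Suc k) * (t - a)"] \<sigma>01[of "real (Suc k) * (t - b)"]
        unfolding \<theta>_def abs_le_iff by linarith
      then show "norm (m t * \<theta> k t) \<le> \<bar>m t\<bar>"
        unfolding real_norm_def abs_mult by (rule mult_left_le[OF _ abs_ge_zero])
    qed
  qed
  then have l2: "(\<lambda>k. LINT t|?M. m t * \<theta> (k + K) t)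
      \<longlonglongrightarrow> (LINT t|?M. m t * indicator {a<..b} t)"
    by (rule LIMSEQ_ignore_initial_segment)
  have "(LINT t|?M. c t * deriv (\<theta> (k + K)) t)
      = - (LINT t|?M. m t * \<theta> (k + K) t)" for k
    using wd test[of "k + K"] by (simp add: has_weak_derivative_on_def)
  then have "c a - c b = - (LINT t|?M. m t * indicator {a<..b} t)"
    using l1 tendsto_minus[OF l2] by (simp add: LIMSEQ_unique)
  also have "(LINT t|?M. m t * indicator {a<..b} t)
      = integral {0..T} (\<lambda>t. m t * indicator {a<..b} t)"
  proof (rule LINT_eq_integral_Icc)
    show "integrable (?M) (\<lambda>t. m t * indicator {a<..b} t)"
      using m ab by (intro integrable_real_mult_indicator) (auto simp: sets_restrict_space_iff)
  qed
  also have "\<dots> = integral {0..T} (\<lambda>t. if t \<in> {a<..b} then m t else 0)"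
    by (intro integral_cong) (auto simp: indicator_def)
  also have "\<dots> = integral {a<..b} m"
    using ab by (subst integral_restrict_Int) (auto intro!: arg_cong[where f = "\<lambda>S. integral S m"])
  also have "\<dots> = integral {a..b} m"
    by (rule integral_spike_set) (auto intro: negligible_subset[of "{a}"])
  finally show ?thesis by simp
qed

text \<open>The increment formula holds strictly inside (0, T). There \<open>c\<close> minus the
  primitive of \<open>m\<close> is constant, and continuity carries this to the endpoints, in
  particular to the initial time.\<close>

lemma weak_derivative_FTC:
  assumes c: "continuous_on {0..T} c" and m: "integrable (lebesgue_on {0<..<T}) m"
    and wd: "has_weak_derivative_on T c m" and t: "t \<in> {0..T}" and T: "T > 0"
  shows "c t - c 0 = integral {0..t} m"
proof -
  have mi: "m integrable_on {0..T}" by (rule LINT_eq_integral_Icc[OF m])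
  define G where "G t = c t - integral {0..t} m" for t
  have Gc: "continuous_on {0..T} G"
    unfolding G_def by (intro continuous_on_diff c indefinite_integral_continuous_1 mi)
  have cl: "closure {0<..<T} = {0..T}" using T by simp
  have inc: "G b = G a" if "0 < a" "a < b" "b < T" for a b
  proof -
    have "integral {0..a} m + integral {a..b} m = integral {0..b} m"
      using that mi by (intro Henstock_Kurzweil_Integration.integral_combine integrable_subinterval_real[OF mi]) auto
    then show ?thesis using weak_derivative_increment[OF c m wd that] by (simp add: G_def)
  qed
  have const: "G s = G (T / 2)" if "s \<in> {0<..<T}" for s
    using inc[of s "T / 2"] inc[of "T / 2" s] that T by (cases s "T / 2" rule: linorder_cases) auto
  have "G s = G (T / 2)" if "s \<in> {0..T}" for s
  proof (rule continuous_constant_on_closure[of "{0<..<T}" G])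
    show "continuous_on (closure {0<..<T}) G" unfolding cl by (rule Gc)
    show "s \<in> closure {0<..<T}" unfolding cl by (rule that)
  qed (rule const)
  from this[OF t] this[of 0] T show ?thesis by (simp add: G_def)
qed

text \<open>The smooth factor is moved onto the test function: the product of \<kappa> and \<theta>
  is again admissible. No approximation of \<open>c\<close> is involved.\<close>

lemma has_weak_derivative_on_mult:
  assumes c: "continuous_on {0..T} c" and m: "integrable (lebesgue_on {0<..<T}) m"
    and wd: "has_weak_derivative_on T c m"
    and k: "\<And>n. times_differentiable n \<kappa>" "\<And>t. (\<kappa> has_real_derivative \<kappa>' t) (at t)"
      "continuous_on UNIV \<kappa>'"
  shows "has_weak_derivative_on T (\<lambda>t. c t * \<kappa> t) (\<lambda>t. m t * \<kappa> t + c t * \<kappa>' t)"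
  unfolding has_weak_derivative_on_def
proof
  fix \<theta> assume th: "\<theta> \<in> test_functions_time T"
  note th' = test_functions_time_D[OF th]
  let ?M = "lebesgue_on {0<..<T}"
  have kc: "continuous_on A \<kappa>" for A
    using k(2) by (meson DERIV_isCont continuous_at_imp_continuous_on)
  have D: "deriv (\<lambda>t. \<kappa> t * \<theta> t) = (\<lambda>t. \<kappa>' t * \<theta> t + deriv \<theta> t * \<kappa> t)"
    by (intro ext DERIV_imp_deriv DERIV_mult k th')
  have "(\<lambda>t. \<kappa> t * \<theta> t) \<in> test_functions_time T"
  proof -
    have sub: "closure {t. \<kappa> t * \<theta> t \<noteq> 0} \<subseteq> closure {t. \<theta> t \<noteq> 0}" by (rule closure_mono) auto
    have K: "compact (closure {t. \<theta> t \<noteq> 0})" "closure {t. \<theta> t \<noteq> 0} \<subseteq> {0<..<T}"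
      using th by (auto simp: test_functions_time_def)
    have "compact (closure {t. \<kappa> t * \<theta> t \<noteq> 0})"
      using bounded_subset[OF compact_imp_bounded[OF K(1)] order_trans[OF closure_subset sub]] by simp
    moreover have "(deriv ^^ n) (\<lambda>t. \<kappa> t * \<theta> t) differentiable_on UNIV" for n
      using times_differentiable_mult[OF k(1) th'(1), of "Suc n"] unfolding times_differentiable_iff by blast
    ultimately show ?thesis using order_trans[OF sub K(2)] by (auto simp: test_functions_time_def)
  qed
  then have "(LINT t|?M. c t * deriv (\<lambda>t. \<kappa> t * \<theta> t) t) = - (LINT t|?M. m t * (\<kappa> t * \<theta> t))"
    using wd by (simp add: has_weak_derivative_on_def)
  moreover have "(LINT t|?M. c t * deriv (\<lambda>t. \<kappa> t * \<theta> t) t)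
      = (LINT t|?M. c t * \<kappa>' t * \<theta> t) + (LINT t|?M. c t * \<kappa> t * deriv \<theta> t)"
  proof -
    have "integrable ?M (\<lambda>t. c t * \<kappa>' t * \<theta> t)" "integrable ?M (\<lambda>t. c t * \<kappa> t * deriv \<theta> t)"
      by (intro integrable_continuous_time continuous_intros c kc th' continuous_on_subset[OF k(3)]; simp)+
    then show ?thesis unfolding D by (subst Bochner_Integration.integral_add[symmetric]) (auto simp: algebra_simps)
  qed
  moreover have "(LINT t|?M. (m t * \<kappa> t + c t * \<kappa>' t) * \<theta> t)
      = (LINT t|?M. m t * (\<kappa> t * \<theta> t)) + (LINT t|?M. c t * \<kappa>' t * \<theta> t)"
  proof -
    have "integrable ?M (\<lambda>t. m t * (\<kappa> t * \<theta> t))"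
      by (intro integrable_mult_continuous m continuous_intros kc th')
    moreover have "integrable ?M (\<lambda>t. c t * \<kappa>' t * \<theta> t)"
      by (intro integrable_continuous_time continuous_intros c th' continuous_on_subset[OF k(3)]; simp)
    ultimately show ?thesis by (subst Bochner_Integration.integral_add[symmetric]) (auto simp: algebra_simps)
  qed
  ultimately show "(LINT t|?M. c t * \<kappa> t * deriv \<theta> t) = - (LINT t|?M. (m t * \<kappa> t + c t * \<kappa>' t) * \<theta> t)"
    by simp
qed

lemma has_weak_derivative_onI:
  assumes "T > 0" "\<And>t. t \<in> {0..T} \<Longrightarrow> (c has_real_derivative d t) (at t within {0..T})"
    and d: "continuous_on {0..T} d"
  shows "has_weak_derivative_on T c d"
  unfolding has_weak_derivative_on_def
proof
  fix \<theta> assume th: "\<theta> \<in> test_functions_time T"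
  note th' = test_functions_time_D[OF th]
  let ?M = "lebesgue_on {0<..<T}"
  have cc: "continuous_on {0..T} c"
    using assms(2) by (meson DERIV_continuous continuous_on_eq_continuous_within)
  have "((\<lambda>t. d t * \<theta> t + deriv \<theta> t * c t) has_integral c T * \<theta> T - c 0 * \<theta> 0) {0..T}"
    using assms(1,2)
    by (intro fundamental_theorem_of_calculus)
      (auto simp: has_real_derivative_iff_has_vector_derivative[symmetric]
        intro!: DERIV_mult DERIV_subset[OF th'(2)])
  then have "integral {0..T} (\<lambda>t. d t * \<theta> t + deriv \<theta> t * c t) = 0"
    using th'(5)[of T] th'(5)[of 0] by (simp add: integral_unique)
  moreover have i: "integrable ?M (\<lambda>t. d t * \<theta> t)" "integrable ?M (\<lambda>t. c t * deriv \<theta> t)"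
    by (intro integrable_continuous_time continuous_intros cc d th')+
  moreover have "integral {0..T} (\<lambda>t. d t * \<theta> t + deriv \<theta> t * c t)
      = integral {0..T} (\<lambda>t. d t * \<theta> t) + integral {0..T} (\<lambda>t. c t * deriv \<theta> t)"
    using integral_add[OF i[THEN LINT_eq_integral_Icc(2)]] by (simp add: mult.commute)
  ultimately show "(LINT t|?M. c t * deriv \<theta> t) = - (LINT t|?M. d t * \<theta> t)"
    by (simp add: LINT_eq_integral_Icc(1))
qed

section \<open>The forced harmonic oscillator\<close>

text \<open>Cauchy-Schwarz against the constant 1 on an interval of length \<open>T\<close>,
  obtained from the nonnegativity of the variance of |m|; \<open>A\<close> is its mean
  value.\<close>

lemma LINT_abs_power2_le:
  fixes m :: "real \<Rightarrow> real"
  assumes T: "T > 0" and m: "integrable (lebesgue_on {0<..<T}) m"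
    and m2: "integrable (lebesgue_on {0<..<T}) (\<lambda>t. (m t)\<^sup>2)"
  shows "(LINT t|lebesgue_on {0<..<T}. \<bar>m t\<bar>)\<^sup>2 \<le> T * (LINT t|lebesgue_on {0<..<T}. (m t)\<^sup>2)"
proof -
  let ?M = "lebesgue_on {0<..<T}"
  interpret finite_measure ?M by (rule finite_measure_lebesgue_on) auto
  define A where "A = (LINT t|?M. \<bar>m t\<bar>) / T"
  have meas: "measure ?M (space ?M) = T"
    using T by (simp add: measure_restrict_space)
  have i: "integrable ?M (\<lambda>t. \<bar>m t\<bar>)" using m by simp
  have "0 \<le> (LINT t|?M. (\<bar>m t\<bar> - A)\<^sup>2)" by simp
  also have "\<dots> = (LINT t|?M. ((m t)\<^sup>2 - 2 * A * \<bar>m t\<bar>) + A\<^sup>2)"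
    by (intro Bochner_Integration.integral_cong) (auto simp: power2_diff)
  also have "\<dots> = (LINT t|?M. (m t)\<^sup>2) - 2 * A * (LINT t|?M. \<bar>m t\<bar>) + A\<^sup>2 * T"
    using m2 i meas by simp
  also have "(LINT t|?M. \<bar>m t\<bar>) = A * T" using T by (simp add: A_def)
  finally have "A\<^sup>2 * T \<le> (LINT t|?M. (m t)\<^sup>2)" by (simp add: power2_eq_square)
  then have "T * (A\<^sup>2 * T) \<le> T * (LINT t|?M. (m t)\<^sup>2)" using T by (intro mult_left_mono) auto
  then show ?thesis unfolding \<open>(LINT t|?M. \<bar>m t\<bar>) = A * T\<close> by (simp add: power2_eq_square algebra_simps)
qed

lemma integral_mult_power2_le:
  fixes m \<kappa> :: "real \<Rightarrow> real"
  assumes T: "T > 0" and m: "integrable (lebesgue_on {0<..<T}) m"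
    and m2: "integrable (lebesgue_on {0<..<T}) (\<lambda>t. (m t)\<^sup>2)"
    and \<kappa>: "continuous_on {0..T} \<kappa>" "\<And>s. \<bar>\<kappa> s\<bar> \<le> 1" and t: "t \<in> {0..T}"
  shows "(integral {0..t} (\<lambda>s. m s * \<kappa> s))\<^sup>2 \<le> T * (LINT t|lebesgue_on {0<..<T}. (m t)\<^sup>2)"
proof -
  have sub: "{0..t} \<subseteq> {0..T}" using t by auto
  have am: "(\<lambda>s. \<bar>m s\<bar>) integrable_on {0..T}"
    by (rule LINT_eq_integral_Icc(2)) (use m in simp)
  have i1: "(\<lambda>s. m s * \<kappa> s) integrable_on {0..T}"
    by (rule LINT_eq_integral_Icc(2)[OF integrable_mult_continuous[OF m \<kappa>(1)]])
  have "norm (integral {0..t} (\<lambda>s. m s * \<kappa> s)) \<le> integral {0..t} (\<lambda>s. \<bar>m s\<bar>)"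
  proof (rule integral_norm_bound_integral)
    show "(\<lambda>s. m s * \<kappa> s) integrable_on {0..t}" "(\<lambda>s. \<bar>m s\<bar>) integrable_on {0..t}"
      using integrable_on_subinterval[OF i1 sub] integrable_on_subinterval[OF am sub] by auto
    show "norm (m s * \<kappa> s) \<le> \<bar>m s\<bar>" for s
      unfolding real_norm_def abs_mult by (rule mult_left_le[OF \<kappa>(2) abs_ge_zero])
  qed
  also have "\<dots> \<le> integral {0..T} (\<lambda>s. \<bar>m s\<bar>)"
    using sub am integrable_on_subinterval[OF am sub] by (intro integral_subset_le) auto
  also have "\<dots> = (LINT t|lebesgue_on {0<..<T}. \<bar>m t\<bar>)"
    by (rule LINT_eq_integral_Icc(1)[symmetric]) (use m in simp)
  finally have "\<bar>integral {0..t} (\<lambda>s. m s * \<kappa> s)\<bar>\<^sup>2 \<le> (LINT t|lebesgue_on {0<..<T}. \<bar>m t\<bar>)\<^sup>2"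
    by (intro power_mono) auto
  then show ?thesis using LINT_abs_power2_le[OF T m m2] by simp
qed

text \<open>Pairing the weak derivative of the forcing with \<open>cos (\<omega> (t - s))\<close> (Duhamel's formula)
  avoids any chain rule for absolutely continuous functions.\<close>

lemma oscillator_fourth_derivative_bound:
  fixes F2 m y2 y3 :: "real \<Rightarrow> real"
  assumes T: "T > 0" and \<Lambda>: "\<Lambda> > 0"
    and y2: "\<And>t. t \<in> {0..T} \<Longrightarrow> (y2 has_real_derivative y3 t) (at t within {0..T})"
    and y3: "\<And>t. t \<in> {0..T} \<Longrightarrow> (y3 has_real_derivative F2 t - \<Lambda> * y2 t) (at t within {0..T})"
    and F2: "continuous_on {0..T} F2" and m: "integrable (lebesgue_on {0<..<T}) m"
    and m2: "integrable (lebesgue_on {0<..<T}) (\<lambda>t. (m t)\<^sup>2)"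
    and wd: "has_weak_derivative_on T F2 m" and t: "t \<in> {0..T}"
  shows "(F2 t - \<Lambda> * y2 t)\<^sup>2
    \<le> 3 * ((F2 0 - \<Lambda> * y2 0)\<^sup>2 + \<Lambda> * (y3 0)\<^sup>2 + T * (LINT t|lebesgue_on {0<..<T}. (m t)\<^sup>2))"
proof -
  define w where "w = sqrt \<Lambda>"
  have w2: "w * w = \<Lambda>" using \<Lambda> by (simp add: w_def)
  \<comment> \<open>A solution of the homogeneous oscillator equation in \<open>s\<close>, chosen
    with value 1 and slope 0 at the final time \<open>t\<close>.\<close>
  define \<kappa> where "\<kappa> s = cos (- w * s + w * t)" for s
  define \<kappa>' where "\<kappa>' s = w * sin (- w * s + w * t)" for s
  have \<kappa>: "(\<kappa> has_real_derivative \<kappa>' s) (at s)" for s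
    unfolding \<kappa>_def[abs_def] \<kappa>'_def by (auto intro!: derivative_eq_intros)
  have \<kappa>': "(\<kappa>' has_real_derivative - \<Lambda> * \<kappa> s) (at s)" for s
    unfolding \<kappa>_def \<kappa>'_def[abs_def] by (auto intro!: derivative_eq_intros simp: w2[symmetric])
  have \<kappa>c: "continuous_on A \<kappa>" "continuous_on A \<kappa>'" for A
    using \<kappa> \<kappa>' by (meson DERIV_isCont continuous_at_imp_continuous_on)+
  have \<kappa>td: "times_differentiable n \<kappa>" for n
    unfolding \<kappa>_def[abs_def]
    by (rule times_differentiable_affine) (use times_differentiable_sin_cos in blast)
  define X where "X = integral {0..t} (\<lambda>s. m s * \<kappa> s)"
  have t0: "0 \<le> t" and sub: "{0..t} \<subseteq> {0..T}" using t by auto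
  have i1: "(\<lambda>s. m s * \<kappa> s) integrable_on {0..t}"
    by (rule integrable_on_subinterval[OF LINT_eq_integral_Icc(2)[OF integrable_mult_continuous[OF m \<kappa>c(1)]] sub])
  have i2: "(\<lambda>s. F2 s * \<kappa>' s) integrable_on {0..t}"
    by (intro integrable_continuous_real continuous_intros \<kappa>c continuous_on_subset[OF F2 sub])
  have "F2 t * \<kappa> t - F2 0 * \<kappa> 0 = integral {0..t} (\<lambda>s. m s * \<kappa> s + F2 s * \<kappa>' s)"
  proof (rule weak_derivative_FTC[OF _ _ has_weak_derivative_on_mult[OF F2 m wd \<kappa>td \<kappa> \<kappa>c(2)] t T])
    show "continuous_on {0..T} (\<lambda>t. F2 t * \<kappa> t)" by (intro continuous_intros F2 \<kappa>c)
    show "integrable (lebesgue_on {0<..<T}) (\<lambda>t. m t * \<kappa> t + F2 t * \<kappa>' t)"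
      by (intro Bochner_Integration.integrable_add integrable_mult_continuous m \<kappa>c
          integrable_continuous_time continuous_intros F2)
  qed
  then have eq1: "F2 t * \<kappa> t - F2 0 * \<kappa> 0 = X + integral {0..t} (\<lambda>s. F2 s * \<kappa>' s)"
    unfolding X_def by (simp add: integral_add[OF i1 i2])
  \<comment> \<open>The oscillator equation gives an explicit primitive: in the derivative of
    \<Lambda> y2 \<kappa> + y3 \<kappa>' the terms with y2 and y3 cancel, as \<kappa>'' = -
    \<Lambda> \<kappa>.\<close>
  have "((\<lambda>s. F2 s * \<kappa>' s) has_integral
      (\<Lambda> * y2 t * \<kappa> t + y3 t * \<kappa>' t) - (\<Lambda> * y2 0 * \<kappa> 0 + y3 0 * \<kappa>' 0)) {0..t}"
  proof (rule fundamental_theorem_of_calculus[OF t0])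
    fix s assume s: "s \<in> {0..t}"
    then have sT: "s \<in> {0..T}" using sub by auto
    have "((\<lambda>s. \<Lambda> * y2 s * \<kappa> s + y3 s * \<kappa>' s) has_real_derivative F2 s * \<kappa>' s) (at s within {0..t})"
      by (rule DERIV_cong[OF DERIV_add[OF DERIV_mult[OF DERIV_cmult[OF DERIV_subset[OF y2[OF sT] sub]] DERIV_subset[OF \<kappa> subset_UNIV]]
          DERIV_mult[OF DERIV_subset[OF y3[OF sT] sub] DERIV_subset[OF \<kappa>' subset_UNIV]]]])
        (simp add: algebra_simps)
    then show "((\<lambda>s. \<Lambda> * y2 s * \<kappa> s + y3 s * \<kappa>' s) has_vector_derivative F2 s * \<kappa>' s) (at s within {0..t})"
      by (simp add: has_real_derivative_iff_has_vector_derivative)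
  qed
  then have eq2: "integral {0..t} (\<lambda>s. F2 s * \<kappa>' s)
      = (\<Lambda> * y2 t * \<kappa> t + y3 t * \<kappa>' t) - (\<Lambda> * y2 0 * \<kappa> 0 + y3 0 * \<kappa>' 0)"
    by (rule integral_unique)
  \<comment> \<open>Because \<kappa>' vanishes at \<open>t\<close>, the uncontrolled value
    \<open>y3 t\<close> drops out of the representation.\<close>
  have v: "\<kappa> t = 1" "\<kappa>' t = 0" "\<kappa> 0 = cos (w * t)" "\<kappa>' 0 = w * sin (w * t)"
    by (auto simp: \<kappa>_def \<kappa>'_def)
  define P Q where "P = (F2 0 - \<Lambda> * y2 0) * cos (w * t)" and "Q = w * y3 0 * sin (w * t)"
  have rep: "F2 t - \<Lambda> * y2 t = P + (- Q) + X"
    using eq1 unfolding eq2 v P_def Q_def by (simp add: algebra_simps)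
  have sq3: "(a + b + c)\<^sup>2 \<le> 3 * (a\<^sup>2 + b\<^sup>2 + c\<^sup>2)" for a b c :: real
  proof -
    have "3 * (a\<^sup>2 + b\<^sup>2 + c\<^sup>2) - (a + b + c)\<^sup>2 = (a - b)\<^sup>2 + (b - c)\<^sup>2 + (a - c)\<^sup>2"
      by (simp add: power2_eq_square algebra_simps)
    also have "\<dots> \<ge> 0" by simp
    finally show ?thesis by simp
  qed
  have trig: "(a * b)\<^sup>2 \<le> a\<^sup>2" if "\<bar>b\<bar> \<le> 1" for a b :: real
    using mult_left_le[of "b\<^sup>2" "a\<^sup>2"] that by (simp add: power_mult_distrib abs_square_le_1)
  have "P\<^sup>2 \<le> (F2 0 - \<Lambda> * y2 0)\<^sup>2" unfolding P_def by (rule trig) simp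
  moreover have "Q\<^sup>2 \<le> (w * y3 0)\<^sup>2" unfolding Q_def by (rule trig) simp
  moreover have "(w * y3 0)\<^sup>2 = \<Lambda> * (y3 0)\<^sup>2" using \<Lambda> by (simp add: power_mult_distrib w_def)
  moreover have "X\<^sup>2 \<le> T * (LINT t|lebesgue_on {0<..<T}. (m t)\<^sup>2)"
    unfolding X_def by (rule integral_mult_power2_le[OF T m m2 \<kappa>c(1) _ t]) (simp add: \<kappa>_def)
  ultimately show ?thesis using sq3[of P "- Q" X] unfolding rep by simp
qed

section \<open>Time-dependent square-summable sequences\<close>

text \<open>The dominating sequence is the same for all times, which is stronger than a uniform
  bound on the sums: tails are uniformly small, so termwise continuity becomes continuity in the
  square-sum norm, and integration in time preserves the property.\<close>

definition sq_dominated :: "real \<Rightarrow> (nat \<Rightarrow> real \<Rightarrow> real) \<Rightarrow> bool" where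
  "sq_dominated T c \<longleftrightarrow>
     (\<exists>M. summable M \<and> (\<forall>n. \<forall>t\<in>{0..T}. (c n t)\<^sup>2 \<le> M n))"

lemma sq_dominatedI:
  "summable M \<Longrightarrow> (\<And>n t. t \<in> {0..T} \<Longrightarrow> (c n t)\<^sup>2 \<le> M n) \<Longrightarrow> sq_dominated T c"
  by (auto simp: sq_dominated_def)

lemma power2_diff_le: "(a - b)\<^sup>2 \<le> 2 * a\<^sup>2 + 2 * (b::real)\<^sup>2"
proof -
  have "2 * a\<^sup>2 + 2 * b\<^sup>2 - (a - b)\<^sup>2 = (a + b)\<^sup>2" by (simp add: power2_eq_square algebra_simps)
  then show ?thesis using zero_le_power2[of "a + b"] by linarith
qed

lemma sq_dominated_diff:
  assumes "sq_dominated T c" "sq_dominated T d"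
  shows "sq_dominated T (\<lambda>n t. c n t - d n t)"
proof -
  obtain M K where M: "summable M" "\<And>n t. t \<in> {0..T} \<Longrightarrow> (c n t)\<^sup>2 \<le> M n"
    and K: "summable K" "\<And>n t. t \<in> {0..T} \<Longrightarrow> (d n t)\<^sup>2 \<le> K n"
    using assms unfolding sq_dominated_def by blast
  show ?thesis
  proof (rule sq_dominatedI)
    show "summable (\<lambda>n. 2 * M n + 2 * K n)" using M(1) K(1) by (intro summable_add summable_mult)
    show "(c n t - d n t)\<^sup>2 \<le> 2 * M n + 2 * K n" if "t \<in> {0..T}" for n t
      using power2_diff_le[of "c n t" "d n t"] M(2)[OF that, of n] K(2)[OF that, of n] by linarith
  qed
qed

text \<open>Mean value theorem for each coefficient separately; an increment over [0, T] costs the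
  factor \<open>T\<^sup>2\<close> in the dominating sequence.\<close>

lemma sq_dominated_primitive:
  assumes d: "sq_dominated T d" and c0: "summable (\<lambda>n. (c n 0)\<^sup>2)"
    and D: "\<And>n t. t \<in> {0..T} \<Longrightarrow> (c n has_real_derivative d n t) (at t within {0..T})"
  shows "sq_dominated T c"
proof -
  obtain M where M: "summable M" "\<And>n t. t \<in> {0..T} \<Longrightarrow> (d n t)\<^sup>2 \<le> M n"
    using d unfolding sq_dominated_def by blast
  show ?thesis
  proof (rule sq_dominatedI)
    show "summable (\<lambda>n. 2 * (T\<^sup>2 * M n) + 2 * (c n 0)\<^sup>2)" using M(1) c0 by (intro summable_add summable_mult)
    fix n t assume t: "t \<in> {0..T}"
    have "(c n t - c n 0)\<^sup>2 \<le> T\<^sup>2 * M n"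
    proof (cases "t = 0")
      case True
      have "0 \<le> M n" by (rule order_trans[OF zero_le_power2 M(2)[OF t]])
      then show ?thesis using True by simp
    next
      case False
      then have "0 < t" using t by simp
      have "\<exists>x\<in>{0<..<t}. c n t - c n 0 = (t - 0) * d n x"
        using t by (intro mvt_simple[OF \<open>0 < t\<close>, where f' = "\<lambda>x h. h * d n x"])
          (auto intro!: DERIV_subset[OF D, unfolded has_field_derivative_def] simp: mult.commute[of _ "d n _"])
      then obtain x where x: "x \<in> {0<..<t}" "c n t - c n 0 = t * d n x" by auto
      then have "(c n t - c n 0)\<^sup>2 = t\<^sup>2 * (d n x)\<^sup>2" by (simp add: power_mult_distrib)
      also have "\<dots> \<le> T\<^sup>2 * M n"
        using x t M(2)[of x n] by (intro mult_mono power_mono) auto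
      finally show ?thesis .
    qed
    then show "(c n t)\<^sup>2 \<le> 2 * (T\<^sup>2 * M n) + 2 * (c n 0)\<^sup>2"
      using power2_diff_le[of "c n t - c n 0" "- c n 0"] by simp
  qed
qed

lemma sq_dominated_bound:
  assumes "sq_dominated T c" "\<And>n t. t \<in> {0..T} \<Longrightarrow> \<bar>d n t\<bar> \<le> K * \<bar>c n t\<bar>"
  shows "sq_dominated T d"
proof -
  obtain M where M: "summable M" "\<And>n t. t \<in> {0..T} \<Longrightarrow> (c n t)\<^sup>2 \<le> M n"
    using assms unfolding sq_dominated_def by blast
  show ?thesis
  proof (rule sq_dominatedI)
    show "summable (\<lambda>n. K\<^sup>2 * M n)" using M(1) by (rule summable_mult)
    fix n t assume t: "t \<in> {0..T}"
    have "\<bar>d n t\<bar>\<^sup>2 \<le> (K * \<bar>c n t\<bar>)\<^sup>2" using assms(2)[OF t] by (intro power_mono) auto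
    also have "\<dots> \<le> K\<^sup>2 * M n" using M(2)[OF t] by (auto simp: power_mult_distrib intro: mult_left_mono)
    finally show "(d n t)\<^sup>2 \<le> K\<^sup>2 * M n" by simp
  qed
qed

lemma sq_dominated_sum:
  assumes "sq_dominated T c" "t \<in> {0..T}" shows "summable (\<lambda>n. (c n t)\<^sup>2)"
proof -
  obtain M where M: "summable M" "\<And>n t. t \<in> {0..T} \<Longrightarrow> (c n t)\<^sup>2 \<le> M n"
    using assms unfolding sq_dominated_def by blast
  show ?thesis by (rule summable_comparison_test'[OF M(1)]) (use M(2)[OF assms(2)] in simp)
qed

lemma sq_dominated_sum_bounded:
  assumes "sq_dominated T c"
  obtains B where "\<And>t. t \<in> {0..T} \<Longrightarrow> (\<Sum>n. (c n t)\<^sup>2) \<le> B"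
proof -
  obtain M where M: "summable M" "\<And>n t. t \<in> {0..T} \<Longrightarrow> (c n t)\<^sup>2 \<le> M n"
    using assms unfolding sq_dominated_def by blast
  show ?thesis
    by (rule that, rule suminf_le[OF M(2) sq_dominated_sum[OF assms] M(1)])
qed

text \<open>Tannery's theorem: each term tends to zero by continuity, and all are dominated by four
  times the common sequence.\<close>

lemma sq_dominated_tendsto_0:
  assumes c: "sq_dominated T c" "\<And>n. continuous_on {0..T} (c n)"
    and t: "t \<in> {0..T}" and s: "\<And>k. s k \<in> {0..T}" "s \<longlonglongrightarrow> t"
  shows "(\<lambda>k. \<Sum>n. (c n t - c n (s k))\<^sup>2) \<longlonglongrightarrow> 0"
proof -
  obtain M where M: "summable M" "\<And>n t. t \<in> {0..T} \<Longrightarrow> (c n t)\<^sup>2 \<le> M n"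
    using c(1) unfolding sq_dominated_def by blast
  have "(\<lambda>k. \<Sum>n. (c n t - c n (s k))\<^sup>2) \<longlonglongrightarrow> (\<Sum>n. 0)"
  proof (rule tannerys_theorem[where M = "\<lambda>n. 4 * M n" and a = "\<lambda>n k. (c n t - c n (s k))\<^sup>2",
        THEN conjunct2, THEN conjunct2])
    fix n
    have "(\<lambda>k. c n (s k)) \<longlonglongrightarrow> c n t"
      using c(2)[of n] t s unfolding continuous_on_sequentially comp_def by blast
    then have "(\<lambda>k. (c n t - c n (s k))\<^sup>2) \<longlonglongrightarrow> (c n t - c n t)\<^sup>2" by (intro tendsto_intros)
    then show "(\<lambda>k. (c n t - c n (s k))\<^sup>2) \<longlonglongrightarrow> 0" by simp
  next
    have "norm ((c n t - c n (s k))\<^sup>2) \<le> 4 * M n" for n k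
      using power2_diff_le[of "c n t" "c n (s k)"] M(2)[OF t, of n] M(2)[OF s(1)[of k], of n] by simp
    then show "\<forall>\<^sub>F (n, k) in at_top \<times>\<^sub>F sequentially. norm ((c n t - c n (s k))\<^sup>2) \<le> 4 * M n"
      by (intro always_eventually) auto
  qed (use M(1) in \<open>auto intro: summable_mult\<close>)
  then show ?thesis by simp
qed

section \<open>Functions of time given by their coefficients\<close>

text \<open>Continuity along sequences makes samples on ever finer uniform grids converge, and a
  sampled function takes finitely many values. Sampling at midpoints keeps all sample times in the
  open interval, whereas left endpoints would include 0.\<close>

lemma bochner_measurableI:
  assumes T: "T > 0" and X: "\<And>t. t \<in> {0<..<T} \<Longrightarrow> U t \<in> X"
    and lim: "\<And>t s. t \<in> {0<..<T} \<Longrightarrow> (\<And>k. s k \<in> {0<..<T}) \<Longrightarrow> s \<longlonglongrightarrow> t \<Longrightarrow>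
      (\<lambda>k::nat. N (\<lambda>x. U t x - U (s k) x)) \<longlonglongrightarrow> 0"
  shows "bochner_measurable T X N U"
proof -
  let ?M = "lebesgue_on {0<..<T}"
  \<comment> \<open>The midpoint of the cell of the uniform grid with \<open>k + 1\<close> cells that contains \<open>t\<close>.\<close>
  define g where "g k t = T * ((real_of_int \<lfloor>real (Suc k) * t / T\<rfloor> + 1 / 2) / real (Suc k))" for k t
  have gd: "\<bar>g k t - t\<bar> \<le> T / real (Suc k)" for k t
  proof -
    define a where "a = real (Suc k) * t / T"
    have "T * (a / real (Suc k)) = t" using T by (simp add: a_def)
    then have "g k t - t = T * ((real_of_int \<lfloor>a\<rfloor> + 1 / 2) / real (Suc k)) - T * (a / real (Suc k))"
      unfolding g_def a_def[symmetric] by linarith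
    then have "g k t - t = T * ((real_of_int \<lfloor>a\<rfloor> + 1 / 2 - a) / real (Suc k))"
      by (simp only: diff_divide_distrib right_diff_distrib)
    moreover have "\<bar>real_of_int \<lfloor>a\<rfloor> + 1 / 2 - a\<bar> \<le> 1" by linarith
    ultimately have "\<bar>g k t - t\<bar> = T * (\<bar>real_of_int \<lfloor>a\<rfloor> + 1 / 2 - a\<bar> / real (Suc k))"
      using T by (simp add: abs_mult)
    also have "\<dots> \<le> T * (1 / real (Suc k))"
      using T \<open>\<bar>real_of_int \<lfloor>a\<rfloor> + 1 / 2 - a\<bar> \<le> 1\<close> by (intro mult_left_mono divide_right_mono) auto
    finally show ?thesis by simp
  qed
  have fl: "0 \<le> \<lfloor>real (Suc k) * t / T\<rfloor>" "\<lfloor>real (Suc k) * t / T\<rfloor> < int (Suc k)" if "t \<in> {0<..<T}" for k t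
  proof -
    show "0 \<le> \<lfloor>real (Suc k) * t / T\<rfloor>" using that by simp
    have "real (Suc k) * t / T < real (Suc k)" using that by (simp add: field_simps del: of_nat_Suc)
    then show "\<lfloor>real (Suc k) * t / T\<rfloor> < int (Suc k)" by (simp add: floor_less_iff)
  qed
  have gin: "g k t \<in> {0<..<T}" if "t \<in> {0<..<T}" for k t
  proof -
    define j K where "j = real_of_int \<lfloor>real (Suc k) * t / T\<rfloor>" and "K = real (Suc k)"
    have "j + 1 \<le> K" "0 \<le> j" "0 < K" using fl[OF that, of k] unfolding j_def K_def by linarith+
    then have "0 < (j + 1 / 2) / K" "(j + 1 / 2) / K < 1" by auto
    then have "0 < T * ((j + 1 / 2) / K)" "T * ((j + 1 / 2) / K) < T * 1"
      using T by (intro mult_pos_pos mult_strict_left_mono; simp)+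
    then show ?thesis unfolding g_def j_def K_def by simp
  qed
  have glim: "(\<lambda>k. g k t) \<longlonglongrightarrow> t" for t
  proof -
    have "(\<lambda>k. T * (1 / real (Suc k))) \<longlonglongrightarrow> 0"
      by (rule tendsto_mult_right_zero[OF LIMSEQ_Suc[OF lim_1_over_n]])
    then have "(\<lambda>k. g k t - t) \<longlonglongrightarrow> 0"
      by (rule Lim_null_comparison[OF always_eventually, rotated]) (use gd in simp)
    then show ?thesis by (simp add: LIM_zero_iff)
  qed
  have "simple_function ?M (\<lambda>t. U (g k t))" for k
  proof -
    have "simple_function ?M (\<lambda>t. \<lfloor>real (Suc k) * t / T\<rfloor>)"
      unfolding simple_function_def
    proof (intro conjI ballI)
      have "(\<lambda>t. \<lfloor>real (Suc k) * t / T\<rfloor>) ` space ?M \<subseteq> {0..<int (Suc k)}"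
        using fl[of _ k] by auto
      then show "finite ((\<lambda>t. \<lfloor>real (Suc k) * t / T\<rfloor>) ` space ?M)"
        by (rule finite_subset) simp
      have "(\<lambda>t. \<lfloor>real (Suc k) * t / T\<rfloor>) \<in> measurable borel (count_space UNIV)"
        by measurable
      then have "(\<lambda>t. \<lfloor>real (Suc k) * t / T\<rfloor>) \<in> measurable ?M (count_space UNIV)"
        by (intro measurable_restrict_space1 measurable_completion) simp
      then show "(\<lambda>t. \<lfloor>real (Suc k) * t / T\<rfloor>) -` {j} \<inter> space ?M \<in> sets ?M" for j
        by (rule measurable_sets) simp
    qed
    then show ?thesis
      unfolding g_def by (rule simple_function_compose1)
  qed
  then show ?thesis
    unfolding bochner_measurable_def
    using X gin lim[OF _ gin glim]
    by (intro conjI exI[of _ "\<lambda>k t. U (g k t)"] allI AE_I2) auto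
qed

text \<open>Completeness of Lebesgue measure, reached by extending both functions by zero to the
  whole line.\<close>

lemma lebesgue_on_measurable_AE:
  fixes f g :: "real \<Rightarrow> real"
  assumes "f \<in> borel_measurable (lebesgue_on {a<..<b})" "AE t in lebesgue_on {a<..<b}. f t = g t"
  shows "g \<in> borel_measurable (lebesgue_on {a<..<b})"
proof -
  have S: "{a<..<b} \<in> sets lebesgue" by simp
  have "(\<lambda>t. if t \<in> {a<..<b} then f t else 0) \<in> borel_measurable lebesgue"
    using assms(1) by (simp only: borel_measurable_if[OF S])
  moreover have "AE t in lebesgue. (if t \<in> {a<..<b} then f t else 0) = (if t \<in> {a<..<b} then g t else 0)"
    using assms(2) by (subst (asm) AE_restrict_space_iff) auto
  ultimately have "(\<lambda>t. if t \<in> {a<..<b} then g t else 0) \<in> borel_measurable lebesgue"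
    by (rule borel_measurable_AE)
  then show ?thesis by (simp only: borel_measurable_if[OF S])
qed

lemma Linf_time_norm_finite:
  assumes "bochner_measurable T X N U" "\<And>t. t \<in> {0<..<T} \<Longrightarrow> N (U t) \<le> B"
  shows "Linf_time_norm T X N U < \<infinity>"
proof -
  \<comment> \<open>The infimum ranges over nonnegative bounds, hence the absolute value of
    \<open>B\<close>.\<close>
  have "Inf {C. 0 \<le> C \<and> (AE t in lebesgue_on {0<..<T}. ereal (N (U t)) \<le> C)} \<le> ereal \<bar>B\<bar>"
  proof (rule Inf_lower, intro CollectI conjI)
    show "AE t in lebesgue_on {0<..<T}. ereal (N (U t)) \<le> ereal \<bar>B\<bar>"
      using assms(2) by (intro AE_I2) fastforce
  qed simp
  then show ?thesis using assms(1) by (auto simp: Linf_time_norm_def)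
qed

lemma sobolev_norm_nonneg: "0 \<le> sobolev_norm \<Omega> s w"
  unfolding sobolev_norm_def by (auto intro!: add_nonneg_nonneg sum_nonneg)

context clamped_plate
begin

definition has_coeffs :: "real \<Rightarrow> (real \<Rightarrow> real^2 \<Rightarrow> real) \<Rightarrow> (nat \<Rightarrow> real \<Rightarrow> real) \<Rightarrow> bool" where
  "has_coeffs T U c \<longleftrightarrow> (\<forall>t\<in>{0..T}. U t \<in> L2 \<Omega> \<and> (\<forall>n. coeff (U t) n = c n t))"

lemma has_coeffs_exists:
  assumes "sq_dominated T c" shows "\<exists>U. has_coeffs T U c"
proof -
  have "\<exists>w. t \<in> {0..T} \<longrightarrow> w \<in> L2 \<Omega> \<and> (\<forall>n. coeff w n = c n t)" for t
    using Riesz_Fischer[OF sq_dominated_sum[OF assms]] by blast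
  then have "\<exists>U. \<forall>t. t \<in> {0..T} \<longrightarrow> U t \<in> L2 \<Omega> \<and> (\<forall>n. coeff (U t) n = c n t)"
    by (intro choice) blast
  then show ?thesis unfolding has_coeffs_def by blast
qed

lemma l2_norm_coeffs: "w \<in> L2 \<Omega> \<Longrightarrow> l2_norm \<Omega> w = sqrt (\<Sum>n. (coeff w n)\<^sup>2)"
  using Parseval_norm[of w] by (simp add: sums_iff l2_norm_nonneg)

lemma has_coeffs_tendsto:
  assumes U: "has_coeffs T U c" "sq_dominated T c" "\<And>n. continuous_on {0..T} (c n)"
    and t: "t \<in> {0..T}" and s: "\<And>k. s k \<in> {0..T}" "s \<longlonglongrightarrow> t"
  shows "(\<lambda>k. l2_dist \<Omega> (U t) (U (s k))) \<longlonglongrightarrow> 0"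
proof -
  have L: "U t \<in> L2 \<Omega>" "coeff (U t) n = c n t" if "t \<in> {0..T}" for t n
    using U(1) that unfolding has_coeffs_def by blast+
  have "l2_dist \<Omega> (U t) (U (s k)) = sqrt (\<Sum>n. (c n t - c n (s k))\<^sup>2)" for k
    using L t s(1)[of k] by (simp add: l2_norm_coeffs L2_diff l2_inner_diff_left psi_L2)
  moreover have "(\<lambda>k. sqrt (\<Sum>n. (c n t - c n (s k))\<^sup>2)) \<longlonglongrightarrow> sqrt 0"
    by (intro tendsto_real_sqrt sq_dominated_tendsto_0[OF U(2,3) t s])
  ultimately show ?thesis by simp
qed

lemma has_coeffs_inner_continuous:
  assumes U: "has_coeffs T U c" "sq_dominated T c" "\<And>n. continuous_on {0..T} (c n)"
    and v: "v \<in> L2 \<Omega>"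
  shows "continuous_on {0..T} (\<lambda>t. l2_inner \<Omega> (U t) v)"
  unfolding continuous_on_sequentially comp_def
proof (intro allI ballI impI)
  fix s t assume t: "t \<in> {0..T}" and "(\<forall>k. s k \<in> {0..T}) \<and> s \<longlonglongrightarrow> t"
  then have s: "\<And>k. s k \<in> {0..T}" "s \<longlonglongrightarrow> t" by auto
  have L: "U t \<in> L2 \<Omega>" if "t \<in> {0..T}" for t using U(1) that unfolding has_coeffs_def by blast
  show "(\<lambda>k. l2_inner \<Omega> (U (s k)) v) \<longlonglongrightarrow> l2_inner \<Omega> (U t) v"
    using has_coeffs_tendsto[OF U t s] L t s(1) v
    by (intro l2_inner_tendsto) (auto simp: l2_dist_commute[of \<Omega> "U t"])
qed

lemma has_coeffs_bochner_measurable: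
  assumes T: "T > 0"
    and U: "has_coeffs T U c" "sq_dominated T c" "\<And>n. continuous_on {0..T} (c n)"
  shows "bochner_measurable T (L2 \<Omega>) (l2_norm \<Omega>) U"
proof (rule bochner_measurableI[OF T])
  show "U t \<in> L2 \<Omega>" if "t \<in> {0<..<T}" for t using U(1) that unfolding has_coeffs_def by auto
  fix t and s :: "nat \<Rightarrow> real" assume t: "t \<in> {0<..<T}" and s: "\<And>k. s k \<in> {0<..<T}" "s \<longlonglongrightarrow> t"
  have "t \<in> {0..T}" "s k \<in> {0..T}" for k using t s(1)[of k] by auto
  then show "(\<lambda>k. l2_dist \<Omega> (U t) (U (s k))) \<longlonglongrightarrow> 0"
    using s(2) by (intro has_coeffs_tendsto[OF U])
qed

lemma has_coeffs_norm_bounded: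
  assumes "has_coeffs T U c" "sq_dominated T c"
  obtains B where "\<And>t. t \<in> {0..T} \<Longrightarrow> l2_norm \<Omega> (U t) \<le> B"
proof -
  obtain B where "\<And>t. t \<in> {0..T} \<Longrightarrow> (\<Sum>n. (c n t)\<^sup>2) \<le> B"
    using sq_dominated_sum_bounded[OF assms(2)] by blast
  then have "l2_norm \<Omega> (U t) \<le> sqrt B" if "t \<in> {0..T}" for t
    using that assms(1) by (simp add: has_coeffs_def l2_norm_coeffs)
  then show ?thesis by (rule that)
qed

lemma has_coeffs_Linf_L2:
  assumes T: "T > 0"
    and U: "has_coeffs T U c" "sq_dominated T c" "\<And>n. continuous_on {0..T} (c n)"
  shows "Linf_time_norm T (L2 \<Omega>) (l2_norm \<Omega>) U < \<infinity>"
proof -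
  obtain B where "\<And>t. t \<in> {0..T} \<Longrightarrow> l2_norm \<Omega> (U t) \<le> B" using has_coeffs_norm_bounded[OF U(1,2)] by blast
  then show ?thesis
    by (intro Linf_time_norm_finite[OF has_coeffs_bochner_measurable[OF T U], of B]) auto
qed

lemma has_coeffs_L1_time:
  assumes T: "T > 0"
    and U: "has_coeffs T U c" "sq_dominated T c" "\<And>n. continuous_on {0..T} (c n)"
  shows "U \<in> L1_time T (L2 \<Omega>) (l2_norm \<Omega>)"
proof -
  have L: "U t \<in> L2 \<Omega>" if "t \<in> {0..T}" for t using U(1) that unfolding has_coeffs_def by blast
  have "continuous_on {0..T} (\<lambda>t. l2_norm \<Omega> (U t))"
    unfolding continuous_on_sequentially comp_def
  proof (intro allI ballI impI)
    fix s t assume t: "t \<in> {0..T}" and "(\<forall>k. s k \<in> {0..T}) \<and> s \<longlonglongrightarrow> t"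
    then have s: "\<And>k. s k \<in> {0..T}" "s \<longlonglongrightarrow> t" by auto
    have "(\<lambda>k. l2_norm \<Omega> (U (s k)) - l2_norm \<Omega> (U t)) \<longlonglongrightarrow> 0"
    proof (rule Lim_null_comparison[OF always_eventually has_coeffs_tendsto[OF U t s]], rule allI)
      fix k
      have "l2_norm \<Omega> (U t) \<le> l2_dist \<Omega> (U t) (U (s k)) + l2_norm \<Omega> (U (s k))"
        using l2_norm_triangle[OF L2_diff[OF L[OF t] L[OF s(1)]] L[OF s(1)], of k k] by simp
      moreover have "l2_norm \<Omega> (U (s k)) \<le> l2_dist \<Omega> (U (s k)) (U t) + l2_norm \<Omega> (U t)"
        using l2_norm_triangle[OF L2_diff[OF L[OF s(1)] L[OF t]] L[OF t], of k] by simp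
      ultimately show "norm (l2_norm \<Omega> (U (s k)) - l2_norm \<Omega> (U t)) \<le> l2_dist \<Omega> (U t) (U (s k))"
        using l2_dist_commute[of \<Omega> "U t" "U (s k)"] by (simp add: abs_le_iff)
    qed
    then show "(\<lambda>k. l2_norm \<Omega> (U (s k))) \<longlonglongrightarrow> l2_norm \<Omega> (U t)" by (simp add: LIM_zero_iff)
  qed
  then show ?thesis
    using has_coeffs_bochner_measurable[OF T U] by (simp add: L1_time_def integrable_continuous_time)
qed

text \<open>By Parseval the pairing with \<open>v\<close> is a series in the coefficients. The
  differentiated series passes the Weierstrass test, because each product is at most the sum of the
  two squares and the coefficients of \<open>v\<close> are square-summable; so it may be
  differentiated termwise.\<close>

lemma has_coeffs_inner_derivative:
  assumes T: "T > 0" and U: "has_coeffs T U c" "sq_dominated T c"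
    and V: "has_coeffs T V d" "sq_dominated T d"
    and D: "\<And>n t. t \<in> {0..T} \<Longrightarrow> (c n has_real_derivative d n t) (at t within {0..T})"
    and v: "v \<in> L2 \<Omega>" and t: "t \<in> {0..T}"
  shows "((\<lambda>t. l2_inner \<Omega> (U t) v) has_real_derivative l2_inner \<Omega> (V t) v) (at t within {0..T})"
proof -
  obtain M where M: "summable M" "\<And>n t. t \<in> {0..T} \<Longrightarrow> (d n t)\<^sup>2 \<le> M n"
    using V(2) unfolding sq_dominated_def by blast
  have LU: "(\<lambda>n. c n t * coeff v n) sums l2_inner \<Omega> (U t) v" if "t \<in> {0..T}" for t
    using Parseval[OF _ v, of "U t"] U(1) that by (simp add: has_coeffs_def)
  have LV: "(\<lambda>n. d n t * coeff v n) sums l2_inner \<Omega> (V t) v" if "t \<in> {0..T}" for t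
    using Parseval[OF _ v, of "V t"] V(1) that by (simp add: has_coeffs_def)
  have sm: "summable (\<lambda>n. M n + (coeff v n)\<^sup>2)"
    using M(1) Parseval_norm[OF v] by (intro summable_add) (auto simp: sums_iff)
  have "uniform_limit {0..T} (\<lambda>n t. \<Sum>i<n. d i t * coeff v i) (\<lambda>t. \<Sum>i. d i t * coeff v i) sequentially"
  proof (rule Weierstrass_m_test[OF _ sm])
    fix n t assume t: "t \<in> {0..T}"
    have "2 * \<bar>d n t * coeff v n\<bar> \<le> (d n t)\<^sup>2 + (coeff v n)\<^sup>2"
      using sum_squares_bound[of "\<bar>d n t\<bar>" "\<bar>coeff v n\<bar>"] by (simp add: abs_mult)
    then show "norm (d n t * coeff v n) \<le> M n + (coeff v n)\<^sup>2"
      using M(2)[OF t, of n] by simp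
  qed
  moreover have "((\<lambda>t. c n t * coeff v n) has_real_derivative d n t * coeff v n) (at t within {0..T})"
    if "t \<in> {0..T}" for n t
    using D[OF that] by (rule DERIV_cmult_right)
  ultimately obtain g where g: "\<And>t. t \<in> {0..T} \<Longrightarrow> (\<lambda>n. c n t * coeff v n) sums g t"
    "\<And>t. t \<in> {0..T} \<Longrightarrow> (g has_real_derivative (\<Sum>i. d i t * coeff v i)) (at t within {0..T})"
    using has_field_derivative_series[of "{0..T}" "\<lambda>n t. c n t * coeff v n" "\<lambda>n t. d n t * coeff v n"
        "\<lambda>t. \<Sum>i. d i t * coeff v i" t] LU[OF t] t by (auto simp: sums_iff)
  have "(g has_real_derivative l2_inner \<Omega> (V t) v) (at t within {0..T})"
    using g(2)[OF t] LV[OF t] by (simp add: sums_iff)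
  moreover have "g s = l2_inner \<Omega> (U s) v" if "s \<in> {0..T}" for s
    using g(1)[OF that] LU[OF that] by (rule sums_unique2)
  ultimately show ?thesis
    by (rule has_field_derivative_transform_within[OF _ zero_less_one t])
qed

lemma has_coeffs_weak_time_deriv:
  assumes T: "T > 0" and U: "has_coeffs T U c" "sq_dominated T c"
    and V: "has_coeffs T V d" "sq_dominated T d" "\<And>n. continuous_on {0..T} (d n)"
    and D: "\<And>n t. t \<in> {0..T} \<Longrightarrow> (c n has_real_derivative d n t) (at t within {0..T})"
  shows "has_weak_time_deriv \<Omega> T U V"
proof -
  have c: "continuous_on {0..T} (c n)" for n
    using D by (meson DERIV_continuous continuous_on_eq_continuous_within)
  have "has_weak_derivative_on T (\<lambda>t. l2_inner \<Omega> (U t) v) (\<lambda>t. l2_inner \<Omega> (V t) v)" if "v \<in> L2 \<Omega>" for v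
    using has_coeffs_inner_derivative[OF T U V(1,2) D that] has_coeffs_inner_continuous[OF V that]
    by (intro has_weak_derivative_onI[OF T]) auto
  then show ?thesis
    using has_coeffs_L1_time[OF T U c] has_coeffs_L1_time[OF T V]
    unfolding has_weak_time_deriv_def has_weak_derivative_on_def by blast
qed

text \<open>Elliptic regularity is used twice: on U(t) for the bound, and on differences U(t) - U(s)
  to get continuity into the Sobolev space, from which Bochner measurability with respect to the
  Sobolev norm follows.\<close>

lemma has_coeffs_Linf_sobolev:
  assumes T: "T > 0" and reg: "elliptic_regularity_index \<Omega> lam \<psi> \<gamma>"
    and U: "has_coeffs T U c" "sq_dominated T (\<lambda>n t. lam n * c n t)"
      "\<And>n. continuous_on {0..T} (c n)"
  shows "Linf_time_norm T (sobolev \<Omega> (2 + \<gamma>)) (sobolev_norm \<Omega> (2 + \<gamma>)) U < \<infinity>"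
proof -
  obtain C where C: "\<And>w. w \<in> dom_A \<Omega> \<Longrightarrow> sobolev_norm \<Omega> (2 + \<gamma>) w \<le> C * norm_A_pow \<Omega> lam \<psi> 1 w"
    and sub: "dom_A \<Omega> \<subseteq> sobolev \<Omega> (2 + \<gamma>)"
    using reg unfolding elliptic_regularity_index_def by blast
  have L: "U t \<in> L2 \<Omega>" "coeff (U t) n = c n t" if "t \<in> {0..T}" for t n
    using U(1) that unfolding has_coeffs_def by blast+
  have nA: "norm_A_pow \<Omega> lam \<psi> 1 w = sqrt (\<Sum>n. (lam n * coeff w n)\<^sup>2)" for w
    using lam_pos[THEN less_imp_le] by (simp add: norm_A_pow_def power_mult_distrib)
  have bd: "sobolev_norm \<Omega> (2 + \<gamma>) w \<le> \<bar>C\<bar> * sqrt (\<Sum>n. (lam n * coeff w n)\<^sup>2)"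
    if "w \<in> L2 \<Omega>" "summable (\<lambda>n. (lam n * coeff w n)\<^sup>2)" for w
  proof -
    have "sobolev_norm \<Omega> (2 + \<gamma>) w \<le> C * sqrt (\<Sum>n. (lam n * coeff w n)\<^sup>2)"
      using C[OF dom_A_I[OF that]] by (simp add: nA)
    \<comment> \<open>The regularity constant carries no sign assumption; its absolute value is safe
      in the monotonicity arguments below.\<close>
    also have "\<dots> \<le> \<bar>C\<bar> * sqrt (\<Sum>n. (lam n * coeff w n)\<^sup>2)"
      using that(2) by (intro mult_right_mono real_sqrt_ge_zero suminf_nonneg) auto
    finally show ?thesis .
  qed
  have sm: "summable (\<lambda>n. (lam n * coeff (U t) n)\<^sup>2)" if "t \<in> {0..T}" for t
    using sq_dominated_sum[OF U(2) that] L(2)[OF that] by simp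
  have lc: "continuous_on {0..T} (\<lambda>t. lam n * c n t)" for n by (intro continuous_intros U)
  have bm: "bochner_measurable T (sobolev \<Omega> (2 + \<gamma>)) (sobolev_norm \<Omega> (2 + \<gamma>)) U"
  proof (rule bochner_measurableI[OF T])
    show "U t \<in> sobolev \<Omega> (2 + \<gamma>)" if "t \<in> {0<..<T}" for t
    proof -
      have t: "t \<in> {0..T}" using that by auto
      show ?thesis using dom_A_I[OF L(1)[OF t] sm[OF t]] sub by blast
    qed
    fix t and s :: "nat \<Rightarrow> real" assume "t \<in> {0<..<T}" and s0: "\<And>k. s k \<in> {0<..<T}" "s \<longlonglongrightarrow> t"
    then have t: "t \<in> {0..T}" and s: "\<And>k. s k \<in> {0..T}" by (auto simp: less_imp_le)
    have "(\<lambda>k. \<bar>C\<bar> * sqrt (\<Sum>n. (lam n * c n t - lam n * c n (s k))\<^sup>2)) \<longlonglongrightarrow> \<bar>C\<bar> * sqrt 0"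
      by (intro tendsto_mult tendsto_const tendsto_real_sqrt
          sq_dominated_tendsto_0[OF U(2) lc t s s0(2)])
    then have "(\<lambda>k. \<bar>C\<bar> * sqrt (\<Sum>n. (lam n * c n t - lam n * c n (s k))\<^sup>2)) \<longlonglongrightarrow> 0" by simp
    then show "(\<lambda>k. sobolev_norm \<Omega> (2 + \<gamma>) (\<lambda>x. U t x - U (s k) x)) \<longlonglongrightarrow> 0"
    proof (rule Lim_null_comparison[OF always_eventually, rotated], intro allI)
      fix k
      have co: "coeff (\<lambda>x. U t x - U (s k) x) n = c n t - c n (s k)" for n
        using L t s by (simp add: l2_inner_diff_left psi_L2)
      have "summable (\<lambda>n. (lam n * c n t - lam n * c n (s k))\<^sup>2)"
      proof (rule summable_comparison_test')
        show "summable (\<lambda>n. 2 * (lam n * c n t)\<^sup>2 + 2 * (lam n * c n (s k))\<^sup>2)"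
          by (intro summable_add summable_mult sq_dominated_sum[OF U(2)] t s)
        show "norm ((lam n * c n t - lam n * c n (s k))\<^sup>2) \<le> 2 * (lam n * c n t)\<^sup>2 + 2 * (lam n * c n (s k))\<^sup>2" for n
          using power2_diff_le by simp
      qed
      then show "norm (sobolev_norm \<Omega> (2 + \<gamma>) (\<lambda>x. U t x - U (s k) x))
          \<le> \<bar>C\<bar> * sqrt (\<Sum>n. (lam n * c n t - lam n * c n (s k))\<^sup>2)"
        using bd[OF L2_diff[OF L(1)[OF t] L(1)[OF s[of k]]]]
        by (simp add: co right_diff_distrib sobolev_norm_nonneg)
    qed
  qed
  obtain B where B: "\<And>t. t \<in> {0..T} \<Longrightarrow> (\<Sum>n. (lam n * c n t)\<^sup>2) \<le> B"
    using sq_dominated_sum_bounded[OF U(2)] by blast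
  have nb: "sobolev_norm \<Omega> (2 + \<gamma>) (U t) \<le> \<bar>C\<bar> * sqrt B" if "t \<in> {0<..<T}" for t
  proof -
    have t: "t \<in> {0..T}" using that by auto
    have "sobolev_norm \<Omega> (2 + \<gamma>) (U t) \<le> \<bar>C\<bar> * sqrt (\<Sum>n. (lam n * c n t)\<^sup>2)"
      using bd[OF L(1)[OF t] sm[OF t]] L(2)[OF t] by simp
    also have "\<dots> \<le> \<bar>C\<bar> * sqrt B" using B[OF t] by (intro mult_left_mono) auto
    finally show ?thesis .
  qed
  show ?thesis by (rule Linf_time_norm_finite[OF bm, of "\<bar>C\<bar> * sqrt B"], fact nb)
qed

section \<open>Coefficients of the data\<close>

text \<open>The coefficients of the approximating simple functions converge to those of
  \<open>g\<close> by continuity of the inner product, but only for almost every time; their limit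
  is therefore compared with the coefficient up to a null set.\<close>

lemma coeff_bochner_measurable:
  assumes "bochner_measurable T (L2 \<Omega>) (l2_norm \<Omega>) g"
  shows "(\<lambda>t. coeff (g t) n) \<in> borel_measurable (lebesgue_on {0<..<T})"
proof -
  let ?M = "lebesgue_on {0<..<T}"
  obtain s where s: "\<And>k. simple_function ?M (s k)" "\<And>k. s k ` {0<..<T} \<subseteq> L2 \<Omega>"
    "AE t in ?M. (\<lambda>k::nat. l2_dist \<Omega> (g t) (s k t)) \<longlonglongrightarrow> 0"
    and gL: "AE t in ?M. g t \<in> L2 \<Omega>"
    using assms unfolding bochner_measurable_def by blast
  have sm[measurable]: "(\<lambda>t. coeff (s k t) n) \<in> borel_measurable ?M" for k
    by (intro borel_measurable_simple_function simple_function_compose1[OF s(1)])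
  define h where "h t = lim (\<lambda>k. coeff (s k t) n)" for t
  have hm: "h \<in> borel_measurable ?M"
    unfolding h_def by (rule borel_measurable_lim_metric) (rule sm)
  have "AE t in ?M. h t = coeff (g t) n"
    using s(3) gL AE_space
  proof eventually_elim
    case (elim t)
    have "s k t \<in> L2 \<Omega>" for k using s(2)[of k] elim(3) by auto
    then have "(\<lambda>k. coeff (s k t) n) \<longlonglongrightarrow> coeff (g t) n"
      using elim by (intro l2_inner_tendsto psi_L2) (auto simp: l2_dist_commute[of \<Omega> "g t"])
    then show ?case unfolding h_def by (rule limI)
  qed
  with hm show ?thesis by (rule lebesgue_on_measurable_AE)
qed

lemma coeff_continuous_in_time:
  assumes "continuous_in_time T (L2 \<Omega>) (l2_norm \<Omega>) h"
  shows "continuous_on {0..T} (\<lambda>t. coeff (h t) n)"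
  unfolding continuous_on_def
proof
  fix t assume t: "t \<in> {0..T}"
  have L: "h t \<in> L2 \<Omega>" if "t \<in> {0..T}" for t using assms that by (simp add: continuous_in_time_def)
  have "((\<lambda>s. coeff (h s) n - coeff (h t) n) \<longlongrightarrow> 0) (at t within {0..T})"
  proof (rule Lim_null_comparison)
    show "((\<lambda>s. l2_dist \<Omega> (h s) (h t)) \<longlongrightarrow> 0) (at t within {0..T})"
      using assms t by (simp add: continuous_in_time_def)
    have "norm (coeff (h s) n - coeff (h t) n) \<le> l2_dist \<Omega> (h s) (h t)" if "s \<in> {0..T}" for s
      using coeff_bound[OF L2_diff[OF L[OF that] L[OF t]], of n] L[OF that] L[OF t]
      by (simp add: l2_inner_diff_left psi_L2)
    then show "\<forall>\<^sub>F s in at t within {0..T}. norm (coeff (h s) n - coeff (h t) n) \<le> l2_dist \<Omega> (h s) (h t)"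
      by (auto simp: eventually_at_filter intro!: always_eventually)
  qed
  then show "((\<lambda>s. coeff (h s) n) \<longlongrightarrow> coeff (h t) n) (at t within {0..T})"
    by (simp add: LIM_zero_iff)
qed

lemma coeff_AE_eq:
  assumes "AE t in lebesgue_on {0<..<T}. g t \<in> L2 \<Omega>" "\<And>t. t \<in> {0<..<T} \<Longrightarrow> h t \<in> L2 \<Omega>"
    and "AE t in lebesgue_on {0<..<T}. AE x in lebesgue_on \<Omega>. g t x = h t x"
  shows "AE t in lebesgue_on {0<..<T}. coeff (g t) n = coeff (h t) n"
  using assms(1,3) AE_space
proof eventually_elim
  case (elim t)
  then show ?case using assms(2)[of t] by (intro l2_inner_cong_AE L2_borel_measurable psi_L2) auto
qed

text \<open>Testing with \<psi>_n makes the weak derivative scalar. Modified representatives are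
  allowed because initial values belong to the continuous representatives of the forcing terms, not
  to the given functions of time.\<close>

lemma coeff_weak_derivative:
  assumes wd: "has_weak_time_deriv \<Omega> T g g'"
    and h: "AE t in lebesgue_on {0<..<T}. coeff (g t) n = h t" "continuous_on {0..T} h"
    and h': "AE t in lebesgue_on {0<..<T}. coeff (g' t) n = h' t"
      "h' \<in> borel_measurable (lebesgue_on {0<..<T})"
  shows "has_weak_derivative_on T h h'"
  unfolding has_weak_derivative_on_def
proof
  let ?M = "lebesgue_on {0<..<T}"
  fix \<theta> assume th: "\<theta> \<in> test_functions_time T"
  note th' = test_functions_time_D[OF th]
  have bm: "bochner_measurable T (L2 \<Omega>) (l2_norm \<Omega>) g" "bochner_measurable T (L2 \<Omega>) (l2_norm \<Omega>) g'"
    using wd by (auto simp: has_weak_time_deriv_def L1_time_def)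
  have m: "h \<in> borel_measurable ?M" "\<theta> \<in> borel_measurable ?M" "deriv \<theta> \<in> borel_measurable ?M"
    by (intro continuous_imp_measurable_on_sets_lebesgue continuous_on_subset[OF h(2)] th'; auto)+
  have "(LINT t|?M. coeff (g t) n * deriv \<theta> t) = - (LINT t|?M. coeff (g' t) n * \<theta> t)"
    using wd th psi_L2 by (simp add: has_weak_time_deriv_def)
  moreover have "(LINT t|?M. coeff (g t) n * deriv \<theta> t) = (LINT t|?M. h t * deriv \<theta> t)"
    using h(1) m coeff_bochner_measurable[OF bm(1)] by (intro integral_cong_AE) auto
  moreover have "(LINT t|?M. coeff (g' t) n * \<theta> t) = (LINT t|?M. h' t * \<theta> t)"
    using h' m coeff_bochner_measurable[OF bm(2)] by (intro integral_cong_AE) auto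
  ultimately show "(LINT t|?M. h t * deriv \<theta> t) = - (LINT t|?M. h' t * \<theta> t)" by simp
qed

text \<open>For the summability, Parseval at almost every time bounds each partial sum of squares by
  the squared norm; integrating gives one bound for all partial sums of the integrals.\<close>

lemma coeff_square_integrable:
  assumes g1: "g \<in> L1_time T (L2 \<Omega>) (l2_norm \<Omega>)" and g2: "g \<in> L2_time T (L2 \<Omega>) (l2_norm \<Omega>)"
  shows "integrable (lebesgue_on {0<..<T}) (\<lambda>t. coeff (g t) n)"
    and "integrable (lebesgue_on {0<..<T}) (\<lambda>t. (coeff (g t) n)\<^sup>2)"
    and "summable (\<lambda>n. LINT t|lebesgue_on {0<..<T}. (coeff (g t) n)\<^sup>2)"
proof -
  let ?M = "lebesgue_on {0<..<T}"
  have bm: "bochner_measurable T (L2 \<Omega>) (l2_norm \<Omega>) g"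
    and i1: "integrable ?M (\<lambda>t. l2_norm \<Omega> (g t))" and i2: "integrable ?M (\<lambda>t. (l2_norm \<Omega> (g t))\<^sup>2)"
    using g1 g2 by (auto simp: L1_time_def L2_time_def)
  have gL: "AE t in ?M. g t \<in> L2 \<Omega>" using bm by (simp add: bochner_measurable_def)
  note m = coeff_bochner_measurable[OF bm]
  show "integrable ?M (\<lambda>t. coeff (g t) n)" for n
    by (rule Bochner_Integration.integrable_bound[OF i1 m])
      (use gL in eventually_elim, simp add: coeff_bound l2_norm_nonneg)
  show sq: "integrable ?M (\<lambda>t. (coeff (g t) n)\<^sup>2)" for n
  proof (rule Bochner_Integration.integrable_bound[OF i2])
    show "(\<lambda>t. (coeff (g t) n)\<^sup>2) \<in> borel_measurable ?M" using m by (intro borel_measurable_power)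
    show "AE t in ?M. norm ((coeff (g t) n)\<^sup>2) \<le> norm ((l2_norm \<Omega> (g t))\<^sup>2)"
      using gL
    proof eventually_elim
      case (elim t)
      have "\<bar>coeff (g t) n\<bar>\<^sup>2 \<le> (l2_norm \<Omega> (g t))\<^sup>2" by (intro power_mono coeff_bound elim) simp
      then show ?case by simp
    qed
  qed
  show "summable (\<lambda>n. LINT t|?M. (coeff (g t) n)\<^sup>2)"
  proof (rule summableI_nonneg_bounded)
    fix N
    have "(\<Sum>n<N. LINT t|?M. (coeff (g t) n)\<^sup>2) = (LINT t|?M. (\<Sum>n<N. (coeff (g t) n)\<^sup>2))"
      using sq by (simp add: Bochner_Integration.integral_sum)
    also have "\<dots> \<le> (LINT t|?M. (l2_norm \<Omega> (g t))\<^sup>2)"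
    proof (rule integral_mono_AE)
      show "integrable ?M (\<lambda>t. \<Sum>n<N. (coeff (g t) n)\<^sup>2)" using sq by (intro Bochner_Integration.integrable_sum)
      show "AE t in ?M. (\<Sum>n<N. (coeff (g t) n)\<^sup>2) \<le> (l2_norm \<Omega> (g t))\<^sup>2"
        using gL
      proof eventually_elim
        case (elim t)
        then show ?case using Parseval_norm[of "g t"] sum_le_suminf[of "\<lambda>n. (coeff (g t) n)\<^sup>2" "{..<N}"]
          by (auto simp: sums_iff)
      qed
    qed (rule i2)
    finally show "(\<Sum>n<N. LINT t|?M. (coeff (g t) n)\<^sup>2) \<le> (LINT t|?M. (l2_norm \<Omega> (g t))\<^sup>2)" .
  qed simp
qed

end

section \<open>Coefficients of the solution\<close>

lemma has_real_derivative_of_integral: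
  fixes c d :: "real \<Rightarrow> real"
  assumes "\<And>t. t \<in> {0..T} \<Longrightarrow> c t - c 0 = integral {0..t} d" "continuous_on {0..T} d" "t \<in> {0..T}"
  shows "(c has_real_derivative d t) (at t within {0..T})"
proof -
  have "((\<lambda>t. integral {0..t} d + c 0) has_real_derivative d t + 0) (at t within {0..T})"
    by (intro DERIV_add integral_has_real_derivative assms(2,3) DERIV_const)
  then have "((\<lambda>t. integral {0..t} d + c 0) has_real_derivative d t) (at t within {0..T})" by simp
  then show ?thesis
  proof (rule has_field_derivative_transform_within[OF _ zero_less_one assms(3)])
    show "integral {0..s} d + c 0 = c s" if "s \<in> {0..T}" for s using assms(1)[OF that] by simp
  qed
qed

lemma negligible_AE_lebesgue_on:
  fixes P :: "real \<Rightarrow> bool"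
  assumes "AE t in lebesgue_on {a<..<b}. P t"
  shows "negligible {t \<in> {a<..<b}. \<not> P t}"
proof -
  have "AE t in lebesgue. t \<in> {a<..<b} \<longrightarrow> P t"
    using assms by (subst (asm) AE_restrict_space_iff) auto
  then obtain N where "N \<in> null_sets lebesgue" "{t. \<not> (t \<in> {a<..<b} \<longrightarrow> P t)} \<subseteq> N"
    unfolding eventually_ae_filter by auto
  then have "negligible N" "{t \<in> {a<..<b}. \<not> P t} \<subseteq> N" by (auto simp: negligible_iff_null_sets)
  then show ?thesis by (rule negligible_subset)
qed

lemma summable_power2_diff:
  fixes a b :: "nat \<Rightarrow> real"
  assumes "summable (\<lambda>n. (a n)\<^sup>2)" "summable (\<lambda>n. (b n)\<^sup>2)"
  shows "summable (\<lambda>n. (a n - b n)\<^sup>2)"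
proof (rule summable_comparison_test')
  show "summable (\<lambda>n. 2 * (a n)\<^sup>2 + 2 * (b n)\<^sup>2)" by (intro summable_add summable_mult assms)
  show "norm ((a n - b n)\<^sup>2) \<le> 2 * (a n)\<^sup>2 + 2 * (b n)\<^sup>2" for n using power2_diff_le by simp
qed

context clamped_plate
begin

text \<open>The spectrum stays above lam_0 > 0, so lower powers of the operator are controlled by
  higher ones. This lowers the exponents of the initial data where less than their full regularity
  is wanted.\<close>

lemma summable_lam_cancel:
  assumes "summable (\<lambda>n. lam n * a n)" "\<And>n. 0 \<le> a n" shows "summable a"
proof (rule summable_comparison_test')
  show "summable (\<lambda>n. (1 / lam 0) * (lam n * a n))" by (rule summable_mult[OF assms(1)])
  fix n
  have "lam 0 * a n \<le> lam n * a n" by (rule mult_right_mono[OF lam_ge assms(2)])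
  then show "norm (a n) \<le> (1 / lam 0) * (lam n * a n)"
    using lam_pos[of 0] assms(2)[of n] by (simp add: field_simps)
qed

lemma sq_dominated_lam_cancel:
  assumes "sq_dominated T (\<lambda>n t. lam n * c n t)" shows "sq_dominated T c"
proof (rule sq_dominated_bound[OF assms, where K = "1 / lam 0"])
  fix n t
  have "lam 0 * \<bar>c n t\<bar> \<le> lam n * \<bar>c n t\<bar>" by (rule mult_right_mono[OF lam_ge]) simp
  then show "\<bar>c n t\<bar> \<le> 1 / lam 0 * \<bar>lam n * c n t\<bar>"
    using lam_pos[of 0] lam_pos[of n] by (simp add: field_simps abs_mult)
qed

lemma coeff_time_deriv:
  assumes d: "has_time_deriv T (l2_norm \<Omega>) u u'"
    and L: "\<And>t. t \<in> {0..T} \<Longrightarrow> u t \<in> L2 \<Omega>" "\<And>t. t \<in> {0..T} \<Longrightarrow> u' t \<in> L2 \<Omega>" and t: "t \<in> {0..T}"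
  shows "((\<lambda>t. coeff (u t) n) has_real_derivative coeff (u' t) n) (at t within {0..T})"
proof -
  have "((\<lambda>s. (coeff (u s) n - coeff (u t) n) / (s - t) - coeff (u' t) n) \<longlongrightarrow> 0) (at t within {0..T})"
  proof (rule Lim_null_comparison)
    show "((\<lambda>s. l2_norm \<Omega> (\<lambda>x. (u s x - u t x) / (s - t) - u' t x)) \<longlongrightarrow> 0) (at t within {0..T})"
      using d t by (simp add: has_time_deriv_def)
    have "norm ((coeff (u s) n - coeff (u t) n) / (s - t) - coeff (u' t) n)
        \<le> l2_norm \<Omega> (\<lambda>x. (u s x - u t x) / (s - t) - u' t x)" if "s \<in> {0..T}" for s
    proof -
      define q where "q x = (1 / (s - t)) * (u s x - u t x)" for x
      have q: "q \<in> L2 \<Omega>" unfolding q_def[abs_def] by (intro L2_scale L2_diff L that t)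
      have cq: "coeff q n = (coeff (u s) n - coeff (u t) n) / (s - t)"
        unfolding q_def[abs_def] l2_inner_scale_left using L that t
        by (simp add: l2_inner_diff_left psi_L2)
      have "\<bar>coeff q n - coeff (u' t) n\<bar> \<le> l2_dist \<Omega> q (u' t)"
        using coeff_bound[OF L2_diff[OF q L(2)[OF t]], of n] q L(2)[OF t] by (simp add: l2_inner_diff_left psi_L2)
      then show ?thesis unfolding cq by (simp add: q_def)
    qed
    then show "\<forall>\<^sub>F s in at t within {0..T}. norm ((coeff (u s) n - coeff (u t) n) / (s - t) - coeff (u' t) n)
        \<le> l2_norm \<Omega> (\<lambda>x. (u s x - u t x) / (s - t) - u' t x)"
      by (auto simp: eventually_at_filter intro!: always_eventually)
  qed
  then show ?thesis by (simp add: has_field_derivative_iff LIM_zero_iff)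
qed

end

theorem lemma1p1:
  fixes \<Omega> :: "(real^2) set" and T \<gamma>0 :: real
    and lam :: "nat \<Rightarrow> real" and \<psi> :: "nat \<Rightarrow> real^2 \<Rightarrow> real"
    and f ft ftt fttt u :: "real \<Rightarrow> real^2 \<Rightarrow> real"
    and u0 v0 :: "real^2 \<Rightarrow> real"
  assumes "bounded_polygonal_lipschitz_domain \<Omega>" and "T > 0"
    and "biharmonic_eigensystem \<Omega> lam \<psi>"
    and "elliptic_regularity_index \<Omega> lam \<psi> \<gamma>0"
    and "biharmonic_wave_weak_solution \<Omega> T f u0 v0 u"
    and "has_weak_time_deriv \<Omega> T f ft"
    and "has_weak_time_deriv \<Omega> T ft ftt"
    and "has_weak_time_deriv \<Omega> T ftt fttt"
    and "u0 \<in> dom_A_pow \<Omega> lam \<psi> 2"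
    and "v0 \<in> dom_A_pow \<Omega> lam \<psi> (3 / 2)"
    and "\<exists>y \<in> dom_A \<Omega>. has_initial_value \<Omega> T f y"
    and "\<exists>y \<in> dom_A_pow \<Omega> lam \<psi> (1 / 2). has_initial_value \<Omega> T ft y"
    and "\<exists>y \<in> L2 \<Omega>. has_initial_value \<Omega> T ftt y"
    and "f \<in> L2_time T (L2 \<Omega>) (l2_norm \<Omega>)"
    and "ft \<in> L2_time T (L2 \<Omega>) (l2_norm \<Omega>)"
    and "ftt \<in> L2_time T (L2 \<Omega>) (l2_norm \<Omega>)"
    and "fttt \<in> L2_time T (L2 \<Omega>) (l2_norm \<Omega>)"
  shows "\<exists>ut utt uttt utttt.
     has_weak_time_deriv \<Omega> T u ut \<and> has_weak_time_deriv \<Omega> T ut utt \<and>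
     has_weak_time_deriv \<Omega> T utt uttt \<and> has_weak_time_deriv \<Omega> T uttt utttt \<and>
     Linf_time_norm T (sobolev \<Omega> (2 + \<gamma>0)) (sobolev_norm \<Omega> (2 + \<gamma>0)) u < \<infinity> \<and>
     Linf_time_norm T (sobolev \<Omega> (2 + \<gamma>0)) (sobolev_norm \<Omega> (2 + \<gamma>0)) ut < \<infinity> \<and>
     Linf_time_norm T (L2 \<Omega>) (l2_norm \<Omega>) utt < \<infinity> \<and>
     Linf_time_norm T (sobolev \<Omega> (2 + \<gamma>0)) (sobolev_norm \<Omega> (2 + \<gamma>0)) utt < \<infinity> \<and>
     Linf_time_norm T (L2 \<Omega>) (l2_norm \<Omega>) uttt < \<infinity> \<and>
     Linf_time_norm T (L2 \<Omega>) (l2_norm \<Omega>) utttt < \<infinity>"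
proof -
  let ?M = "lebesgue_on {0<..<T}"
  note T = \<open>T > 0\<close>
  interpret clamped_plate \<Omega> lam \<psi>
    by unfold_locales (use assms(1,3) in \<open>auto simp: bounded_polygonal_lipschitz_domain_def lipschitz_domain_def\<close>)

  \<comment> \<open>Coefficients of the solution and of the continuous representatives of the
    forcing\<close>
  obtain ut where uH: "continuous_in_time T (H20 \<Omega>) (sobolev_norm \<Omega> 2) u"
    and ut: "continuous_in_time T (L2 \<Omega>) (l2_norm \<Omega>) ut" "has_time_deriv T (l2_norm \<Omega>) u ut"
    and eq: "\<And>v t. v \<in> H20 \<Omega> \<Longrightarrow> t \<in> {0<..<T} \<Longrightarrow> \<exists>d.
           ((\<lambda>s. l2_inner \<Omega> (ut s) v) has_real_derivative d) (at t) \<and>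
           d + hessian_form \<Omega> (u t) v = l2_inner \<Omega> (f t) v"
    and ini: "AE x in lebesgue_on \<Omega>. u 0 x = u0 x" "AE x in lebesgue_on \<Omega>. ut 0 x = v0 x"
    using assms(5) unfolding biharmonic_wave_weak_solution_def by blast
  have uL: "u t \<in> H20 \<Omega>" "u t \<in> L2 \<Omega>" "ut t \<in> L2 \<Omega>" if "t \<in> {0..T}" for t
    using uH ut(1) that by (auto simp: continuous_in_time_def intro: H20_L2)
  obtain F0 where F0: "continuous_in_time T (L2 \<Omega>) (l2_norm \<Omega>) F0"
    "AE t in ?M. AE x in lebesgue_on \<Omega>. f t x = F0 t x" "F0 0 \<in> dom_A \<Omega>"
    using assms(11) unfolding has_initial_value_def by blast
  obtain F1 where F1: "continuous_in_time T (L2 \<Omega>) (l2_norm \<Omega>) F1"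
    "AE t in ?M. AE x in lebesgue_on \<Omega>. ft t x = F1 t x" "F1 0 \<in> dom_A_pow \<Omega> lam \<psi> (1 / 2)"
    using assms(12) unfolding has_initial_value_def by blast
  obtain F2 where F2: "continuous_in_time T (L2 \<Omega>) (l2_norm \<Omega>) F2"
    "AE t in ?M. AE x in lebesgue_on \<Omega>. ftt t x = F2 t x" "F2 0 \<in> L2 \<Omega>"
    using assms(13) unfolding has_initial_value_def by blast
  define y y1 f0 f1 f2 m where "y n t = coeff (u t) n" and "y1 n t = coeff (ut t) n"
    and "f0 n t = coeff (F0 t) n" and "f1 n t = coeff (F1 t) n" and "f2 n t = coeff (F2 t) n"
    and "m n t = coeff (fttt t) n" for n t
  have fc: "continuous_on {0..T} (f0 n)" "continuous_on {0..T} (f1 n)" "continuous_on {0..T} (f2 n)" for n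
    unfolding f0_def[abs_def] f1_def[abs_def] f2_def[abs_def]
    using F0(1) F1(1) F2(1) by (intro coeff_continuous_in_time; simp)+
  have gL: "AE t in ?M. g t \<in> L2 \<Omega>" if "g \<in> L2_time T (L2 \<Omega>) (l2_norm \<Omega>)" for g
    using that by (simp add: L2_time_def bochner_measurable_def)
  have AEf: "AE t in ?M. coeff (f t) n = f0 n t" "AE t in ?M. coeff (ft t) n = f1 n t"
    "AE t in ?M. coeff (ftt t) n = f2 n t" for n
    unfolding f0_def f1_def f2_def
    using F0(1) F1(1) F2(1)
    by (intro coeff_AE_eq gL assms(14-16) F0(2) F1(2) F2(2); simp add: continuous_in_time_def)+
  have fm: "f0 n \<in> borel_measurable ?M" "f1 n \<in> borel_measurable ?M" "f2 n \<in> borel_measurable ?M" for n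
    using fc[THEN integrable_continuous_time, of n] by (auto dest: borel_measurable_integrable)
  have fttt: "fttt \<in> L1_time T (L2 \<Omega>) (l2_norm \<Omega>)" using assms(8) by (simp add: has_weak_time_deriv_def)
  note m = coeff_square_integrable[OF fttt assms(17), folded m_def]
  have wd2: "has_weak_derivative_on T (f2 n) (m n)" for n
    by (rule coeff_weak_derivative[OF assms(8) AEf(3) fc(3)])
      (use m(1)[of n] in \<open>auto simp: m_def[symmetric] dest: borel_measurable_integrable\<close>)
  \<comment> \<open>The weak derivative of \<open>f0 n\<close> has the continuous representative
    \<open>f1 n\<close>, so the fundamental theorem upgrades it to a classical derivative. The same
    works one order higher, but not for \<open>f2 n\<close>, whose weak derivative
    \<open>m n\<close> is merely square-integrable.\<close>
  have Df0: "(f0 n has_real_derivative f1 n t) (at t within {0..T})" if "t \<in> {0..T}" for n t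
    by (intro has_real_derivative_of_integral weak_derivative_FTC[OF fc(1) integrable_continuous_time[OF fc(2)]
          coeff_weak_derivative[OF assms(6) AEf(1) fc(1) AEf(2) fm(2)] _ T] fc that)
  have Df1: "(f1 n has_real_derivative f2 n t) (at t within {0..T})" if "t \<in> {0..T}" for n t
    by (intro has_real_derivative_of_integral weak_derivative_FTC[OF fc(2) integrable_continuous_time[OF fc(3)]
          coeff_weak_derivative[OF assms(7) AEf(2) fc(2) AEf(3) fm(3)] _ T] fc that)

  \<comment> \<open>The oscillator equations, with the higher derivatives read off from the
    equation\<close>
  define y2 y3 y4 where "y2 n t = f0 n t - lam n * y n t" and "y3 n t = f1 n t - lam n * y1 n t"
    and "y4 n t = f2 n t - lam n * y2 n t" for n t
  have Dy: "(y n has_real_derivative y1 n t) (at t within {0..T})" if "t \<in> {0..T}" for n t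
    unfolding y_def[abs_def] y1_def by (rule coeff_time_deriv[OF ut(2) uL(2,3) that])
  have yc: "continuous_on {0..T} (y n)" for n
    using Dy by (meson DERIV_continuous continuous_on_eq_continuous_within)
  have y1c: "continuous_on {0..T} (y1 n)" for n
    unfolding y1_def[abs_def] by (rule coeff_continuous_in_time[OF ut(1)])
  have y2c: "continuous_on {0..T} (y2 n)" for n
    unfolding y2_def[abs_def] by (intro continuous_intros fc yc)
  have y3c: "continuous_on {0..T} (y3 n)" for n
    unfolding y3_def[abs_def] by (intro continuous_intros fc y1c)
  have y4c: "continuous_on {0..T} (y4 n)" for n
    unfolding y4_def[abs_def] by (intro continuous_intros fc y2c)
  \<comment> \<open>The weak equation differentiates \<open>y1 n\<close> only at interior times, and
    with \<open>f\<close> in place of its continuous representative. Integration removes the null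
    set where the two differ and the endpoints; since \<open>y2 n\<close> is continuous,
    differentiating the integral again is valid on the closed interval.\<close>
  have Dy1: "(y1 n has_real_derivative y2 n t) (at t within {0..T})" if "t \<in> {0..T}" for n t
  proof (rule has_real_derivative_of_integral[OF _ y2c that])
    fix t assume t: "t \<in> {0..T}"
    have "((\<lambda>s. coeff (f s) n - lam n * y n s) has_integral y1 n t - y1 n 0) {0..t}"
    proof (rule fundamental_theorem_of_calculus_interior)
      show "continuous_on {0..t} (y1 n)" using t by (intro continuous_on_subset[OF y1c]) auto
      fix s assume "s \<in> {0<..<t}"
      then have s: "s \<in> {0<..<T}" "s \<in> {0..T}" using t by auto
      obtain d where "((\<lambda>s. coeff (ut s) n) has_real_derivative d) (at s)"
        "d + hessian_form \<Omega> (u s) (\<psi> n) = coeff (f s) n"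
        using eq[OF psi_H20 s(1)] by blast
      moreover from this(2) have "d = coeff (f s) n - lam n * y n s"
        by (simp add: hessian_form_psi[OF uL(1)[OF s(2)]] y_def)
      ultimately show "(y1 n has_vector_derivative coeff (f s) n - lam n * y n s) (at s)"
        by (simp add: y1_def[abs_def] has_real_derivative_iff_has_vector_derivative)
    qed (use t in auto)
    then have "(y2 n has_integral y1 n t - y1 n 0) {0..t}"
    proof (rule has_integral_spike[rotated 2])
      show "negligible ({t \<in> {0<..<T}. coeff (f t) n \<noteq> f0 n t} \<union> {0, T})"
        using negligible_AE_lebesgue_on[OF AEf(1)] by (intro negligible_Un) auto
      show "y2 n s = coeff (f s) n - lam n * y n s"
        if "s \<in> {0..t} - ({t \<in> {0<..<T}. coeff (f t) n \<noteq> f0 n t} \<union> {0, T})" for s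
        using that t by (auto simp: y2_def)
    qed
    then show "y1 n t - y1 n 0 = integral {0..t} (y2 n)" by (simp add: integral_unique)
  qed
  have Dy2: "(y2 n has_real_derivative y3 n t) (at t within {0..T})" if "t \<in> {0..T}" for n t
    unfolding y2_def[abs_def] y3_def by (intro DERIV_diff DERIV_cmult Df0 Dy that)
  have Dy3: "(y3 n has_real_derivative y4 n t) (at t within {0..T})" if "t \<in> {0..T}" for n t
    unfolding y3_def[abs_def] y4_def by (intro DERIV_diff DERIV_cmult Df1 Dy1 that)

  \<comment> \<open>Square-summability of the initial values\<close>
  have T0: "0 \<in> {0..T}" using T by simp
  have y0: "y n 0 = coeff u0 n" and y10: "y1 n 0 = coeff v0 n" for n
    unfolding y_def y1_def using ini uL[OF T0] assms(9,10)
    by (auto intro!: l2_inner_cong_AE L2_borel_measurable psi_L2 simp: dom_A_pow_def)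
  \<comment> \<open>The exponents 2 r of \<open>dom_A_pow\<close> for r = 2, 3/2 and 1/2.\<close>
  have lpow: "lam n powr 4 = lam n ^ 4" "lam n powr 3 = lam n ^ 3" "lam n powr 1 = lam n" for n
    using lam_pos[of n] by auto
  have s_y0: "summable (\<lambda>n. (lam n * (lam n * y n 0))\<^sup>2)"
    using assms(9) by (simp add: dom_A_pow_def y0 lpow power_mult_distrib power4_eq_xxxx power2_eq_square mult_ac)
  have s_y10: "summable (\<lambda>n. lam n * (lam n * y1 n 0)\<^sup>2)"
    using assms(10) by (simp add: dom_A_pow_def y10 lpow power_mult_distrib power3_eq_cube power2_eq_square mult_ac)
  have s_f0: "summable (\<lambda>n. (lam n * f0 n 0)\<^sup>2)"
    using dom_A_summable[OF F0(3)] by (simp add: f0_def)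
  have s_f1: "summable (\<lambda>n. lam n * (f1 n 0)\<^sup>2)"
    using F1(3) lpow(3) by (simp add: dom_A_pow_def f1_def)
  have s_f2: "summable (\<lambda>n. (f2 n 0)\<^sup>2)"
    using Parseval_norm[OF F2(3)] by (simp add: f2_def sums_iff)
  have s_y4: "summable (\<lambda>n. (y4 n 0)\<^sup>2)"
    using summable_power2_diff[OF s_f2 summable_power2_diff[OF s_f0 s_y0]]
    by (simp add: y4_def y2_def right_diff_distrib)
  \<comment> \<open>The weight is absorbed as a square root, so that the difference of the
    coefficients of A^(1/2) f_t(0) and A^(3/2) v^0 can be treated as a difference of square-summable
    sequences.\<close>
  have s_y3: "summable (\<lambda>n. lam n * (y3 n 0)\<^sup>2)"
  proof -
    have sq: "(sqrt (lam n) * a)\<^sup>2 = lam n * a\<^sup>2" for n a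
      using lam_pos[of n] by (simp add: power_mult_distrib)
    have "summable (\<lambda>n. (sqrt (lam n) * f1 n 0 - sqrt (lam n) * (lam n * y1 n 0))\<^sup>2)"
      by (rule summable_power2_diff) (use s_f1 s_y10 in \<open>simp_all only: sq\<close>)
    then show ?thesis by (simp only: right_diff_distrib[symmetric] sq y3_def)
  qed

  \<comment> \<open>Domination uniform in time, descending from the fourth derivative\<close>
  have u4: "sq_dominated T y4"
  proof (rule sq_dominatedI)
    show "summable (\<lambda>n. 3 * ((y4 n 0)\<^sup>2 + lam n * (y3 n 0)\<^sup>2 + T * (LINT t|?M. (m n t)\<^sup>2)))"
      by (intro summable_mult summable_add s_y4 s_y3 m(3))
    show "(y4 n t)\<^sup>2 \<le> 3 * ((y4 n 0)\<^sup>2 + lam n * (y3 n 0)\<^sup>2 + T * (LINT t|?M. (m n t)\<^sup>2))"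
      if "t \<in> {0..T}" for n t
      unfolding y4_def
      by (rule oscillator_fourth_derivative_bound[OF T lam_pos Dy2 Dy3[unfolded y4_def] fc(3) m(1,2) wd2 that])
  qed
  have uf2: "sq_dominated T f2"
  proof (rule sq_dominatedI)
    show "summable (\<lambda>n. 2 * (T * (LINT t|?M. (m n t)\<^sup>2)) + 2 * (f2 n 0)\<^sup>2)"
      by (intro summable_mult summable_add s_f2 m(3))
    fix n t assume t: "t \<in> {0..T}"
    have "f2 n t - f2 n 0 = integral {0..t} (m n)"
      by (rule weak_derivative_FTC[OF fc(3) m(1) wd2 t T])
    then have "(f2 n t - f2 n 0)\<^sup>2 \<le> T * (LINT t|?M. (m n t)\<^sup>2)"
      \<comment> \<open>The weighted integral estimate with the constant weight 1.\<close>
      using integral_mult_power2_le[OF T m(1,2) continuous_on_const[of _ 1] _ t, of n] by simp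
    then show "(f2 n t)\<^sup>2 \<le> 2 * (T * (LINT t|?M. (m n t)\<^sup>2)) + 2 * (f2 n 0)\<^sup>2"
      using power2_diff_le[of "f2 n t - f2 n 0" "- f2 n 0"] by simp
  qed
  have ul2: "sq_dominated T (\<lambda>n t. lam n * y2 n t)"
    using sq_dominated_diff[OF uf2 u4] by (simp add: y4_def)
  have ul1: "sq_dominated T (\<lambda>n t. lam n * y1 n t)"
    by (rule sq_dominated_primitive[OF ul2 summable_lam_cancel[OF s_y10] DERIV_cmult[OF Dy1]]) simp_all
  have ul0: "sq_dominated T (\<lambda>n t. lam n * y n t)"
  proof (rule sq_dominated_primitive[OF ul1 _ DERIV_cmult[OF Dy]])
    \<comment> \<open>The fourth power of lam_n provided by D(A^2) is split so that two factors can
      be cancelled one after the other.\<close>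
    have "summable (\<lambda>n. lam n * (lam n * (lam n * y n 0)\<^sup>2))"
      using s_y0 by (simp add: power2_eq_square mult.assoc mult.left_commute)
    then show "summable (\<lambda>n. (lam n * y n 0)\<^sup>2)"
      using lam_pos[THEN less_imp_le] summable_lam_cancel[of "\<lambda>n. lam n * (lam n * y n 0)\<^sup>2"]
        summable_lam_cancel[of "\<lambda>n. (lam n * y n 0)\<^sup>2"] by simp
  qed
  have u3: "sq_dominated T y3"
    by (rule sq_dominated_primitive[OF u4 summable_lam_cancel[OF s_y3] Dy3]) simp_all
  note u2 = sq_dominated_lam_cancel[OF ul2]
    and u1 = sq_dominated_lam_cancel[OF ul1]
    and u0 = sq_dominated_lam_cancel[OF ul0]

  \<comment> \<open>Reconstruction of the time derivatives and finiteness of the norms\<close>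
  have C0: "has_coeffs T u y" using uL(2) by (simp add: has_coeffs_def y_def)
  have C1: "has_coeffs T ut y1" using uL(3) by (simp add: has_coeffs_def y1_def)
  \<comment> \<open>The weak formulation provides only \<open>u\<close> and \<open>ut\<close> as
    functions; the higher derivatives are assembled from their coefficients by Riesz-Fischer at
    every time.\<close>
  obtain utt uttt utttt where C2: "has_coeffs T utt y2" and C3: "has_coeffs T uttt y3"
    and C4: "has_coeffs T utttt y4"
    using has_coeffs_exists[OF u2] has_coeffs_exists[OF u3] has_coeffs_exists[OF u4] by blast
  show ?thesis
    by (intro exI conjI)
      ((rule has_coeffs_weak_time_deriv[OF T C0 u0 C1 u1 y1c Dy]
        has_coeffs_weak_time_deriv[OF T C1 u1 C2 u2 y2c Dy1]
        has_coeffs_weak_time_deriv[OF T C2 u2 C3 u3 y3c Dy2]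
        has_coeffs_weak_time_deriv[OF T C3 u3 C4 u4 y4c Dy3]
        has_coeffs_Linf_sobolev[OF T assms(4) C0 ul0 yc]
        has_coeffs_Linf_sobolev[OF T assms(4) C1 ul1 y1c]
        has_coeffs_Linf_L2[OF T C2 u2 y2c]
        has_coeffs_Linf_sobolev[OF T assms(4) C2 ul2 y2c]
        has_coeffs_Linf_L2[OF T C3 u3 y3c]
        has_coeffs_Linf_L2[OF T C4 u4 y4c]; assumption?)+)
qed

end
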